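(* Let $n,k\ge 1$ be integers, not both equal to $1$, let $\varLambda\subset\mathbb R^n$ be a lattice with $|\det(\varLambda)|=1$, let $V=V(\varLambda,k)$ be the set of $k$-free points of $\varLambda$, and let $\mathbb X(V)=\overline{\{t+V\mid t\in\varLambda\}}\subset\{0,1\}^{\varLambda}$ be its discrete hull, on which $\varLambda$ acts by translation. The topological dynamical system $(\mathbb X(V),\varLambda)$ has the following properties. (a) $(\mathbb X(V),\varLambda)$ is topologically ergodic with positive topological entropy equal to $1/\zeta(nk)$, where $\zeta$ is Riemann's zeta function. (b) $(\mathbb X(V),\varLambda)$ is proximal (i.e., for any $X,Y\in\mathbb X(V)$ one has $\inf_{t\in\varLambda}\mathrm d(X+t,Y+t)=0$), and $\{\varnothing\}$ is the unique $\varLambda$-minimal subset of $\mathbb X(V)$. (c) $(\mathbb X(V),\varLambda)$ has no non-trivial topological Kronecker factor (i.e., minimal equicontinuous factor). In particular, $(\mathbb X(V),\varLambda)$ has trivial topological point spectrum. (d) $(\mathbb X(V),\varLambda)$ has a non-trivial joining with the Kronecker system $K=(G,\varLambda)$, where $G$ is the compact Abelian group $\prod_p(\varLambda/p^k\varLambda)$ (product over all primes $p$) and $\varLambda$ acts on $G$ via addition on the diagonal, $g\mapsto g+(\bar x,\bar x,\dots)$, with $g\in G$ and $x\in\varLambda$. In particular, $(\mathbb X(V),\varLambda)$ fails to be topologically weakly mixing.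
   Context: $k$-free points: $V(\varLambda,k)$ is the set of points of $\varLambda$ for which the greatest common divisor of the coordinates in any lattice basis of $\varLambda$ is not divisible by any non-trivial $k$th power of an integer; equivalently $V=\varLambda\setminus\bigcup_p p^k\varLambda$, with $p$ running through all primes. Hull: the power set of $\varLambda$ is identified with $\{0,1\}^{\varLambda}$ and given the product topology of the discrete topology on $\{0,1\}$; it is compact, and is metrised by $\mathrm d(X,Y)=\min\{1,\inf\{\epsilon>0\mid X\cap B_{1/\epsilon}(0)=Y\cap B_{1/\epsilon}(0)\}\}$, where $B_R(0)$ is the open ball of radius $R$ about $0$ in $\mathbb R^n$. The group $\varLambda$ acts continuously by translation $X\mapsto X+t$. The hull $\mathbb X(V)$ is the closure of the $\varLambda$-orbit of $V$ in $\{0,1\}^{\varLambda}$; it contains the empty set $\varnothing$. Write $v_n=\operatorname{vol}(B_1(0))$. Topological ergodicity: for any two non-empty open subsets $U,W$ of $\mathbb X(V)$ one has $\limsup_{R\to\infty}\frac{1}{v_nR^n}\sum_{t\in\varLambda\cap B_R(0)}\theta(U\cap(W+t))>0$, where $\theta(\varnothing)=0$ and $\theta(A)=1$ for non-empty $A\subset\mathbb X(V)$. Topological entropy of the $\varLambda$-action is taken with logarithm to base $2$ and normalised by volume: it is $\sup_{\mathcal U}\lim_{R\to\infty}\frac{1}{v_nR^n}\log_2 N\big(\bigvee_{t\in\varLambda\cap B_R(0)}(\mathcal U-t)\big)$, the supremum being over finite open covers $\mathcal U$ of $\mathbb X(V)$ and $N$ denoting the minimal cardinality of a subcover. A $\varLambda$-minimal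 subset is a non-empty closed $\varLambda$-invariant subset containing no proper non-empty closed $\varLambda$-invariant subset. A topological factor is the image under a continuous surjective $\varLambda$-equivariant map; it is trivial if it is a one-point system. A continuous eigenfunction is a continuous $f:\mathbb X(V)\to\mathbb C$, $f\not\equiv 0$, such that for each $t\in\varLambda$ there is $\lambda_t\in\mathbb C$ with $f(X-t)=\lambda_t f(X)$ for all $X\in\mathbb X(V)$. Trivial topological point spectrum means that for every continuous eigenfunction all $\lambda_t=1$ and $f$ is constant. A (topological) joining of two systems $(\mathbb X,\varLambda)$ and $(\mathbb Y,\varLambda)$ is a closed subset of $\mathbb X\times\mathbb Y$ that is invariant under the diagonal action of $\varLambda$ and projects onto both $\mathbb X$ and $\mathbb Y$; it is non-trivial if it is not all of $\mathbb X\times\mathbb Y$. A system $(\mathbb X,\varLambda)$ is topologically weakly mixing if $\mathbb X\times\mathbb X$ with the diagonal action is topologically transitive, i.e. for any two non-empty open sets $U,W\subset\mathbb X\times\mathbb X$ there is $t\in\varLambda$ with $U\cap(W+t)\ne\varnothing$. *)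

theory Defs
  imports
    "HOL-Analysis.Analysis"
    "HOL-Algebra.Product_Groups"
    "HOL-Computational_Algebra.Primes"
begin

subsection \<open>Lattices and \<open>k\<close>-free points\<close>

(* The columns of B are the basis vectors, z is the vector of coordinates. *)
definition lattice_point :: "real^'n^'n \<Rightarrow> int^'n \<Rightarrow> real^'n" where
  "lattice_point B z = B *v (\<chi> i. real_of_int (z $ i))"

definition lattice_basis :: "real^'n^'n \<Rightarrow> (real^'n) set \<Rightarrow> bool" where
  "lattice_basis B \<Lambda> \<longleftrightarrow> invertible B \<and> \<Lambda> = range (lattice_point B)"

definition is_lattice :: "(real^'n) set \<Rightarrow> bool" where
  "is_lattice \<Lambda> \<longleftrightarrow> (\<exists>B. lattice_basis B \<Lambda>)"

(* The determinant of a basis depends on the basis only up to sign, so that just the absolute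
   value of this number is canonical. *)
definition lattice_det :: "(real^'n) set \<Rightarrow> real" where
  "lattice_det \<Lambda> = det (SOME B. lattice_basis B \<Lambda>)"

(* The Gcd of the zero vector is 0, which is divisible by everything: 0 is not k-free. *)
definition k_free_points :: "(real^'n) set \<Rightarrow> nat \<Rightarrow> (real^'n) set" where
  "k_free_points \<Lambda> k = {x \<in> \<Lambda>. \<forall>B z. lattice_basis B \<Lambda> \<longrightarrow> x = lattice_point B z \<longrightarrow>
     \<not> (\<exists>m::int. m > 1 \<and> m ^ k dvd Gcd (range (\<lambda>i. z $ i)))}"


subsection \<open>The space of subsets of a lattice\<close>

(* A subset X of L is identified with its characteristic function, an element of the product
   of copies of the discrete two-point space bool indexed by L. *)
definition powerset_topology :: "'a set \<Rightarrow> 'a set topology" where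
  "powerset_topology L = pullback_topology (Pow L) (\<lambda>X. \<lambda>x\<in>L. x \<in> X)
     (product_topology (\<lambda>_. discrete_topology (UNIV :: bool set)) L)"

(* min {1, inf E} = Inf (insert 1 E) where inf {} is read as infinity; the latter cannot be
   expressed by Inf {} on the reals. *)
definition subset_dist :: "(real^'n) set \<Rightarrow> (real^'n) set \<Rightarrow> real" where
  "subset_dist X Y =
     Inf (insert 1 {\<epsilon>. \<epsilon> > 0 \<and> X \<inter> ball 0 (1 / \<epsilon>) = Y \<inter> ball 0 (1 / \<epsilon>)})"

definition translate :: "real^'n \<Rightarrow> (real^'n) set \<Rightarrow> (real^'n) set" where
  "translate t X = (\<lambda>x. x + t) ` X"

definition k_free_hull :: "(real^'n) set \<Rightarrow> nat \<Rightarrow> (real^'n) set set" where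
  "k_free_hull \<Lambda> k =
     powerset_topology \<Lambda> closure_of {translate t (k_free_points \<Lambda> k) | t. t \<in> \<Lambda>}"

definition hull_topology :: "(real^'n) set \<Rightarrow> nat \<Rightarrow> (real^'n) set topology" where
  "hull_topology \<Lambda> k = subtopology (powerset_topology \<Lambda>) (k_free_hull \<Lambda> k)"


subsection \<open>Topological dynamical systems over a lattice\<close>

(* A system is given by a topology T, with underlying set topspace T, and an action of the
   (discrete) group \<Lambda> by homeomorphisms; act need only make sense for group elements and
   points of the space. *)
definition dynamical_system ::
    "(real^'n) set \<Rightarrow> 'x topology \<Rightarrow> (real^'n \<Rightarrow> 'x \<Rightarrow> 'x) \<Rightarrow> bool" where
  "dynamical_system \<Lambda> T act \<longleftrightarrow> compact_space T \<and> Hausdorff_space T \<and>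
     (\<forall>t\<in>\<Lambda>. continuous_map T T (act t)) \<and>
     (\<forall>x\<in>topspace T. act 0 x = x) \<and>
     (\<forall>s\<in>\<Lambda>. \<forall>t\<in>\<Lambda>. \<forall>x\<in>topspace T. act (s + t) x = act s (act t x))"

(* Used only for R > 0, where it is the volume of the ball of radius R. *)
definition ball_volume :: "'n::finite itself \<Rightarrow> real \<Rightarrow> real" where
  "ball_volume _ R = measure lborel (ball (0 :: real^'n) 1) * R ^ CARD('n)"

definition topologically_ergodic ::
    "(real^'n) set \<Rightarrow> 'x topology \<Rightarrow> (real^'n \<Rightarrow> 'x \<Rightarrow> 'x) \<Rightarrow> bool" where
  "topologically_ergodic \<Lambda> T act \<longleftrightarrow>
     (\<forall>U W. openin T U \<longrightarrow> U \<noteq> {} \<longrightarrow> openin T W \<longrightarrow> W \<noteq> {} \<longrightarrow>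
        Limsup at_top (\<lambda>R. ereal ((\<Sum>t\<in>\<Lambda> \<inter> ball 0 R. of_bool (U \<inter> act t ` W \<noteq> {}))
                                    / ball_volume TYPE('n) R)) > 0)"

definition finite_open_cover :: "'x topology \<Rightarrow> 'x set set \<Rightarrow> bool" where
  "finite_open_cover T \<U> \<longleftrightarrow> finite \<U> \<and> (\<forall>A\<in>\<U>. openin T A) \<and> \<Union>\<U> = topspace T"

definition min_subcover_card :: "'x topology \<Rightarrow> 'x set set \<Rightarrow> nat" where
  "min_subcover_card T \<U> =
     (LEAST m. \<exists>\<V>\<subseteq>\<U>. finite \<V> \<and> \<Union>\<V> = topspace T \<and> card \<V> = m)"

definition cover_join :: "'x topology \<Rightarrow> 'i set \<Rightarrow> ('i \<Rightarrow> 'x set set) \<Rightarrow> 'x set set" where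
  "cover_join T I \<C> = {topspace T \<inter> (\<Inter>i\<in>I. A i) | A. \<forall>i\<in>I. A i \<in> \<C> i}"

definition cover_entropy_at ::
    "(real^'n) set \<Rightarrow> 'x topology \<Rightarrow> (real^'n \<Rightarrow> 'x \<Rightarrow> 'x) \<Rightarrow> 'x set set \<Rightarrow> real \<Rightarrow> real" where
  "cover_entropy_at \<Lambda> T act \<U> R =
     log 2 (real (min_subcover_card T
              (cover_join T (\<Lambda> \<inter> ball 0 R) (\<lambda>t. (\<lambda>A. act (- t) ` A) ` \<U>))))
       / ball_volume TYPE('n) R"

(* That the defining limits exist is part of the predicate. *)
definition has_topological_entropy ::
    "(real^'n) set \<Rightarrow> 'x topology \<Rightarrow> (real^'n \<Rightarrow> 'x \<Rightarrow> 'x) \<Rightarrow> ereal \<Rightarrow> bool" where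
  "has_topological_entropy \<Lambda> T act h \<longleftrightarrow>
     (\<exists>H. (\<forall>\<U>. finite_open_cover T \<U> \<longrightarrow>
             ((\<lambda>R. ereal (cover_entropy_at \<Lambda> T act \<U> R)) \<longlongrightarrow> H \<U>) at_top) \<and>
          h = (SUP \<U>\<in>{\<U>. finite_open_cover T \<U>}. H \<U>))"

definition proximal ::
    "(real^'n) set \<Rightarrow> 'x set \<Rightarrow> ('x \<Rightarrow> 'x \<Rightarrow> real) \<Rightarrow> (real^'n \<Rightarrow> 'x \<Rightarrow> 'x) \<Rightarrow> bool" where
  "proximal \<Lambda> S d act \<longleftrightarrow> (\<forall>x\<in>S. \<forall>y\<in>S. (INF t\<in>\<Lambda>. d (act t x) (act t y)) = 0)"

definition closed_invariant ::
    "(real^'n) set \<Rightarrow> 'x topology \<Rightarrow> (real^'n \<Rightarrow> 'x \<Rightarrow> 'x) \<Rightarrow> 'x set \<Rightarrow> bool" where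
  "closed_invariant \<Lambda> T act M \<longleftrightarrow> closedin T M \<and> (\<forall>t\<in>\<Lambda>. act t ` M \<subseteq> M)"

definition minimal_subset ::
    "(real^'n) set \<Rightarrow> 'x topology \<Rightarrow> (real^'n \<Rightarrow> 'x \<Rightarrow> 'x) \<Rightarrow> 'x set \<Rightarrow> bool" where
  "minimal_subset \<Lambda> T act M \<longleftrightarrow> M \<noteq> {} \<and> closed_invariant \<Lambda> T act M \<and>
     \<not> (\<exists>N. N \<noteq> {} \<and> N \<subset> M \<and> closed_invariant \<Lambda> T act N)"

definition minimal_system ::
    "(real^'n) set \<Rightarrow> 'x topology \<Rightarrow> (real^'n \<Rightarrow> 'x \<Rightarrow> 'x) \<Rightarrow> bool" where
  "minimal_system \<Lambda> T act \<longleftrightarrow> minimal_subset \<Lambda> T act (topspace T)"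

(* On a compact space the choice of the metric inducing T is immaterial. Requiring such a
   metric is no restriction for factors of the hull: a Hausdorff continuous image of a compact
   metrizable space is metrizable. *)
definition equicontinuous_system ::
    "(real^'n) set \<Rightarrow> 'x topology \<Rightarrow> (real^'n \<Rightarrow> 'x \<Rightarrow> 'x) \<Rightarrow> bool" where
  "equicontinuous_system \<Lambda> T act \<longleftrightarrow>
     (\<exists>d. Metric_space (topspace T) d \<and> Metric_space.mtopology (topspace T) d = T \<and>
        (\<forall>\<epsilon>>0. \<exists>\<delta>>0. \<forall>x\<in>topspace T. \<forall>y\<in>topspace T. d x y < \<delta> \<longrightarrow>
           (\<forall>t\<in>\<Lambda>. d (act t x) (act t y) < \<epsilon>)))"

definition topological_factor ::
    "(real^'n) set \<Rightarrow> 'x topology \<Rightarrow> (real^'n \<Rightarrow> 'x \<Rightarrow> 'x) \<Rightarrow>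
       'y topology \<Rightarrow> (real^'n \<Rightarrow> 'y \<Rightarrow> 'y) \<Rightarrow> bool" where
  "topological_factor \<Lambda> T act S act' \<longleftrightarrow> dynamical_system \<Lambda> S act' \<and>
     (\<exists>\<phi>. continuous_map T S \<phi> \<and> \<phi> ` topspace T = topspace S \<and>
        (\<forall>t\<in>\<Lambda>. \<forall>x\<in>topspace T. \<phi> (act t x) = act' t (\<phi> x)))"

definition kronecker_factor ::
    "(real^'n) set \<Rightarrow> 'x topology \<Rightarrow> (real^'n \<Rightarrow> 'x \<Rightarrow> 'x) \<Rightarrow>
       'y topology \<Rightarrow> (real^'n \<Rightarrow> 'y \<Rightarrow> 'y) \<Rightarrow> bool" where
  "kronecker_factor \<Lambda> T act S act' \<longleftrightarrow> topological_factor \<Lambda> T act S act' \<and>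
     minimal_system \<Lambda> S act' \<and> equicontinuous_system \<Lambda> S act'"

definition continuous_eigenfunction ::
    "(real^'n) set \<Rightarrow> 'x topology \<Rightarrow> (real^'n \<Rightarrow> 'x \<Rightarrow> 'x) \<Rightarrow>
       ('x \<Rightarrow> complex) \<Rightarrow> (real^'n \<Rightarrow> complex) \<Rightarrow> bool" where
  "continuous_eigenfunction \<Lambda> T act f ev \<longleftrightarrow>
     continuous_map T euclidean f \<and> (\<exists>x\<in>topspace T. f x \<noteq> 0) \<and>
     (\<forall>t\<in>\<Lambda>. \<forall>x\<in>topspace T. f (act (- t) x) = ev t * f x)"

definition trivial_point_spectrum ::
    "(real^'n) set \<Rightarrow> 'x topology \<Rightarrow> (real^'n \<Rightarrow> 'x \<Rightarrow> 'x) \<Rightarrow> bool" where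
  "trivial_point_spectrum \<Lambda> T act \<longleftrightarrow>
     (\<forall>f ev. continuous_eigenfunction \<Lambda> T act f ev \<longrightarrow>
        (\<forall>t\<in>\<Lambda>. ev t = 1) \<and> (\<exists>c. \<forall>x\<in>topspace T. f x = c))"

definition joining ::
    "(real^'n) set \<Rightarrow> 'x topology \<Rightarrow> (real^'n \<Rightarrow> 'x \<Rightarrow> 'x) \<Rightarrow>
       'y topology \<Rightarrow> (real^'n \<Rightarrow> 'y \<Rightarrow> 'y) \<Rightarrow> ('x \<times> 'y) set \<Rightarrow> bool" where
  "joining \<Lambda> T act S act' J \<longleftrightarrow>
     closed_invariant \<Lambda> (prod_topology T S) (\<lambda>t. map_prod (act t) (act' t)) J \<and>
     fst ` J = topspace T \<and> snd ` J = topspace S"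

definition topologically_transitive ::
    "(real^'n) set \<Rightarrow> 'x topology \<Rightarrow> (real^'n \<Rightarrow> 'x \<Rightarrow> 'x) \<Rightarrow> bool" where
  "topologically_transitive \<Lambda> T act \<longleftrightarrow>
     (\<forall>U W. openin T U \<longrightarrow> U \<noteq> {} \<longrightarrow> openin T W \<longrightarrow> W \<noteq> {} \<longrightarrow>
        (\<exists>t\<in>\<Lambda>. U \<inter> act t ` W \<noteq> {}))"

definition topologically_weakly_mixing ::
    "(real^'n) set \<Rightarrow> 'x topology \<Rightarrow> (real^'n \<Rightarrow> 'x \<Rightarrow> 'x) \<Rightarrow> bool" where
  "topologically_weakly_mixing \<Lambda> T act \<longleftrightarrow>
     topologically_transitive \<Lambda> (prod_topology T T) (\<lambda>t. map_prod (act t) (act t))"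


subsection \<open>The Kronecker system\<close>

definition lattice_group :: "(real^'n) set \<Rightarrow> (real^'n) monoid" where
  "lattice_group \<Lambda> = \<lparr>carrier = \<Lambda>, monoid.mult = (+), one = 0\<rparr>"

definition power_sublattice :: "(real^'n) set \<Rightarrow> nat \<Rightarrow> nat \<Rightarrow> (real^'n) set" where
  "power_sublattice \<Lambda> k p = (\<lambda>x. real (p ^ k) *\<^sub>R x) ` \<Lambda>"

definition kronecker_group :: "(real^'n) set \<Rightarrow> nat \<Rightarrow> (nat \<Rightarrow> (real^'n) set) monoid" where
  "kronecker_group \<Lambda> k =
     product_group {p. prime p} (\<lambda>p. lattice_group \<Lambda> Mod power_sublattice \<Lambda> k p)"

definition kronecker_topology :: "(real^'n) set \<Rightarrow> nat \<Rightarrow> (nat \<Rightarrow> (real^'n) set) topology" where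
  "kronecker_topology \<Lambda> k = product_topology
     (\<lambda>p. discrete_topology (carrier (lattice_group \<Lambda> Mod power_sublattice \<Lambda> k p))) {p. prime p}"

definition kronecker_action ::
    "(real^'n) set \<Rightarrow> nat \<Rightarrow> real^'n \<Rightarrow> (nat \<Rightarrow> (real^'n) set) \<Rightarrow> nat \<Rightarrow> (real^'n) set" where
  "kronecker_action \<Lambda> k x g =
     g \<otimes>\<^bsub>kronecker_group \<Lambda> k\<^esub>
       (\<lambda>p\<in>{p. prime p}. power_sublattice \<Lambda> k p #>\<^bsub>lattice_group \<Lambda>\<^esub> x)"


subsection \<open>The zeta function\<close>

(* The Dirichlet series, which represents Riemann's zeta function for s > 1. *)
definition zeta :: "real \<Rightarrow> real" where
  "zeta s = (\<Sum>m. 1 / real (Suc m) powr s)"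

end

(* The hull consists of the admissible sets, that is, of those subsets of the lattice which miss a
   coset of p^k times the lattice for every prime p. The closure of the orbit of V only contains
   admissible sets, as missing a coset is a closed condition. Conversely, an admissible finite pattern
   in a finite window is cut out by some translate of V: the Chinese remainder theorem yields a coset
   of translations which are right for the small primes and which remove every other point of the
   window by a large prime of its own, and for the remaining primes a positive proportion of that
   coset is good, since the sum of p^(-nk) over all large p is small.

   In an admissible set the finitely many points of a window are moved out of the set by a translation
   that is prescribed modulo one prime per point. Hence all orbits, and all pairs of orbits, accumulate
   at the empty set; this gives proximality, the unique minimal set, and the triviality of Kronecker
   factors and eigenfunctions. The pairs (X, g) such that X misses the coset g_p for all p form the
   joining. For ergodicity, two patterns are combined after a translation that matches their missing
   cosets for the small primes.

   The number of patterns in a ball of volume v is at least 2^(number of points of V in the ball), and at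
   most the sum, over the finitely many choices of missing cosets for p <= P, of
   2^(number of points outside these cosets). Both exponents have density close to 1/zeta(nk) by the
   Euler product. A general open cover is refined by the patterns in a finite window, and the limit
   defining its entropy exists by subadditivity. *)
theory Submission
  imports Defs
begin

text \<open>Everything is computed in integer coordinates with respect to one fixed basis
  \<open>B\<close>; unimodularity makes \<open>card (disc R) / vol R\<close> tend to 1, so that
  normalising by volume amounts to counting per lattice point. Periodic sets have an exact density,
  but \<open>V\<close> involves infinitely many primes, and densities do not pass to infinite
  intersections by themselves. The gap is bridged by one estimate for discs of every radius
  \<open>r > 0\<close>: with the origin removed they have at most a constant times
  \<open>vol r\<close> lattice points. The origin would otherwise be counted once for every
  \<open>p\<close>. With \<open>r\<close> about \<open>R / p ^ k\<close>, summation over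
  \<open>p\<close> is possible as soon as \<open>n * k \<ge> 2\<close>. For the k-free points
  themselves only a lower bound of the density is derived, since the matching upper bound for the
  entropy comes from patterns that are constrained at finitely many primes. For a general cover, the
  limit over balls is not a direct instance of Fekete's lemma, because balls do not tile; cubes do,
  and balls are compared with cubes from both sides.\<close>

text \<open>\<open>measure_linear_image\<close> needs a well-ordered index type; \<open>ordered_index\<close> supplies one of the
  same cardinality as a given finite type.\<close>

typedef ('n::finite) ordered_index = "{..<CARD('n)}"
  by (auto intro!: exI[of _ 0])

instantiation ordered_index :: (finite) wellorder
begin

definition less_eq_ordered_index :: "'a ordered_index \<Rightarrow> 'a ordered_index \<Rightarrow> bool" where
  "x \<le> y \<longleftrightarrow> Rep_ordered_index x \<le> Rep_ordered_index y"

definition less_ordered_index :: "'a ordered_index \<Rightarrow> 'a ordered_index \<Rightarrow> bool" where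
  "x < y \<longleftrightarrow> Rep_ordered_index x < Rep_ordered_index y"

instance
proof
  fix P :: "'a ordered_index \<Rightarrow> bool" and a :: "'a ordered_index"
  assume step: "\<And>x. (\<And>y. y < x \<Longrightarrow> P y) \<Longrightarrow> P x"
  show "P a"
    by (induction a rule: measure_induct_rule[where f = Rep_ordered_index])
       (rule step, simp add: less_ordered_index_def)
qed (auto simp: less_eq_ordered_index_def less_ordered_index_def Rep_ordered_index_inject)

end

instance ordered_index :: (finite) finite
proof
  have "(UNIV :: 'a ordered_index set) = Abs_ordered_index ` {..<CARD('a)}"
    by (metis type_definition.Abs_image type_definition_ordered_index)
  then show "finite (UNIV :: 'a ordered_index set)"
    by (metis finite_imageI finite_lessThan)
qed

lemma ex_bij_ordered_index: "\<exists>f :: 'n::finite ordered_index \<Rightarrow> 'n. bij f"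
proof -
  have "card (UNIV :: 'n ordered_index set) = CARD('n)"
    using type_definition.card[OF type_definition_ordered_index[where ?'n = 'n]] by simp
  then show ?thesis
    by (metis finite_class.finite_UNIV finite_same_card_bij)
qed

section \<open>Linear images and Lebesgue measure over an arbitrary finite index type\<close>

text \<open>In general \<open>p\<close> and its conjugate live on different types, so
  multiplicativity of \<open>sign\<close> does not apply to them. Instead a factorisation into
  transpositions is conjugated factor by factor, which keeps its length.\<close>

lemma swapidseq_conjugate:
  assumes "bij f" "swapidseq m p"
  shows "swapidseq m (inv_into UNIV f \<circ> p \<circ> f)"
proof -
  let ?g = "inv_into UNIV f"
  show ?thesis
    using assms(2)
  proof induction
    case id
    have "?g \<circ> id \<circ> f = id"
      using assms(1) by (simp add: fun_eq_iff bij_is_inj)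
    then show ?case
      by (simp only: swapidseq.id)
  next
    case (comp_Suc m p a b)
    have eq: "?g y = ?g z \<longleftrightarrow> y = z" for y z
      using assms(1) by (metis bij_inv_eq_iff)
    have "?g \<circ> (Transposition.transpose a b \<circ> p) \<circ> f =
        Transposition.transpose (?g a) (?g b) \<circ> (?g \<circ> p \<circ> f)"
    proof
      fix x
      show "(?g \<circ> (Transposition.transpose a b \<circ> p) \<circ> f) x =
          (Transposition.transpose (?g a) (?g b) \<circ> (?g \<circ> p \<circ> f)) x"
        by (auto simp: Transposition.transpose_def eq)
    qed
    then show ?case
      using comp_Suc eq by (simp only: swapidseq.comp_Suc simp_thms)
  qed
qed

lemma sign_conjugate:
  fixes p :: "'n::finite \<Rightarrow> 'n" and f :: "'m::finite \<Rightarrow> 'n"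
  assumes "bij f" "permutation p"
  shows "sign (inv_into UNIV f \<circ> p \<circ> f) = sign p"
proof -
  obtain m where m: "swapidseq m p"
    using assms(2) permutation_def by blast
  show ?thesis
    using evenperm_unique[OF m refl] evenperm_unique[OF swapidseq_conjugate[OF assms(1) m] refl]
    by (simp add: sign_def)
qed

text \<open>Leibniz formula: conjugation by \<open>f\<close> is a sign-preserving bijection between
  the permutations of the two index types.\<close>

lemma det_reindex:
  fixes A :: "real^'n^'n" and f :: "'m::finite \<Rightarrow> 'n"
  assumes f: "bij f"
  shows "det (\<chi> i j. A $ f i $ f j) = det A"
proof -
  let ?g = "inv_into UNIV f"
  let ?c = "\<lambda>p. ?g \<circ> p \<circ> f"
  have bij: "bij_betw ?c {p. p permutes UNIV} {p. p permutes UNIV}"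
  proof (rule bij_betw_byWitness[where f' = "\<lambda>q. f \<circ> q \<circ> ?g"])
    show "\<forall>p\<in>{p. p permutes UNIV}. f \<circ> (?g \<circ> p \<circ> f) \<circ> ?g = p"
      using f by (auto simp: fun_eq_iff bij_is_surj surj_f_inv_f)
    show "\<forall>q\<in>{q. q permutes UNIV}. ?g \<circ> (f \<circ> q \<circ> ?g) \<circ> f = q"
      using f by (auto simp: fun_eq_iff bij_is_inj)
    show "?c ` {p. p permutes UNIV} \<subseteq> {p. p permutes UNIV}"
      using f by (auto intro!: bij_imp_permutes bij_comp bij_imp_bij_inv dest: permutes_bij)
    show "(\<lambda>q. f \<circ> q \<circ> ?g) ` {p. p permutes UNIV} \<subseteq> {p. p permutes UNIV}"
      using f by (auto intro!: bij_imp_permutes bij_comp bij_imp_bij_inv dest: permutes_bij)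
  qed
  have "det (\<chi> i j. A $ f i $ f j) =
      (\<Sum>p | p permutes UNIV. of_int (sign p) * (\<Prod>i\<in>UNIV. A $ f i $ f (p i)))"
    by (simp add: det_def)
  also have "\<dots> = (\<Sum>p | p permutes UNIV. of_int (sign (?c p)) * (\<Prod>i\<in>UNIV. A $ f i $ f (?c p i)))"
    by (rule sum.reindex_bij_betw[OF bij, symmetric])
  also have "\<dots> = (\<Sum>p | p permutes UNIV. of_int (sign p) * (\<Prod>i\<in>UNIV. A $ i $ p i))"
  proof (rule sum.cong[OF refl])
    fix p :: "'n \<Rightarrow> 'n" assume p: "p \<in> {p. p permutes UNIV}"
    have "(\<Prod>i\<in>UNIV. A $ f i $ f (?c p i)) = (\<Prod>i\<in>UNIV. A $ f i $ p (f i))"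
      using f by (simp add: bij_is_surj surj_f_inv_f)
    also have "\<dots> = (\<Prod>i\<in>UNIV. A $ i $ p i)"
      by (rule prod.reindex_bij_betw[OF f, where g = "\<lambda>i. A $ i $ p i"])
    finally show "of_int (sign (?c p)) * (\<Prod>i\<in>UNIV. A $ f i $ f (?c p i)) =
        of_int (sign p) * (\<Prod>i\<in>UNIV. A $ i $ p i)"
      using sign_conjugate[OF f, of p] p by (simp add: permutation_permutes) blast
  qed
  finally show ?thesis
    by (simp add: det_def)
qed

text \<open>Lebesgue measure is determined by boxes, and relabelling coordinates turns a box into a
  box with the same side lengths.\<close>

lemma lborel_reindex:
  fixes f :: "'m::finite \<Rightarrow> 'n::finite"
  assumes f: "bij f"
  shows "distr lborel borel (\<lambda>x :: real^'n. (\<chi> i. x $ f i) :: real^'m) = lborel"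
proof (rule lborel_eqI[symmetric])
  let ?r = "\<lambda>x :: real^'n. (\<chi> i. x $ f i) :: real^'m"
  have "continuous_on UNIV ?r"
    by (intro continuous_intros)
  then have meas: "?r \<in> borel_measurable lborel"
    by (simp add: borel_measurable_continuous_onI)
  fix l u :: "real^'m" assume lu: "\<And>b. b \<in> Basis \<Longrightarrow> l \<bullet> b \<le> u \<bullet> b"
  let ?s = "\<lambda>y :: real^'m. (\<chi> i. y $ inv_into UNIV f i) :: real^'n"
  have "?r -` box l u = box (?s l) (?s u)"
    using f by (auto simp: mem_box_cart) (metis bij_inv_eq_iff)+
  moreover have "emeasure lborel (box (?s l) (?s u)) = (\<Prod>b\<in>Basis. (?s u - ?s l) \<bullet> b)"
    using lu by (subst emeasure_lborel_box) (force simp: Basis_vec_def inner_axis)+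
  moreover have "(\<Prod>b\<in>Basis. (?s u - ?s l) \<bullet> b) = (\<Prod>b\<in>Basis. (u - l) \<bullet> b)"
  proof -
    have *: "(\<Prod>b\<in>Basis. (x::real^'k) \<bullet> b) = (\<Prod>i\<in>UNIV. x $ i)" for x
    proof -
      have B: "Basis = range (\<lambda>i::'k. axis i (1::real))"
        by (auto simp: Basis_vec_def)
      show ?thesis
        unfolding B by (subst prod.reindex) (auto simp: inj_on_def axis_eq_axis inner_axis)
    qed
    have "(\<Prod>i\<in>UNIV. (u - l) $ i) = (\<Prod>i\<in>UNIV. (u - l) $ inv_into UNIV f i)"
      by (rule prod.reindex_bij_betw[OF bij_imp_bij_inv[OF f], symmetric])
    then show ?thesis
      by (simp add: *)
  qed
  ultimately show "emeasure (distr lborel borel ?r) (box l u) = ennreal (\<Prod>b\<in>Basis. (u - l) \<bullet> b)"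
    using meas by (simp add: emeasure_distr)
qed simp

text \<open>Relabelling the coordinates by an ordered index type changes neither measure nor
  determinant, and over that type \<open>measure_linear_image\<close> applies. Compactness of
  \<open>S\<close> keeps all images Borel.\<close>

lemma measure_matrix_image:
  fixes B :: "real^'n^'n" and S :: "(real^'n) set"
  assumes "compact S"
  shows "measure lborel ((\<lambda>x. B *v x) ` S) = \<bar>det B\<bar> * measure lborel S"
proof -
  obtain f :: "'n ordered_index \<Rightarrow> 'n" where f: "bij f"
    using ex_bij_ordered_index by blast
  let ?r = "\<lambda>x :: real^'n. (\<chi> i. x $ f i) :: real^'n ordered_index"
  let ?s = "\<lambda>y :: real^'n ordered_index. (\<chi> i. y $ inv_into UNIV f i) :: real^'n"
  have sr: "?s (?r x) = x" for x
    using f by (simp add: vec_eq_iff bij_is_surj surj_f_inv_f)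
  have contr: "continuous_on T ?r" for T
    by (intro continuous_intros)
  then have meas: "?r \<in> borel_measurable lborel"
    by (simp add: borel_measurable_continuous_onI)
  have r: "measure lborel (?r ` T) = measure lborel T" if "compact T" for T
  proof -
    have "compact (?r ` T)"
      using that contr compact_continuous_image by blast
    then have "?r ` T \<in> sets borel"
      by (simp add: borel_compact)
    moreover have "?r -` ?r ` T = T"
      proof (intro equalityI subsetI)
      fix x assume "x \<in> ?r -` ?r ` T"
      then obtain y where "y \<in> T" "?r x = ?r y" by blast
      then show "x \<in> T"
        using sr[of x] sr[of y] by simp
    qed blast
    ultimately show ?thesis
      using lborel_reindex[OF f] measure_distr[OF meas, of "?r ` T"] by simp
  qed
  let ?C = "(\<chi> i j. B $ f i $ f j) :: real^'n ordered_index^'n ordered_index"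
  have C: "?r (B *v x) = ?C *v ?r x" for x
  proof -
    have "(\<Sum>j\<in>UNIV. B $ i $ f j * x $ f j) = (\<Sum>j\<in>UNIV. B $ i $ j * x $ j)" for i
      by (rule sum.reindex_bij_betw[OF f, where g = "\<lambda>j. B $ i $ j * x $ j"])
    then show ?thesis
      by (simp add: vec_eq_iff matrix_vector_mult_def)
  qed
  have comp: "compact ((\<lambda>x. B *v x) ` S)" "compact (?r ` S)" "compact ((\<lambda>x. ?C *v x) ` ?r ` S)"
    using assms contr
    by (auto intro!: compact_continuous_image matrix_vector_mult_linear_continuous_on)
  have "measure lborel ((\<lambda>x. B *v x) ` S) = measure lborel ((\<lambda>x. ?C *v x) ` ?r ` S)"
    using r[OF comp(1)] by (simp add: image_image C)
  also have "\<dots> = measure lebesgue ((\<lambda>x. ?C *v x) ` ?r ` S)"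
    using comp(3) by (simp add: borel_compact)
  also have "\<dots> = \<bar>det ?C\<bar> * measure lebesgue (?r ` S)"
    using measure_linear_image[of "\<lambda>x. ?C *v x" "?r ` S"] comp(2)
    by (simp add: lmeasurable_compact)
  also have "\<dots> = \<bar>det B\<bar> * measure lborel S"
    using comp(2) r[OF assms] det_reindex[OF f, of B] by (simp add: borel_compact)
  finally show ?thesis .
qed

section \<open>Boxes and residues of integer vectors\<close>

text \<open>The standard representatives of the residue classes of integer vectors modulo
  \<open>q\<close>; empty for \<open>q \<le> 0\<close>.\<close>

definition res_box :: "int \<Rightarrow> (int^'n) set" where
  "res_box q = {z. \<forall>i. 0 \<le> z $ i \<and> z $ i < q}"

definition vmod :: "int \<Rightarrow> int^'n \<Rightarrow> int^'n" where
  "vmod q z = (\<chi> i. z $ i mod q)"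

definition vdiv :: "int \<Rightarrow> int^'n \<Rightarrow> int^'n" where
  "vdiv q z = (\<chi> i. z $ i div q)"

lemma vmod_nth [simp]: "vmod q z $ i = z $ i mod q"
  by (simp add: vmod_def)

lemma vdiv_nth [simp]: "vdiv q z $ i = z $ i div q"
  by (simp add: vdiv_def)

lemma card_vec_box: "card {z :: int^'n. \<forall>i. z $ i \<in> A i} = (\<Prod>i\<in>UNIV. card (A i))"
  and finite_vec_box: "(\<And>i. finite (A i)) \<Longrightarrow> finite {z :: int^'n. \<forall>i. z $ i \<in> A i}"
proof -
  have bij: "bij_betw (\<lambda>z. ($) z) {z :: int^'n. \<forall>i. z $ i \<in> A i} (PiE UNIV A)"
    by (rule bij_betw_byWitness[where f' = "vec_lambda"]) (auto simp: PiE_def)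
  then show "card {z :: int^'n. \<forall>i. z $ i \<in> A i} = (\<Prod>i\<in>UNIV. card (A i))"
    by (simp add: bij_betw_same_card card_PiE)
  show "finite {z :: int^'n. \<forall>i. z $ i \<in> A i}" if "\<And>i. finite (A i)"
    using that bij_betw_finite[OF bij] by (simp add: finite_PiE)
qed

lemma finite_res_box [simp]: "finite (res_box q :: (int^'n) set)"
  and card_res_box: "card (res_box q :: (int^'n) set) = nat q ^ CARD('n)"
proof -
  have *: "res_box q = {z :: int^'n. \<forall>i. z $ i \<in> {0..<q}}"
    by (auto simp: res_box_def)
  show "finite (res_box q :: (int^'n) set)"
    unfolding * by (rule finite_vec_box) simp
  show "card (res_box q :: (int^'n) set) = nat q ^ CARD('n)"
    unfolding * by (subst card_vec_box) simp
qed

lemma vmod_in_res_box: "q > 0 \<Longrightarrow> vmod q z \<in> res_box q"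
  by (simp add: res_box_def)

lemma vmod_res_box: "z \<in> res_box q \<Longrightarrow> vmod q z = z"
  by (simp add: res_box_def vec_eq_iff)

lemma vmod_vmod: "q dvd m \<Longrightarrow> vmod q (vmod m z) = vmod q z"
  by (simp add: vec_eq_iff mod_mod_cancel)

lemma vmod_eq_iff: "vmod q x = vmod q y \<longleftrightarrow> (\<forall>i. q dvd (x - y) $ i)"
  by (simp add: vec_eq_iff mod_eq_dvd_iff)

text \<open>Chinese remainder theorem as a count: the pair of residues is injective on
  \<open>res_box (q1 * q2)\<close> and source and target have the same size, so it is a
  bijection.\<close>

lemma card_res_box_coprime:
  fixes A1 A2 :: "(int^'n) set"
  assumes "coprime q1 q2" "q1 > 0" "q2 > 0" "A1 \<subseteq> res_box q1" "A2 \<subseteq> res_box q2"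
  shows "card {z \<in> res_box (q1 * q2). vmod q1 z \<in> A1 \<and> vmod q2 z \<in> A2} = card A1 * card A2"
proof -
  define f where "f = (\<lambda>z :: int^'n. (vmod q1 z, vmod q2 z))"
  have inj: "inj_on f (res_box (q1 * q2))"
  proof (rule inj_onI)
    fix x y assume x: "x \<in> res_box (q1 * q2)" and y: "y \<in> res_box (q1 * q2)" and "f x = f y"
    then have "\<forall>i. q1 dvd (x - y) $ i" "\<forall>i. q2 dvd (x - y) $ i"
      unfolding vmod_eq_iff[symmetric] by (auto simp: f_def)
    then have "vmod (q1 * q2) x = vmod (q1 * q2) y"
      using assms(1) by (simp add: vmod_eq_iff divides_mult)
    then show "x = y"
      using x y by (simp add: vmod_res_box)
  qed
  have "f ` res_box (q1 * q2) = res_box q1 \<times> res_box q2"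
  proof (rule card_seteq)
    show "f ` res_box (q1 * q2) \<subseteq> res_box q1 \<times> res_box q2"
      using assms by (auto simp: f_def vmod_in_res_box)
    show "card ((res_box q1 :: (int^'n) set) \<times> (res_box q2 :: (int^'n) set)) \<le> card (f ` res_box (q1 * q2))"
      using assms by (simp add: card_image[OF inj] card_res_box nat_mult_distrib power_mult_distrib)
  qed simp
  then have "f ` {z \<in> res_box (q1 * q2). vmod q1 z \<in> A1 \<and> vmod q2 z \<in> A2} = A1 \<times> A2"
  proof -
    assume eq: "f ` res_box (q1 * q2) = res_box q1 \<times> res_box q2"
    show ?thesis
    proof (intro equalityI subsetI)
      fix y assume y: "y \<in> A1 \<times> A2"
      then have "y \<in> f ` res_box (q1 * q2)"
        unfolding eq using assms(4,5) by blast
      then obtain z where "z \<in> res_box (q1 * q2)" "y = f z"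
        by blast
      then show "y \<in> f ` {z \<in> res_box (q1 * q2). vmod q1 z \<in> A1 \<and> vmod q2 z \<in> A2}"
        using y by (auto simp: f_def)
    qed (auto simp: f_def)
  qed
  moreover have "inj_on f {z \<in> res_box (q1 * q2). vmod q1 z \<in> A1 \<and> vmod q2 z \<in> A2}"
    using inj by (rule inj_on_subset) auto
  ultimately show ?thesis
    using card_image[of f "{z \<in> res_box (q1 * q2). vmod q1 z \<in> A1 \<and> vmod q2 z \<in> A2}"]
    by (simp add: card_cartesian_product)
qed

text \<open>Residue conditions for pairwise coprime moduli are independent; this is what turns
  densities into products over primes.\<close>

lemma card_res_box_prod:
  fixes A :: "'i \<Rightarrow> (int^'n) set"
  assumes "finite S" "\<And>i. i \<in> S \<Longrightarrow> m i > 0" "\<And>i. i \<in> S \<Longrightarrow> A i \<subseteq> res_box (m i)"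
    and "\<And>i j. i \<in> S \<Longrightarrow> j \<in> S \<Longrightarrow> i \<noteq> j \<Longrightarrow> coprime (m i) (m j)"
  shows "card {z \<in> res_box (\<Prod>i\<in>S. m i). \<forall>i\<in>S. vmod (m i) z \<in> A i} = (\<Prod>i\<in>S. card (A i))"
  using assms
proof (induction S)
  case empty
  then show ?case
    by (simp add: card_res_box)
next
  case (insert j S)
  let ?Z = "{z \<in> res_box (\<Prod>i\<in>S. m i). \<forall>i\<in>S. vmod (m i) z \<in> A i}"
  have pos: "(\<Prod>i\<in>S. m i) > 0"
    using insert by (intro prod_pos) auto
  have "coprime (m j) (\<Prod>i\<in>S. m i)"
    using insert.prems(3) insert.hyps(2) by (intro prod_coprime_right) (metis insertI1 insertI2)
  then have "card {z \<in> res_box (m j * (\<Prod>i\<in>S. m i)). vmod (m j) z \<in> A j \<and> vmod (\<Prod>i\<in>S. m i) z \<in> ?Z}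
      = card (A j) * card ?Z"
    using insert pos by (intro card_res_box_coprime) auto
  moreover have "{z \<in> res_box (m j * (\<Prod>i\<in>S. m i)). vmod (m j) z \<in> A j \<and> vmod (\<Prod>i\<in>S. m i) z \<in> ?Z}
     = {z \<in> res_box (\<Prod>i\<in>insert j S. m i). \<forall>i\<in>insert j S. vmod (m i) z \<in> A i}"
    using insert.hyps pos by (auto simp: vmod_in_res_box vmod_vmod[OF dvd_prodI])
  ultimately show ?case
    using insert by simp
qed

section \<open>Counting lattice points in balls\<close>

locale unimodular_basis =
  fixes B :: "real^'n^'n"
  assumes inv_B: "invertible B" and det_B: "\<bar>det B\<bar> = 1"
begin

abbreviation pt :: "int^'n \<Rightarrow> real^'n" where
  "pt \<equiv> lattice_point B"

definition disc :: "real \<Rightarrow> (int^'n) set" where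
  "disc R = {z. norm (pt z) < R}"

definition vol :: "real \<Rightarrow> real" where
  "vol R = ball_volume TYPE('n) R"

lemma vol_content: "R \<ge> 0 \<Longrightarrow> measure lborel (ball (x :: real^'n) R) = vol R"
  by (simp add: vol_def ball_volume_def content_ball)

lemma vol_mult: "vol (c * R) = c ^ CARD('n) * vol R"
  by (simp add: vol_def ball_volume_def power_mult_distrib)

lemma vol_pos: "R > 0 \<Longrightarrow> vol R > 0"
  by (simp add: vol_def ball_volume_def)

lemma vol_mono: "0 \<le> R \<Longrightarrow> R \<le> S \<Longrightarrow> vol R \<le> vol S"
  by (simp add: vol_def ball_volume_def mult_left_mono power_mono)

lemma lattice_point_simps:
  "pt (x + y) = pt x + pt y"
  "pt (x - y) = pt x - pt y"
  "pt (- x) = - pt x"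
  "pt 0 = 0"
proof -
  let ?r = "\<lambda>z :: int^'n. (\<chi> i. real_of_int (z $ i)) :: real^'n"
  have "?r (x + y) = ?r x + ?r y" "?r (x - y) = ?r x - ?r y" "?r (- x) = - ?r x" "?r 0 = 0"
    by (simp_all add: vec_eq_iff)
  then show "pt (x + y) = pt x + pt y"
    "pt (x - y) = pt x - pt y"
    "pt (- x) = - pt x"
    "pt 0 = 0"
    by (simp_all only: lattice_point_def matrix_vector_right_distrib matrix_vector_mult_diff_distrib
        matrix_vector_mult_0_right linear_neg[OF matrix_vector_mul_linear])
qed

lemma mult_B_bound: "\<exists>\<rho>>0. \<forall>x c. (\<forall>i. \<bar>x $ i\<bar> \<le> c) \<longrightarrow> norm (B *v x) \<le> \<rho> * c"
proof -
  obtain K where K: "K > 0" "\<And>x. norm (B *v x) \<le> norm x * K"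
    using bounded_linear.pos_bounded[OF matrix_vector_mul_bounded_linear[of B]] by blast
  have "norm (B *v x) \<le> (K * CARD('n)) * c" if "\<forall>i. \<bar>x $ i\<bar> \<le> c" for x c
  proof -
    have "norm x \<le> (\<Sum>i\<in>UNIV. \<bar>x $ i\<bar>)"
      by (rule norm_le_l1_cart)
    also have "\<dots> \<le> CARD('n) * c"
      using that sum_bounded_above[of "UNIV :: 'n set" "\<lambda>i. \<bar>x $ i\<bar>" c] by simp
    finally have "norm x * K \<le> CARD('n) * c * K"
      using K by simp
    then show ?thesis
      using K(2)[of x] by (simp add: algebra_simps)
  qed
  then show ?thesis
    using K(1) by (intro exI[of _ "K * CARD('n)"]) simp
qed

text \<open>Controls displacements: changing each coordinate by at most \<open>c\<close> moves the
  point by at most \<open>\<rho> * c\<close>.\<close>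

definition \<rho> :: real where
  "\<rho> = (SOME \<rho>. \<rho> > 0 \<and> (\<forall>x c. (\<forall>i. \<bar>x $ i\<bar> \<le> c) \<longrightarrow> norm (B *v x) \<le> \<rho> * c))"

lemma \<rho>_pos: "\<rho> > 0"
  and norm_mult_B: "(\<And>i. \<bar>x $ i\<bar> \<le> c) \<Longrightarrow> norm (B *v x) \<le> \<rho> * c"
  using someI_ex[OF mult_B_bound] unfolding \<rho>_def[symmetric] by auto

lemma norm_lattice_point: "(\<And>i. \<bar>z $ i\<bar> \<le> c) \<Longrightarrow> norm (pt z) \<le> \<rho> * of_int c"
  unfolding lattice_point_def by (rule norm_mult_B) (metis of_int_abs of_int_le_iff vec_lambda_beta)

lemma inverse_bound: "\<exists>K>0. \<forall>x i. \<bar>x $ i\<bar> \<le> K * norm (B *v x)"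
proof -
  obtain C where C: "C ** B = mat 1"
    using inv_B invertible_def by blast
  obtain K where K: "K > 0" "\<And>x. norm (C *v x) \<le> norm x * K"
    using bounded_linear.pos_bounded[OF matrix_vector_mul_bounded_linear[of C]] by blast
  have "\<bar>x $ i\<bar> \<le> K * norm (B *v x)" for x i
  proof -
    have "\<bar>x $ i\<bar> \<le> norm x"
      by (rule component_le_norm_cart)
    also have "\<dots> = norm (C *v (B *v x))"
      by (simp add: C matrix_vector_mul_assoc)
    also have "\<dots> \<le> K * norm (B *v x)"
      using K(2)[of "B *v x"] by (simp add: mult.commute)
    finally show ?thesis .
  qed
  then show ?thesis
    using K(1) by blast
qed

text \<open>The constant for the converse direction, from the norm of a point back to its
  coordinates.\<close>

definition \<kappa> :: real where
  "\<kappa> = (SOME K. K > 0 \<and> (\<forall>x i. \<bar>x $ i\<bar> \<le> K * norm (B *v x)))"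

lemma \<kappa>_pos: "\<kappa> > 0" and coord_B: "\<bar>x $ i\<bar> \<le> \<kappa> * norm (B *v x)"
  using someI_ex[OF inverse_bound] unfolding \<kappa>_def[symmetric] by auto

lemma coord_lattice_point: "of_int \<bar>z $ i\<bar> \<le> \<kappa> * norm (pt z)"
  using coord_B[of "\<chi> i. real_of_int (z $ i)" i] by (simp add: lattice_point_def)

lemma inj_mult_B: "B *v x = B *v y \<Longrightarrow> x = y"
  using inv_B by (metis invertible_def matrix_vector_mul_assoc matrix_vector_mul_lid)

lemma inj_lattice_point: "inj (pt)"
proof (rule injI)
  fix x y assume "pt x = pt y"
  then have "(\<chi> i. real_of_int (x $ i)) = (\<chi> i. real_of_int (y $ i))"
    unfolding lattice_point_def by (rule inj_mult_B)
  then show "x = y"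
    by (simp add: vec_eq_iff)
qed

lemma finite_disc [simp]: "finite (disc R)"
proof (rule finite_subset)
  show "disc R \<subseteq> {z. \<forall>i. z $ i \<in> {-\<lceil>\<kappa> * R\<rceil>..\<lceil>\<kappa> * R\<rceil>}}"
  proof safe
    fix z i assume "z \<in> disc R"
    then have "of_int \<bar>z $ i\<bar> \<le> \<kappa> * R"
      using coord_lattice_point[of z i] \<kappa>_pos
      by (metis (no_types, lifting) disc_def less_eq_real_def mem_Collect_eq mult_left_mono order_trans)
    then have "\<bar>z $ i\<bar> \<le> \<lceil>\<kappa> * R\<rceil>"
      by linarith
    then show "z $ i \<in> {-\<lceil>\<kappa> * R\<rceil>..\<lceil>\<kappa> * R\<rceil>}"
      by auto
  qed
  show "finite {z :: int^'n. \<forall>i. z $ i \<in> {-\<lceil>\<kappa> * R\<rceil>..\<lceil>\<kappa> * R\<rceil>}}"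
    by (rule finite_vec_box) simp
qed

lemma disc_translate: "x \<in> disc R \<Longrightarrow> norm (pt z) \<le> r \<Longrightarrow> x + z \<in> disc (R + r)"
  using norm_triangle_ineq[of "pt x" "pt z"]
  by (simp add: disc_def lattice_point_simps)

text \<open>Closed, so that compactness settles measurability; the overlaps along faces are null
  sets.\<close>

definition coord_cell :: "int^'n \<Rightarrow> (real^'n) set" where
  "coord_cell z = cbox (\<chi> i. real_of_int (z $ i)) (\<chi> i. real_of_int (z $ i) + 1)"

definition unit_cell :: "int^'n \<Rightarrow> (real^'n) set" where
  "unit_cell z = (\<lambda>x. B *v x) ` coord_cell z"

lemma compact_unit_cell: "compact (unit_cell z)"
  unfolding unit_cell_def coord_cell_def
  by (intro compact_continuous_image matrix_vector_mult_linear_continuous_on compact_cbox)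

lemma measure_unit_cell: "measure lborel (unit_cell z) = 1"
proof -
  have "measure lborel (coord_cell z) = 1"
    unfolding coord_cell_def by (simp add: content_cbox_if_cart interval_eq_empty_cart not_less)
  moreover have "compact (coord_cell z)"
    by (simp add: coord_cell_def)
  ultimately show ?thesis
    by (simp add: unit_cell_def measure_matrix_image det_B)
qed

text \<open>The cells attached to the points of the disc have volume 1, overlap in null sets only,
  and lie within the ball of radius \<open>R + \<rho>\<close>.\<close>

lemma card_disc_le:
  assumes "R \<ge> 0"
  shows "real (card (disc R)) \<le> vol (R + \<rho>)"
proof -
  have "real (card (disc R)) = (\<Sum>z\<in>disc R. measure lebesgue (unit_cell z))"
    using measure_unit_cell compact_unit_cell by (simp add: borel_compact)
  also have "\<dots> = measure lebesgue (\<Union>z\<in>disc R. unit_cell z)"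
  proof (rule measure_negligible_finite_Union_image[symmetric])
    show "unit_cell z \<in> lmeasurable" for z
      using compact_unit_cell lmeasurable_compact by blast
    show "pairwise (\<lambda>x y. negligible (unit_cell x \<inter> unit_cell y)) (disc R)"
    proof (rule pairwiseI)
      fix x y :: "int^'n" assume "x \<noteq> y"
      then obtain i where i: "x $ i \<noteq> y $ i"
        by (auto simp: vec_eq_iff)
      \<comment> \<open>Cells whose corners differ in coordinate \<open>i\<close> can meet only in a
        common face, where that coordinate equals the larger corner.\<close>
      let ?H = "{u :: real^'n. u $ i = of_int (max (x $ i) (y $ i))}"
      have "coord_cell x \<inter> coord_cell y \<subseteq> ?H"
      proof
        fix u assume "u \<in> coord_cell x \<inter> coord_cell y"
        then have "of_int (x $ i) \<le> u $ i" "u $ i \<le> of_int (x $ i) + 1"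
          "of_int (y $ i) \<le> u $ i" "u $ i \<le> of_int (y $ i) + 1"
          by (auto simp: coord_cell_def mem_box_cart)
        then show "u \<in> ?H"
          using i by (simp add: max_def)
      qed
      then have "negligible (coord_cell x \<inter> coord_cell y)"
        using negligible_hyperplane[of "axis i (1::real)" "of_int (max (x $ i) (y $ i))"]
        by (simp add: inner_axis' axis_eq_0_iff negligible_subset)
      moreover have cb: "compact (coord_cell x \<inter> coord_cell y)" "compact ((\<lambda>x. B *v x) ` (coord_cell x \<inter> coord_cell y))"
        unfolding coord_cell_def by (auto intro!: compact_continuous_image matrix_vector_mult_linear_continuous_on compact_Int)
      ultimately have "negligible ((\<lambda>x. B *v x) ` (coord_cell x \<inter> coord_cell y))"
        using measure_matrix_image[of "coord_cell x \<inter> coord_cell y" B] cb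
        by (simp add: negligible_iff_measure borel_compact lmeasurable_compact)
      moreover have "unit_cell x \<inter> unit_cell y = (\<lambda>x. B *v x) ` (coord_cell x \<inter> coord_cell y)"
        unfolding unit_cell_def by (rule image_Int[symmetric]) (auto intro!: injI inj_mult_B)
      ultimately show "negligible (unit_cell x \<inter> unit_cell y)"
        by simp
    qed
  qed simp
  also have "\<dots> \<le> measure lebesgue (ball (0 :: real^'n) (R + \<rho>))"
  proof (rule measure_mono_fmeasurable)
    show "(\<Union>z\<in>disc R. unit_cell z) \<subseteq> ball 0 (R + \<rho>)"
    proof safe
      fix z v assume z: "z \<in> disc R" and "v \<in> unit_cell z"
      then obtain u where u: "u \<in> coord_cell z" "v = B *v u"
        by (auto simp: unit_cell_def)
      have "norm (B *v (u - (\<chi> i. real_of_int (z $ i)))) \<le> \<rho> * 1"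
        using u(1) by (intro norm_mult_B) (auto simp: coord_cell_def mem_box_cart abs_le_iff algebra_simps)
      then have "norm (v - pt z) \<le> \<rho>"
        by (simp add: u(2) lattice_point_def matrix_vector_mult_diff_distrib)
      then show "v \<in> ball 0 (R + \<rho>)"
        using z norm_triangle_ineq2[of v "pt z"] by (simp add: disc_def)
    qed
    show "(\<Union>z\<in>disc R. unit_cell z) \<in> sets lebesgue"
      using compact_unit_cell by (intro sets.finite_UN) (simp_all add: lmeasurable_compact fmeasurableD)
  qed simp
  also have "\<dots> = vol (R + \<rho>)"
    using vol_content[of "R + \<rho>"] assms \<rho>_pos by simp
  finally show ?thesis .
qed

text \<open>Each point of the ball of radius \<open>R - \<rho>\<close> lies in the cell at the
  coordinatewise floor of its coordinates, and that corner is within distance \<open>\<rho>\<close>,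
  hence in the disc.\<close>

lemma card_disc_ge:
  assumes "R \<ge> \<rho>"
  shows "vol (R - \<rho>) \<le> real (card (disc R))"
proof -
  have "vol (R - \<rho>) = measure lborel (ball (0 :: real^'n) (R - \<rho>))"
    using vol_content assms by simp
  also have "\<dots> \<le> measure lborel (\<Union>z\<in>disc R. unit_cell z)"
  proof (rule measure_mono_fmeasurable)
    show "ball 0 (R - \<rho>) \<subseteq> (\<Union>z\<in>disc R. unit_cell z)"
    proof
      fix v :: "real^'n" assume v: "v \<in> ball 0 (R - \<rho>)"
      obtain u where u: "v = B *v u"
        using inv_B by (metis invertible_def matrix_vector_mul_assoc matrix_vector_mul_lid)
      let ?z = "\<chi> i. \<lfloor>u $ i\<rfloor>"
      have ub: "u \<in> coord_cell ?z"
        by (auto simp: coord_cell_def mem_box_cart)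
      then have "norm (B *v (u - (\<chi> i. real_of_int (?z $ i)))) \<le> \<rho> * 1"
        by (intro norm_mult_B) (auto simp: coord_cell_def mem_box_cart abs_le_iff algebra_simps)
      then have "norm (v - pt ?z) \<le> \<rho>"
        by (simp add: u lattice_point_def matrix_vector_mult_diff_distrib)
      then have "?z \<in> disc R"
        using v norm_triangle_ineq2[of "pt ?z" v] by (simp add: disc_def norm_minus_commute)
      moreover have "v \<in> unit_cell ?z"
        using ub u by (simp add: unit_cell_def)
      ultimately show "v \<in> (\<Union>z\<in>disc R. unit_cell z)"
        by blast
    qed
    show "(\<Union>z\<in>disc R. unit_cell z) \<in> fmeasurable lborel"
      using compact_unit_cell by (intro fmeasurable.finite_UN) (auto simp: fmeasurable_compact)
  qed simp
  also have "\<dots> \<le> (\<Sum>z\<in>disc R. measure lborel (unit_cell z))"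
    using compact_unit_cell by (intro measure_UNION_le) (auto simp: borel_compact)
  also have "\<dots> = real (card (disc R))"
    by (simp add: measure_unit_cell)
  finally show ?thesis .
qed

lemma vol_shift_ratio: "((\<lambda>R. vol (R + c) / vol R) \<longlongrightarrow> 1) at_top"
proof -
  have "((\<lambda>R. (1 + c / R) ^ CARD('n)) \<longlongrightarrow> (1 + 0) ^ CARD('n)) at_top"
    by (intro tendsto_intros tendsto_divide_0[OF tendsto_const] filterlim_at_top_imp_at_infinity filterlim_ident)
  moreover have "eventually (\<lambda>R. (1 + c / R) ^ CARD('n) = vol (R + c) / vol R) at_top"
    using eventually_gt_at_top[of 0]
  proof eventually_elim
    case (elim R)
    have "R + c = (1 + c / R) * R"
      using elim by (simp add: field_simps)
    then show ?case
      using vol_pos[OF elim] by (metis less_irrefl nonzero_mult_div_cancel_right vol_mult)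
  qed
  ultimately show ?thesis
    by (simp add: tendsto_cong)
qed

text \<open>The shift \<open>c\<close> is allowed for because windows are later enlarged or shrunk
  by a fixed amount, which costs nothing in the limit.\<close>

lemma card_disc_ratio: "((\<lambda>R. card (disc (R + c)) / vol R) \<longlongrightarrow> 1) at_top"
proof (rule tendsto_sandwich)
  show "((\<lambda>R. vol (R + (c - \<rho>)) / vol R) \<longlongrightarrow> 1) at_top" "((\<lambda>R. vol (R + (c + \<rho>)) / vol R) \<longlongrightarrow> 1) at_top"
    by (rule vol_shift_ratio)+
  show "\<forall>\<^sub>F R in at_top. vol (R + (c - \<rho>)) / vol R \<le> card (disc (R + c)) / vol R"
    using eventually_ge_at_top[of "\<rho> - c"] eventually_gt_at_top[of 0]
    by eventually_elim (use card_disc_ge vol_pos in \<open>auto intro!: divide_right_mono simp: algebra_simps less_imp_le\<close>)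
  show "\<forall>\<^sub>F R in at_top. card (disc (R + c)) / vol R \<le> vol (R + (c + \<rho>)) / vol R"
    using eventually_ge_at_top[of "- c"] eventually_gt_at_top[of 0]
    proof eventually_elim
    case (elim R)
    then show ?case
      using card_disc_le[of "R + c"] vol_pos[of R] by (auto intro!: divide_right_mono simp: add.assoc less_imp_le)
  qed
qed

end

section \<open>Densities\<close>

lemma suminf_inverse_power_tail:
  fixes s :: nat
  assumes "s \<ge> 2" "\<epsilon> > 0"
  shows "\<exists>P0. \<forall>P\<ge>P0. \<forall>M. (\<Sum>p\<in>{P<..M}. 1 / real p ^ s) \<le> \<epsilon>"
proof -
  let ?f = "\<lambda>p. 1 / real p ^ s"
  have sm: "summable ?f"
    using inverse_power_summable[OF assms(1), where 'a = real] by (simp add: field_simps)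
  obtain N where N: "\<And>n. n \<ge> N \<Longrightarrow> norm (\<Sum>i. ?f (i + n)) < \<epsilon>"
    using suminf_exist_split[OF assms(2) sm] by blast
  have "(\<Sum>p\<in>{P<..M}. ?f p) \<le> \<epsilon>" if "P \<ge> N" for P M
  proof -
    have "(\<lambda>i. i + (P + 1)) ` {..<M - P} = {P<..M}"
    proof (intro equalityI subsetI)
      fix p assume "p \<in> {P<..M}"
      then show "p \<in> (\<lambda>i. i + (P + 1)) ` {..<M - P}"
        by (intro image_eqI[of _ _ "p - (P + 1)"]) auto
    qed auto
    then have "(\<Sum>p\<in>{P<..M}. ?f p) = (\<Sum>i<M - P. ?f (i + (P + 1)))"
      using sum.reindex[of "\<lambda>i. i + (P + 1)" "{..<M - P}" ?f] by (simp add: inj_on_def)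
    also have "\<dots> \<le> (\<Sum>i. ?f (i + (P + 1)))"
      by (rule sum_le_suminf) (use summable_ignore_initial_segment[OF sm, of "P + 1"] in auto)
    also have "\<dots> \<le> \<epsilon>"
      using N[of "P + 1"] that by simp
    finally show ?thesis .
  qed
  then show ?thesis
    by blast
qed

text \<open>For \<open>q > 0\<close> this is the cube of side \<open>q\<close> with lower corner
  \<open>q * a\<close>; these cubes tile the integer vectors.\<close>

definition cell :: "int \<Rightarrow> int^'n \<Rightarrow> (int^'n) set" where
  "cell q a = {z. vdiv q z = a}"

text \<open>Division with remainder: a cell meets each residue class modulo \<open>q\<close> exactly
  once.\<close>

lemma card_cell_residues:
  fixes A :: "(int^'n) set"
  assumes "q > 0" "A \<subseteq> res_box q"
  shows "card {z \<in> cell q a. vmod q z \<in> A} = card A"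
proof -
  let ?f = "\<lambda>r :: int^'n. (\<chi> i. q * a $ i + r $ i) :: int^'n"
  have "bij_betw ?f A {z \<in> cell q a. vmod q z \<in> A}"
  proof (rule bij_betw_byWitness[where f' = "vmod q"])
    have *: "vmod q (?f r) = r \<and> vdiv q (?f r) = a" if "r \<in> A" for r
      using that assms by (auto simp: vec_eq_iff res_box_def dest!: subsetD)
    show "\<forall>r\<in>A. vmod q (?f r) = r"
      using * by blast
    show "?f ` A \<subseteq> {z \<in> cell q a. vmod q z \<in> A}"
      using * by (auto simp: cell_def)
    show "\<forall>z\<in>{z \<in> cell q a. vmod q z \<in> A}. ?f (vmod q z) = z"
      by (auto simp: cell_def vec_eq_iff) (metis mult_div_mod_eq)
  qed auto
  then show ?thesis
    by (simp add: bij_betw_same_card)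
qed

lemma card_cell: "q > 0 \<Longrightarrow> card (cell q a :: (int^'n) set) = nat q ^ CARD('n)"
  and finite_cell: "q > 0 \<Longrightarrow> finite (cell q a :: (int^'n) set)"
proof -
  assume q: "q > 0"
  have "{z \<in> cell q a. vmod q z \<in> res_box q} = (cell q a :: (int^'n) set)"
    using q by (auto simp: vmod_in_res_box)
  then show *: "card (cell q a :: (int^'n) set) = nat q ^ CARD('n)"
    using card_cell_residues[OF q, of "res_box q" a] by (simp add: card_res_box)
  show "finite (cell q a :: (int^'n) set)"
    by (rule card_ge_0_finite) (simp add: * q)
qed

lemma card_UN_cells:
  fixes C :: "(int^'n) set"
  assumes "finite C" "\<And>a. a \<in> C \<Longrightarrow> finite (S \<inter> cell q a)" "\<And>a. a \<in> C \<Longrightarrow> card (S \<inter> cell q a) = c"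
  shows "card (\<Union>a\<in>C. S \<inter> cell q a) = card C * c"
  using assms by (subst card_UN_disjoint) (auto simp: cell_def)

section \<open>Discs approximated by cells, and the densities of periodic sets\<close>

context unimodular_basis
begin

definition inner_cells :: "int \<Rightarrow> real \<Rightarrow> (int^'n) set" where
  "inner_cells q R = {a. cell q a \<subseteq> disc R}"

definition outer_cells :: "int \<Rightarrow> real \<Rightarrow> (int^'n) set" where
  "outer_cells q R = vdiv q ` disc R"

text \<open>Points of one cell differ by less than \<open>q\<close> in each coordinate, hence by at
  most \<open>\<rho> * q\<close> in norm.\<close>

lemma same_cell_disc:
  assumes "q > 0" "vdiv q z = vdiv q w" "w \<in> disc R"
  shows "z \<in> disc (R + \<rho> * q)"
proof -
  have "\<bar>(z - w) $ i\<bar> \<le> q" for i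
  proof -
    have "z $ i div q = w $ i div q"
      using assms(2) by (metis vdiv_nth)
    then have "(z - w) $ i = z $ i mod q - w $ i mod q"
      using div_mult_mod_eq[of "z $ i" q] div_mult_mod_eq[of "w $ i" q]
      unfolding vector_minus_component \<open>z $ i div q = w $ i div q\<close> by linarith
    moreover have "0 \<le> z $ i mod q" "z $ i mod q < q" "0 \<le> w $ i mod q" "w $ i mod q < q"
      using assms(1) by auto
    ultimately show ?thesis
      by linarith
  qed
  then have "norm (pt (z - w)) \<le> \<rho> * q"
    by (rule norm_lattice_point)
  then show ?thesis
    using disc_translate[OF assms(3), of "z - w"] by simp
qed

lemma finite_outer_cells [simp]: "finite (outer_cells q R)"
  by (simp add: outer_cells_def)

lemma inner_subset_outer: "q > 0 \<Longrightarrow> inner_cells q R \<subseteq> outer_cells q R"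
proof
  fix a assume q: "q > 0" and a: "a \<in> inner_cells q R"
  have "cell q a \<noteq> {}"
    using card_cell[OF q, of a] q by (metis card.empty less_irrefl zero_less_nat_eq zero_less_power)
  then show "a \<in> outer_cells q R"
    using a by (auto simp: inner_cells_def outer_cells_def cell_def)
qed

lemma finite_inner_cells: "q > 0 \<Longrightarrow> finite (inner_cells q R)"
  by (rule finite_subset[OF inner_subset_outer finite_outer_cells])

lemma card_outer_cells_le:
  assumes "q > 0"
  shows "card (outer_cells q R) * nat q ^ CARD('n) \<le> card (disc (R + \<rho> * q))"
proof -
  have "card (\<Union>a\<in>outer_cells q R. UNIV \<inter> cell q a) = card (outer_cells q R) * nat q ^ CARD('n)"
    by (rule card_UN_cells) (use assms in \<open>auto simp: card_cell finite_cell\<close>)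
  moreover have "(\<Union>a\<in>outer_cells q R. UNIV \<inter> cell q a) \<subseteq> disc (R + \<rho> * q)"
    using same_cell_disc[OF assms] by (auto simp: outer_cells_def cell_def)
  ultimately show ?thesis
    by (metis card_mono finite_disc)
qed

lemma card_inner_cells_ge:
  assumes "q > 0"
  shows "card (disc (R - \<rho> * q)) \<le> card (inner_cells q R) * nat q ^ CARD('n)"
proof -
  have "card (\<Union>a\<in>inner_cells q R. UNIV \<inter> cell q a) = card (inner_cells q R) * nat q ^ CARD('n)"
    by (rule card_UN_cells) (use assms in \<open>auto simp: card_cell finite_cell finite_inner_cells\<close>)
  moreover have "disc (R - \<rho> * q) \<subseteq> (\<Union>a\<in>inner_cells q R. UNIV \<inter> cell q a)"
  proof
    fix z assume z: "z \<in> disc (R - \<rho> * q)"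
    have "cell q (vdiv q z) \<subseteq> disc R"
      using same_cell_disc[OF assms _ z] by (force simp: cell_def)
    then show "z \<in> (\<Union>a\<in>inner_cells q R. UNIV \<inter> cell q a)"
      by (auto simp: inner_cells_def cell_def)
  qed
  moreover have "finite (\<Union>a\<in>inner_cells q R. UNIV \<inter> cell q a)"
    using assms by (auto simp: finite_cell finite_inner_cells)
  ultimately show ?thesis
    by (metis card_mono)
qed

text \<open>A cell has \<open>q ^ n\<close> points. The inner cells cover
  \<open>disc (R - \<rho> * q)\<close> and the outer cells lie in
  \<open>disc (R + \<rho> * q)\<close>, so both counts are squeezed.\<close>

lemma card_cells_ratio:
  assumes "q > 0"
  shows "((\<lambda>R. card (outer_cells q R) / vol R) \<longlongrightarrow> 1 / of_int q ^ CARD('n)) at_top"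
    and "((\<lambda>R. card (inner_cells q R) / vol R) \<longlongrightarrow> 1 / of_int q ^ CARD('n)) at_top"
proof -
  have Q: "real (nat q ^ CARD('n)) = of_int q ^ CARD('n)" "(0 :: real) < of_int q ^ CARD('n)"
    using assms by simp_all
  have lim: "((\<lambda>R. card (disc (R + c)) / vol R / of_int q ^ CARD('n)) \<longlongrightarrow> 1 / of_int q ^ CARD('n)) at_top" for c
    by (intro tendsto_divide card_disc_ratio tendsto_const less_imp_neq[OF Q(2), symmetric])
  have lower: "card (disc (R + (- \<rho> * q))) / vol R / of_int q ^ CARD('n) \<le> card (inner_cells q R) / vol R"
    and mid: "card (inner_cells q R) / vol R \<le> card (outer_cells q R) / vol R"
    and upper: "card (outer_cells q R) / vol R \<le> card (disc (R + \<rho> * q)) / vol R / of_int q ^ CARD('n)"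
    if "R > 0" for R
  proof -
    have "real (card (disc (R + (- \<rho> * q)))) \<le> real (card (inner_cells q R)) * of_int q ^ CARD('n)"
      using of_nat_mono[OF card_inner_cells_ge[OF assms, of R], where 'a = real]
      by (simp only: of_nat_mult Q(1)) simp
    then show "card (disc (R + (- \<rho> * q))) / vol R / of_int q ^ CARD('n) \<le> card (inner_cells q R) / vol R"
      using Q vol_pos[OF that] by (simp add: field_simps)
    have "real (card (outer_cells q R)) * of_int q ^ CARD('n) \<le> real (card (disc (R + \<rho> * q)))"
      using of_nat_mono[OF card_outer_cells_le[OF assms, of R], where 'a = real]
      by (simp only: of_nat_mult Q(1))
    then show "card (outer_cells q R) / vol R \<le> card (disc (R + \<rho> * q)) / vol R / of_int q ^ CARD('n)"
      using Q vol_pos[OF that] by (simp add: field_simps)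
    show "card (inner_cells q R) / vol R \<le> card (outer_cells q R) / vol R"
      using vol_pos[OF that] card_mono[OF finite_outer_cells inner_subset_outer[OF assms]]
      by (simp add: divide_right_mono)
  qed
  have ev: "\<forall>\<^sub>F R in at_top. (R::real) > 0"
    by (rule eventually_gt_at_top)
  show "((\<lambda>R. card (outer_cells q R) / vol R) \<longlongrightarrow> 1 / of_int q ^ CARD('n)) at_top"
    by (rule tendsto_sandwich[OF _ _ lim[of "- \<rho> * q"] lim[of "\<rho> * q"]];
        rule eventually_mono[OF ev]) (meson lower mid upper order_trans)+
  show "((\<lambda>R. card (inner_cells q R) / vol R) \<longlongrightarrow> 1 / of_int q ^ CARD('n)) at_top"
    by (rule tendsto_sandwich[OF _ _ lim[of "- \<rho> * q"] lim[of "\<rho> * q"]];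
        rule eventually_mono[OF ev]) (meson lower mid upper order_trans)+
qed

definition has_density :: "(int^'n) set \<Rightarrow> real \<Rightarrow> bool" where
  "has_density S d \<longleftrightarrow> ((\<lambda>R. card (S \<inter> disc R) / vol R) \<longlongrightarrow> d) at_top"

text \<open>Every cell contains exactly \<open>card A\<close> points of the set, so the inner and
  outer cells bracket the count in the disc.\<close>

lemma has_density_periodic:
  assumes q: "q > 0" and A: "A \<subseteq> res_box q"
  shows "has_density {z. vmod q z \<in> A} (card A / of_int q ^ CARD('n))"
proof -
  let ?S = "{z. vmod q z \<in> A}"
  have c: "card (?S \<inter> cell q a) = card A" "finite (?S \<inter> cell q a)" for a
    using card_cell_residues[OF assms, of a] finite_cell[OF q, of a] by (simp_all add: Int_def conj_commute)
  have lower: "card (inner_cells q R) * card A \<le> card (?S \<inter> disc R)" for R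
  proof -
    have "card (\<Union>a\<in>inner_cells q R. ?S \<inter> cell q a) = card (inner_cells q R) * card A"
      by (rule card_UN_cells) (use c q finite_inner_cells in auto)
    moreover have "(\<Union>a\<in>inner_cells q R. ?S \<inter> cell q a) \<subseteq> ?S \<inter> disc R"
      by (auto simp: inner_cells_def)
    ultimately show ?thesis
      by (metis card_mono finite_Int finite_disc)
  qed
  have upper: "card (?S \<inter> disc R) \<le> card (outer_cells q R) * card A" for R
  proof -
    have "card (\<Union>a\<in>outer_cells q R. ?S \<inter> cell q a) = card (outer_cells q R) * card A"
      by (rule card_UN_cells) (use c in auto)
    moreover have "?S \<inter> disc R \<subseteq> (\<Union>a\<in>outer_cells q R. ?S \<inter> cell q a)"
      by (auto simp: outer_cells_def cell_def)
    moreover have "finite (\<Union>a\<in>outer_cells q R. ?S \<inter> cell q a)"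
      using c(2) by (intro finite_UN_I finite_outer_cells)
    ultimately show ?thesis
      by (metis card_mono)
  qed
  have "((\<lambda>R. card (inner_cells q R) / vol R * card A) \<longlongrightarrow> 1 / of_int q ^ CARD('n) * card A) at_top"
    "((\<lambda>R. card (outer_cells q R) / vol R * card A) \<longlongrightarrow> 1 / of_int q ^ CARD('n) * card A) at_top"
    by (intro tendsto_mult_right card_cells_ratio q)+
  then have "((\<lambda>R. card (?S \<inter> disc R) / vol R) \<longlongrightarrow> 1 / of_int q ^ CARD('n) * card A) at_top"
  proof (rule tendsto_sandwich[rotated 2])
    show "\<forall>\<^sub>F R in at_top. card (inner_cells q R) / vol R * card A \<le> card (?S \<inter> disc R) / vol R"
      using eventually_gt_at_top[of 0]
    proof eventually_elim
      case (elim R)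
      have "real (card (inner_cells q R)) * card A \<le> card (?S \<inter> disc R)"
        using lower[of R] by (simp flip: of_nat_mult)
      then show ?case
        using vol_pos[OF elim] by (simp add: divide_right_mono)
    qed
    show "\<forall>\<^sub>F R in at_top. card (?S \<inter> disc R) / vol R \<le> card (outer_cells q R) / vol R * card A"
      using eventually_gt_at_top[of 0]
    proof eventually_elim
      case (elim R)
      have "card (?S \<inter> disc R) \<le> real (card (outer_cells q R)) * card A"
        using upper[of R] by (simp flip: of_nat_mult)
      then show ?case
        using vol_pos[OF elim] by (simp add: divide_right_mono)
    qed
  qed
  then show ?thesis
    by (simp add: has_density_def)
qed

lemma has_density_residues:
  fixes A :: "'i \<Rightarrow> (int^'n) set"
  assumes S: "finite S" "\<And>i. i \<in> S \<Longrightarrow> m i > 0" "\<And>i. i \<in> S \<Longrightarrow> A i \<subseteq> res_box (m i)"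
    and "\<And>i j. i \<in> S \<Longrightarrow> j \<in> S \<Longrightarrow> i \<noteq> j \<Longrightarrow> coprime (m i) (m j)"
  shows "has_density {z. \<forall>i\<in>S. vmod (m i) z \<in> A i} (\<Prod>i\<in>S. card (A i) / of_int (m i) ^ CARD('n))"
proof -
  let ?q = "\<Prod>i\<in>S. m i"
  let ?A = "{z \<in> res_box ?q. \<forall>i\<in>S. vmod (m i) z \<in> A i}"
  have q: "?q > 0"
    using S by (intro prod_pos) auto
  have "has_density {z. vmod ?q z \<in> ?A} (card ?A / of_int ?q ^ CARD('n))"
    using q by (intro has_density_periodic) auto
  moreover have "{z. vmod ?q z \<in> ?A} = {z. \<forall>i\<in>S. vmod (m i) z \<in> A i}"
    using q S(1) by (auto simp: vmod_in_res_box vmod_vmod[OF dvd_prodI])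
  moreover have "card ?A = (\<Prod>i\<in>S. card (A i))"
    by (rule card_res_box_prod) (use assms in auto)
  ultimately show ?thesis
    by (simp add: prod_dividef prod_power_distrib)
qed

section \<open>Points congruent to a given point modulo a large k-th power\<close>

text \<open>One constant must serve all \<open>r > 0\<close>, since \<open>r\<close> will be about
  \<open>R / p ^ k\<close> with \<open>p\<close> large. If \<open>\<kappa> * r \<le> 1\<close>, all
  coordinates are below 1 in absolute value and nothing but the origin is in the disc; otherwise the
  boundary term \<open>\<rho>\<close> is at most \<open>\<rho> * \<kappa> * r\<close>.\<close>

lemma card_disc_minus_0:
  assumes "r > 0"
  shows "real (card (disc r - {0})) \<le> (1 + \<rho> * \<kappa>) ^ CARD('n) * vol r"
proof (cases "\<kappa> * r \<le> 1")
  case True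
  have "disc r - {0} = {}"
  proof safe
    fix z assume "z \<in> disc r"
    then have "\<kappa> * norm (pt z) < \<kappa> * r"
      using \<kappa>_pos by (simp add: disc_def)
    then have "\<bar>z $ i\<bar> < 1" for i
      using coord_lattice_point[of z i] True by linarith
    then show "z = 0"
      by (simp add: vec_eq_iff)
  qed
  then show ?thesis
    using vol_pos[OF assms] \<rho>_pos \<kappa>_pos by (simp only: card.empty) (simp add: less_imp_le)
next
  case False
  have "real (card (disc r - {0})) \<le> card (disc r)"
    by (simp add: card_mono)
  also have "\<dots> \<le> vol (r + \<rho>)"
    using card_disc_le assms by simp
  also have "\<dots> \<le> vol ((1 + \<rho> * \<kappa>) * r)"
  proof (rule vol_mono)
    have "\<rho> * 1 \<le> \<rho> * (\<kappa> * r)"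
      using False \<rho>_pos by (intro mult_left_mono) auto
    then show "r + \<rho> \<le> (1 + \<rho> * \<kappa>) * r"
      by (simp add: algebra_simps)
  qed (use assms \<rho>_pos in simp)
  also have "\<dots> = (1 + \<rho> * \<kappa>) ^ CARD('n) * vol r"
    by (rule vol_mult)
  finally show ?thesis .
qed

definition divisible_beyond :: "nat \<Rightarrow> nat \<Rightarrow> int^'n \<Rightarrow> (int^'n) set" where
  "divisible_beyond k P x = {z. z \<noteq> x \<and> (\<exists>p>P. \<forall>i. int p ^ k dvd (z - x) $ i)}"

text \<open>A point counted here is \<open>x + p ^ k * y\<close> with nonzero \<open>y\<close> in a
  disc of radius about \<open>R / p ^ k\<close>. There are at most a constant times
  \<open>vol R / p ^ (n * k)\<close> such \<open>y\<close>, and the sum over \<open>p > P\<close> is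
  a tail of a convergent series. The threshold \<open>P0\<close> is uniform in \<open>x\<close>; the
  radius from which the bound holds may depend on \<open>x\<close>.\<close>

lemma divisible_beyond_sparse:
  assumes k: "k \<ge> 1" "CARD('n) * k \<ge> 2" and "\<epsilon> > 0"
  shows "\<exists>P0. \<forall>P\<ge>P0. \<forall>x. \<forall>\<^sub>F R in at_top. card (divisible_beyond k P x \<inter> disc R) \<le> \<epsilon> * vol R"
proof -
  define C where "C = (1 + \<rho> * \<kappa>) ^ CARD('n)"
  have C: "C > 0"
    unfolding C_def using \<rho>_pos \<kappa>_pos by (intro zero_less_power add_pos_pos mult_pos_pos) auto
  \<comment> \<open>The factor 2 pays for replacing \<open>vol (R + ?c)\<close> by
    \<open>2 * vol R\<close> at the end.\<close>
  obtain P0 where P0: "\<And>P M. P \<ge> P0 \<Longrightarrow> (\<Sum>p\<in>{P<..M}. 1 / real p ^ (CARD('n) * k)) \<le> \<epsilon> / (2 * C)"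
    using suminf_inverse_power_tail[OF k(2), of "\<epsilon> / (2 * C)"] C assms(3) by auto
  have "\<forall>\<^sub>F R in at_top. card (divisible_beyond k P x \<inter> disc R) \<le> \<epsilon> * vol R" if P: "P \<ge> P0" for P x
  proof -
    let ?c = "norm (pt x)"
    have bound: "card (divisible_beyond k P x \<inter> disc R) \<le> \<epsilon> / 2 * vol (R + ?c)" if R: "R > 0" for R
    proof -
      \<comment> \<open>A nonzero coordinate of \<open>z - x\<close> is a multiple of
        \<open>p ^ k\<close>, hence at least \<open>p\<close> in absolute value; so no
        \<open>p\<close> above \<open>M\<close> occurs within the disc.\<close>
      define M where "M = nat \<lceil>\<kappa> * (R + ?c)\<rceil>"
      let ?T = "divisible_beyond k P x \<inter> disc R"
      let ?f = "\<lambda>p :: nat. \<lambda>y :: int^'n. (\<chi> i. x $ i + int p ^ k * y $ i) :: int^'n"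
      let ?D = "\<lambda>p :: nat. disc ((R + ?c) / real p ^ k) - {0}"
      have "?T \<subseteq> (\<Union>p\<in>{P<..M}. ?f p ` ?D p)"
      proof
        fix z assume z: "z \<in> ?T"
        then obtain p where p: "p > P" "\<And>i. int p ^ k dvd (z - x) $ i" and "z \<noteq> x"
          by (auto simp: divisible_beyond_def)
        define y where "y = (\<chi> i. (z - x) $ i div int p ^ k)"
        have y: "z - x = (\<chi> i. int p ^ k * y $ i)"
          using p(2) by (simp add: y_def vec_eq_iff)
        have "y \<noteq> 0"
        proof
          assume "y = 0"
          then have "z - x = 0"
            unfolding y by (simp add: vec_eq_iff)
          then show False
            using \<open>z \<noteq> x\<close> by simp
        qed
        then obtain i where i: "y $ i \<noteq> 0"
          by (auto simp: vec_eq_iff)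
        have zx: "norm (pt (z - x)) < R + ?c"
          using z norm_triangle_ineq4[of "pt z" "pt x"]
          by (simp add: disc_def lattice_point_simps)
        have "int p \<le> int p ^ k"
          using k(1) p(1) by (intro self_le_power) auto
        also have "\<dots> * 1 \<le> int p ^ k * \<bar>y $ i\<bar>"
          using i by (intro mult_left_mono) auto
        also have "\<dots> = \<bar>(z - x) $ i\<bar>"
          by (simp add: y abs_mult)
        finally have "real p \<le> \<kappa> * norm (pt (z - x))"
          using coord_lattice_point[of "z - x" i] by linarith
        also have "\<dots> \<le> \<kappa> * (R + ?c)"
          using zx \<kappa>_pos by simp
        finally have "p \<le> M"
          unfolding M_def by linarith
        have "pt (z - x) = real p ^ k *\<^sub>R pt y"
          unfolding y lattice_point_def matrix_vector_mult_scaleR[symmetric]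
          by (rule arg_cong[where f = "(*v) B"]) (simp add: vec_eq_iff)
        then have "real p ^ k * norm (pt y) < R + ?c"
          using zx by simp
        then have "y \<in> ?D p"
          using p(1) \<open>y \<noteq> 0\<close> by (simp add: disc_def field_simps)
        moreover have "z = ?f p y"
          using y by (simp add: vec_eq_iff algebra_simps)
        ultimately show "z \<in> (\<Union>p\<in>{P<..M}. ?f p ` ?D p)"
          using p(1) \<open>p \<le> M\<close> by (intro UN_I[of p] image_eqI[of z _ y]) simp_all
      qed
      then have "card ?T \<le> card (\<Union>p\<in>{P<..M}. ?f p ` ?D p)"
        by (intro card_mono) auto
      also have "\<dots> \<le> (\<Sum>p\<in>{P<..M}. card (?f p ` ?D p))"
        by (intro card_UN_le) auto
      also have "\<dots> \<le> (\<Sum>p\<in>{P<..M}. card (?D p))"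
        by (intro sum_mono card_image_le) auto
      finally have "real (card ?T) \<le> (\<Sum>p\<in>{P<..M}. real (card (?D p)))"
        by (metis of_nat_le_iff of_nat_sum)
      also have "\<dots> \<le> (\<Sum>p\<in>{P<..M}. C * vol (R + ?c) * (1 / real p ^ (CARD('n) * k)))"
      proof (rule sum_mono)
        fix p assume p: "p \<in> {P<..M}"
        have "real (card (?D p)) \<le> C * vol ((R + ?c) / real p ^ k)"
          unfolding C_def by (rule card_disc_minus_0) (use R p in \<open>simp add: add_pos_nonneg\<close>)
        also have "vol ((R + ?c) / real p ^ k) = vol (R + ?c) * (1 / real p ^ (CARD('n) * k))"
          using vol_mult[of "1 / real p ^ k" "R + ?c"]
          by (simp add: power_divide power_mult[symmetric] mult.commute)
        finally show "real (card (?D p)) \<le> C * vol (R + ?c) * (1 / real p ^ (CARD('n) * k))"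
          by simp
      qed
      also have "\<dots> = C * vol (R + ?c) * (\<Sum>p\<in>{P<..M}. 1 / real p ^ (CARD('n) * k))"
        by (simp add: sum_distrib_left)
      also have "\<dots> \<le> C * vol (R + ?c) * (\<epsilon> / (2 * C))"
        using P0[OF P] C vol_pos[of "R + ?c"] R by (intro mult_left_mono) (auto simp: add_pos_nonneg)
      finally show ?thesis
        using C by (simp add: field_simps)
    qed
    have "\<forall>\<^sub>F R in at_top. vol (R + ?c) / vol R < 2"
      using order_tendstoD(2)[OF vol_shift_ratio, of 2] by simp
    then show ?thesis
      using eventually_gt_at_top[of 0]
    proof eventually_elim
      case (elim R)
      then have "vol (R + ?c) \<le> 2 * vol R"
        using vol_pos[of R] by (simp add: field_simps)
      then have "\<epsilon> / 2 * vol (R + ?c) \<le> \<epsilon> / 2 * (2 * vol R)"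
        using assms(3) by (intro mult_left_mono) auto
      then show ?case
        using bound[of R] elim by simp
    qed
  qed
  then show ?thesis
    by blast
qed

end

section \<open>The Euler product\<close>

text \<open>The zeta series sieved by the primes in \<open>S\<close> in the manner of Eratosthenes;
  the index \<open>m = 0\<close> contributes 0.\<close>

definition coprime_sum :: "nat \<Rightarrow> nat set \<Rightarrow> real" where
  "coprime_sum s S = (\<Sum>m. if m \<ge> 1 \<and> (\<forall>p\<in>S. \<not> p dvd m) then 1 / real m ^ s else 0)"

lemma summable_inverse_power: "s \<ge> 2 \<Longrightarrow> summable (\<lambda>m. 1 / real m ^ s)"
  using inverse_power_summable[of s, where 'a = real] by (simp add: field_simps)

lemma summable_coprime:
  assumes "s \<ge> 2"
  shows "summable (\<lambda>m. if m \<ge> 1 \<and> Q m then 1 / real m ^ s else 0)"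
  by (rule summable_comparison_test'[OF summable_inverse_power[OF assms], of 0]) auto

lemma coprime_sum_empty:
  assumes "s \<ge> 2"
  shows "coprime_sum s {} = zeta (real s)"
proof -
  let ?f = "\<lambda>m. if m \<ge> 1 \<and> (\<forall>p\<in>{}. \<not> p dvd m) then 1 / real m ^ s else 0"
  have "(\<Sum>m. ?f (Suc m)) = suminf ?f - ?f 0"
    by (rule suminf_split_head[OF summable_coprime[OF assms]])
  moreover have "?f (Suc m) = 1 / real (Suc m) powr real s" for m
    by (simp add: powr_realpow)
  ultimately show ?thesis
    by (simp add: coprime_sum_def zeta_def)
qed

text \<open>The terms removed by \<open>p\<close> are those at \<open>p * m\<close>. The other
  primes do not see the factor \<open>p\<close>, so the removed terms sum to
  \<open>1 / p ^ s\<close> times the old sum.\<close>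

lemma coprime_sum_insert:
  assumes s: "s \<ge> 2" and p: "prime p" and S: "\<And>q. q \<in> S \<Longrightarrow> prime q" "p \<notin> S"
  shows "coprime_sum s (insert p S) = (1 - 1 / real p ^ s) * coprime_sum s S"
proof -
  let ?g = "\<lambda>m. if m \<ge> 1 \<and> (\<forall>q\<in>S. \<not> q dvd m) then 1 / real m ^ s else 0"
  let ?h = "\<lambda>m. if m \<ge> 1 \<and> (p dvd m \<and> (\<forall>q\<in>S. \<not> q dvd m)) then 1 / real m ^ s else 0"
  let ?g' = "\<lambda>m. if m \<ge> 1 \<and> (\<forall>q\<in>insert p S. \<not> q dvd m) then 1 / real m ^ s else 0"
  have p1: "p > 1"
    using p prime_gt_1_nat by blast
  have "suminf ?h = (\<Sum>m. ?h (p * m))"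
  proof (rule suminf_mono_reindex[symmetric])
    show "strict_mono ((*) p)"
      using p1 by (simp add: strict_mono_def)
    show "?h m = 0" if "m \<notin> range ((*) p)" for m
      using that by (auto elim!: dvdE)
  qed
  also have "(\<lambda>m. ?h (p * m)) = (\<lambda>m. 1 / real p ^ s * ?g m)"
  proof
    fix m
    have "q dvd p * m \<longleftrightarrow> q dvd m" if "q \<in> S" for q
      using that S p by (metis prime_dvd_mult_iff primes_dvd_imp_eq)
    then show "?h (p * m) = 1 / real p ^ s * ?g m"
      using p1 by (auto simp: power_mult_distrib)
  qed
  also have "(\<Sum>m. 1 / real p ^ s * ?g m) = 1 / real p ^ s * suminf ?g"
    by (rule suminf_mult[OF summable_coprime[OF s]])
  finally have h: "coprime_sum s S = coprime_sum s (insert p S) + 1 / real p ^ s * coprime_sum s S"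
    if "suminf ?g = suminf ?g' + suminf ?h"
    using that unfolding coprime_sum_def by simp
  have "suminf ?g = (\<Sum>m. ?g' m + ?h m)"
    by (rule suminf_cong) auto
  also have "\<dots> = suminf ?g' + suminf ?h"
    by (rule suminf_add[symmetric]; rule summable_coprime[OF s])
  finally show ?thesis
    using h by (simp only: left_diff_distrib) simp
qed

lemma coprime_sum_eq:
  assumes "s \<ge> 2" "finite S" "\<And>p. p \<in> S \<Longrightarrow> prime p"
  shows "coprime_sum s S = (\<Prod>p\<in>S. 1 - 1 / real p ^ s) * zeta (real s)"
  using assms(2,3)
proof (induction S)
  case empty
  then show ?case
    by (simp add: coprime_sum_empty[OF assms(1)])
next
  case (insert p S)
  then show ?case
    using coprime_sum_insert[OF assms(1), of p S] by simp
qed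

lemma coprime_sum_ge_1:
  assumes "s \<ge> 2" "\<And>p. p \<in> S \<Longrightarrow> prime p"
  shows "coprime_sum s S \<ge> 1"
proof -
  let ?g = "\<lambda>m. if m \<ge> 1 \<and> (\<forall>p\<in>S. \<not> p dvd m) then 1 / real m ^ s else 0"
  have "sum ?g {1} \<le> suminf ?g"
    by (rule sum_le_suminf[OF summable_coprime[OF assms(1)]]) auto
  moreover have "sum ?g {1} = 1"
  proof -
    have "1 \<notin> S"
      using assms(2) not_prime_1 by blast
    then show ?thesis
      by auto
  qed
  ultimately show ?thesis
    by (simp add: coprime_sum_def)
qed

lemma zeta_ge_1: "s \<ge> 2 \<Longrightarrow> zeta (real s) \<ge> 1"
  using coprime_sum_ge_1[of s "{}"] coprime_sum_empty[of s] by simp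

text \<open>The sieved sum equals the finite product times \<open>zeta s\<close>, and its term at 1
  survives.\<close>

lemma euler_product_ge:
  assumes "s \<ge> 2" "finite S" "\<And>p. p \<in> S \<Longrightarrow> prime p"
  shows "1 / zeta (real s) \<le> (\<Prod>p\<in>S. 1 - 1 / real p ^ s)"
  using coprime_sum_ge_1[OF assms(1), of S] coprime_sum_eq[OF assms] zeta_ge_1[OF assms(1)] assms(3)
  by (simp add: field_simps)

text \<open>A survivor of the sieve other than 1 has no prime factor up to \<open>P\<close>, hence
  exceeds \<open>P\<close>; the sieved sum is therefore at most 1 plus a tail.\<close>

lemma euler_product_le:
  assumes s: "s \<ge> 2" and "\<epsilon> > 0"
  shows "\<exists>P0. \<forall>P\<ge>P0. (\<Prod>p\<in>{p. prime p \<and> p \<le> P}. 1 - 1 / real p ^ s) \<le> 1 / zeta (real s) + \<epsilon>"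
proof -
  obtain P0 where P0: "\<And>P M. P \<ge> P0 \<Longrightarrow> (\<Sum>p\<in>{P<..M}. 1 / real p ^ s) \<le> \<epsilon>"
    using suminf_inverse_power_tail[OF assms] by blast
  have "(\<Prod>p\<in>{p. prime p \<and> p \<le> P}. 1 - 1 / real p ^ s) \<le> 1 / zeta (real s) + \<epsilon>" if P: "P \<ge> P0" for P
  proof -
    let ?S = "{p. prime p \<and> p \<le> P}"
    let ?g = "\<lambda>m. if m \<ge> 1 \<and> (\<forall>p\<in>?S. \<not> p dvd m) then 1 / real m ^ s else 0"
    have "coprime_sum s ?S \<le> 1 + \<epsilon>"
      unfolding coprime_sum_def
    proof (rule suminf_le_const[OF summable_coprime[OF s]])
      fix n
      have "sum ?g {..<n} = sum ?g ({..<n} \<inter> insert 1 {P<..n})"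
      proof (rule sum.mono_neutral_right)
        show "\<forall>m\<in>{..<n} - {..<n} \<inter> insert 1 {P<..n}. ?g m = 0"
        proof
          fix m assume m: "m \<in> {..<n} - {..<n} \<inter> insert 1 {P<..n}"
          show "?g m = 0"
          proof (cases "m \<ge> 1")
            case True
            then obtain q where "prime q" "q dvd m"
              using m by (metis DiffD2 DiffD1 IntI insertI1 prime_factor_nat)
            moreover have "q \<le> P"
              using dvd_imp_le[OF \<open>q dvd m\<close>] True m by auto
            ultimately show ?thesis
              by auto
          qed auto
        qed
      qed auto
      also have "\<dots> \<le> sum ?g (insert 1 {P<..n})"
        by (rule sum_mono2) auto
      also have "\<dots> \<le> ?g 1 + sum ?g {P<..n}"
        by (cases "1 \<in> {P<..n}") (auto simp: insert_absorb)
      also have "\<dots> \<le> 1 + (\<Sum>p\<in>{P<..n}. 1 / real p ^ s)"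
        by (intro add_mono sum_mono) auto
      also have "\<dots> \<le> 1 + \<epsilon>"
        using P0[OF P] by simp
      finally show "sum ?g {..<n} \<le> 1 + \<epsilon>" .
    qed
    moreover have "coprime_sum s ?S = (\<Prod>p\<in>?S. 1 - 1 / real p ^ s) * zeta (real s)"
      by (rule coprime_sum_eq[OF s]) auto
    ultimately have "(\<Prod>p\<in>?S. 1 - 1 / real p ^ s) * zeta (real s) \<le> 1 + \<epsilon>"
      by (simp only:)
    then have "(\<Prod>p\<in>?S. 1 - 1 / real p ^ s) \<le> 1 / zeta (real s) + \<epsilon> / zeta (real s)"
      using zeta_ge_1[OF s] by (simp add: field_simps)
    moreover have "\<epsilon> / zeta (real s) \<le> \<epsilon>"
      using zeta_ge_1[OF s] \<open>\<epsilon> > 0\<close> by (simp add: field_simps)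
    ultimately show ?thesis
      by linarith
  qed
  then show ?thesis
    by blast
qed

section \<open>Admissible sets\<close>

abbreviation pmod :: "nat \<Rightarrow> nat \<Rightarrow> int^'n \<Rightarrow> int^'n" where
  "pmod k p \<equiv> vmod (int p ^ k)"

lemma coprime_prime_powers: "prime (p :: nat) \<Longrightarrow> prime q \<Longrightarrow> p \<noteq> q \<Longrightarrow> coprime (int p ^ k) (int q ^ k)"
  by (simp add: primes_coprime coprime_int_iff)

lemma ex_inj_primes:
  assumes "finite G"
  shows "\<exists>\<pi>. inj_on \<pi> G \<and> (\<forall>g\<in>G. prime (\<pi> g) \<and> \<pi> g > (L :: nat))"
proof -
  have "infinite ({p :: nat. prime p} - {..L})"
    using primes_infinite by (rule Diff_infinite_finite[rotated]) simp
  then obtain A where A: "A \<subseteq> {p :: nat. prime p} - {..L}" "finite A" "card A = card G"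
    using infinite_arbitrarily_large by metis
  then obtain \<pi> where "bij_betw \<pi> G A"
    using finite_same_card_bij[OF assms] by metis
  then show ?thesis
    using A(1) by (intro exI[of _ \<pi>]) (auto simp: bij_betw_def)
qed

definition admissible :: "nat \<Rightarrow> (int^'n) set \<Rightarrow> bool" where
  "admissible k Z \<longleftrightarrow> (\<forall>p. prime p \<longrightarrow> (\<exists>c. \<forall>z\<in>Z. pmod k p z \<noteq> pmod k p c))"

lemma admissible_subset: "admissible k Z \<Longrightarrow> W \<subseteq> Z \<Longrightarrow> admissible k W"
  unfolding admissible_def by (meson subsetD)

text \<open>Pigeonhole: there are fewer points than residue classes.\<close>

lemma ex_residue_avoiding:
  fixes Z :: "(int^'n) set"
  assumes "finite Z" "q > 0" "card Z < nat q ^ CARD('n)"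
  shows "\<exists>c. \<forall>z\<in>Z. vmod q z \<noteq> vmod q c"
proof -
  have "card (vmod q ` Z) < card (res_box q :: (int^'n) set)"
    using card_image_le[OF assms(1), of "vmod q"] assms(3) by (simp add: card_res_box)
  then obtain c where "c \<in> res_box q" "c \<notin> vmod q ` Z"
    by (metis assms(1) card_mono finite_imageI not_less subsetI)
  then show ?thesis
    using vmod_res_box[of c q] by (intro exI[of _ c]) auto
qed

definition power_free :: "nat \<Rightarrow> (int^'n) set" where
  "power_free k = {z. \<forall>p. prime p \<longrightarrow> \<not> (\<forall>i. int p ^ k dvd z $ i)}"

text \<open>Thus the translate by \<open>t\<close> of the k-free points misses exactly the class of
  \<open>t\<close> at every prime as far as membership is concerned, and to control the translate is
  to prescribe \<open>t\<close> modulo prime powers.\<close>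

lemma power_free_diff_iff:
  "x - t \<in> power_free k \<longleftrightarrow> (\<forall>p. prime p \<longrightarrow> pmod k p x \<noteq> pmod k p t)"
  by (simp add: power_free_def vmod_eq_iff)

section \<open>Realizing admissible patterns by translates, and the density of the k-free
  points\<close>

context unimodular_basis
begin

lemma has_density_crt:
  assumes "finite S" "\<And>p. p \<in> S \<Longrightarrow> prime p"
  shows "has_density {z. \<forall>p\<in>S. pmod k p z = pmod k p (c p)}
    (\<Prod>p\<in>S. 1 / real p ^ (CARD('n) * k))"
proof -
  have pos: "int p ^ k > 0" if "p \<in> S" for p
    using assms(2)[OF that] prime_gt_0_nat by simp
  have "has_density {z. \<forall>p\<in>S. pmod k p z \<in> {pmod k p (c p)}}
      (\<Prod>p\<in>S. card {pmod k p (c p)} / of_int (int p ^ k) ^ CARD('n))"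
    using assms pos by (intro has_density_residues coprime_prime_powers) (auto intro: vmod_in_res_box)
  then show ?thesis
    by (simp add: power_mult[symmetric] mult.commute)
qed

lemma has_density_pos_ex:
  assumes "has_density S d" "d > 0"
  shows "\<exists>z. z \<in> S"
proof (rule ccontr)
  assume "\<not> (\<exists>z. z \<in> S)"
  then have "has_density S 0"
    by (auto simp: has_density_def)
  then show False
    using assms tendsto_unique[OF trivial_limit_at_top_linorder] unfolding has_density_def by (metis less_irrefl)
qed

text \<open>Existence is read off from the positive density of the solutions.\<close>

lemma chinese_remainder:
  assumes "finite S" "\<And>p. p \<in> S \<Longrightarrow> prime p"
  shows "\<exists>t :: int^'n. \<forall>p\<in>S. pmod k p t = pmod k p (c p)"
proof -
  have "(\<Prod>p\<in>S. 1 / real p ^ (CARD('n) * k)) > 0"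
    using assms(2) prime_gt_0_nat by (intro prod_pos) auto
  then show ?thesis
    using has_density_pos_ex[OF has_density_crt[OF assms]] by auto
qed

text \<open>Large primes carry the residues that remove the points outside \<open>P\<close>; the density of the
  translations that are good for all primes up to a bound beats the density of those which are bad
  for some larger prime.\<close>

lemma admissible_realized:
  fixes F :: "(int^'n) set"
  assumes k: "k \<ge> 1" "CARD('n) * k \<ge> 2" and F: "finite F" "P \<subseteq> F" and adm: "admissible k P"
  shows "\<exists>t. \<forall>x\<in>F. x - t \<in> power_free k \<longleftrightarrow> x \<in> P"
proof -
  define s where "s = CARD('n) * k"
  define N where "N = card P"
  have finP: "finite P"
    using F finite_subset by blast
  obtain c where c: "\<And>p z. prime p \<Longrightarrow> z \<in> P \<Longrightarrow> pmod k p z \<noteq> pmod k p (c p)"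
    using adm unfolding admissible_def by metis
  \<comment> \<open>With this bound, forbidding \<open>N\<close> classes at each prime beyond
    \<open>P0\<close> costs at most half of the density.\<close>
  obtain P0' where P0': "\<And>Q M. Q \<ge> P0' \<Longrightarrow> (\<Sum>p\<in>{Q<..M}. 1 / real p ^ s) \<le> 1 / (2 * (real N + 1))"
    using suminf_inverse_power_tail[of s "1 / (2 * (real N + 1))"] k(2) by (auto simp: s_def)
  define P0 where "P0 = max P0' 2"
  \<comment> \<open>Primes above \<open>L\<close> separate the points of \<open>F\<close>: a nonzero
    coordinate difference is too small to be divisible by \<open>p ^ k\<close>.\<close>
  obtain L where L: "\<And>x g i. x \<in> F \<Longrightarrow> g \<in> F \<Longrightarrow> \<bar>(x - g) $ i\<bar> \<le> int L"
  proof -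
    let ?D = "(\<lambda>(x, g, i). nat \<bar>(x - g) $ i\<bar>) ` (F \<times> F \<times> UNIV)"
    have fin: "finite ?D"
      using F by simp
    have "\<bar>(x - g) $ i\<bar> \<le> int (Max ?D)" if "x \<in> F" "g \<in> F" for x g i
    proof -
      have "nat \<bar>(x - g) $ i\<bar> \<le> Max ?D"
        using that by (intro Max_ge[OF fin]) (force simp: image_iff)
      then show ?thesis
        by linarith
    qed
    then show ?thesis
      using that by blast
  qed
  obtain \<pi> where \<pi>: "inj_on \<pi> (F - P)" "\<And>g. g \<in> F - P \<Longrightarrow> prime (\<pi> g)"
    "\<And>g. g \<in> F - P \<Longrightarrow> \<pi> g > max P0 L"
    using ex_inj_primes[of "F - P" "max P0 L"] F by (metis finite_Diff)
  define S1 where "S1 = {p. prime p \<and> p \<le> P0} \<union> \<pi> ` (F - P)"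
  have S1: "finite S1" "\<And>p. p \<in> S1 \<Longrightarrow> prime p"
    using F \<pi> by (auto simp: S1_def)
  \<comment> \<open>The class that \<open>t\<close> is to have: at small primes the class missed by
    \<open>P\<close>, and at \<open>\<pi> g\<close> the point \<open>g\<close> itself, which deletes
    \<open>g\<close>.\<close>
  define e where "e = (\<lambda>p. if p \<le> P0 then c p else the_inv_into (F - P) \<pi> p)"
  have e_small: "e p = c p" if "p \<le> P0" for p
    using that by (simp add: e_def)
  have e_\<pi>: "e (\<pi> g) = g" if "g \<in> F - P" for g
    using \<pi>(3)[OF that] the_inv_into_f_f[OF \<pi>(1) that] by (simp add: e_def)
  \<comment> \<open>Density of the congruences at the primes in \<open>S1\<close> alone. It is fixed
    before \<open>P1\<close>, because it decides how rare the bad translations have to be.\<close>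
  define d0 where "d0 = (\<Prod>p\<in>S1. 1 / real p ^ s)"
  have d0: "d0 > 0"
    unfolding d0_def using S1(2) prime_gt_0_nat by (intro prod_pos) auto
  have "d0 / (4 * (real N + 1)) > 0"
    using d0 by simp
  \<comment> \<open>The \<open>N\<close> points of \<open>P\<close> together spoil at most
    \<open>d0 / 4\<close> of the volume, whereas the good residues will have density
    \<open>d \<ge> d0 / 2\<close>.\<close>
  then obtain P1' where P1': "\<And>Q x. Q \<ge> P1' \<Longrightarrow>
      \<forall>\<^sub>F R in at_top. card (divisible_beyond k Q x \<inter> disc R) \<le> d0 / (4 * (real N + 1)) * vol R"
    using divisible_beyond_sparse[OF k] by blast
  define P1 where "P1 = max P1' P0"
  define S2 where "S2 = {p. prime p \<and> p \<le> P1} - S1"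
  have S2: "finite S2" "\<And>p. p \<in> S2 \<Longrightarrow> prime p" "\<And>p. p \<in> S2 \<Longrightarrow> p > P0"
    by (auto simp: S2_def S1_def)
  define A where "A = (\<lambda>p. if p \<in> S1 then {pmod k p (e p)}
    else res_box (int p ^ k) - pmod k p ` P)"
  define T where "T = {z. \<forall>p\<in>S1 \<union> S2. pmod k p z \<in> A p}"
  define d where "d = (\<Prod>p\<in>S1 \<union> S2. card (A p) / of_int (int p ^ k) ^ CARD('n))"
  have pos: "int p ^ k > 0" if "p \<in> S1 \<union> S2" for p
    using that S1(2) S2(2) prime_gt_0_nat by force
  have dens: "has_density T d"
    unfolding T_def d_def using S1 S2 pos
    by (intro has_density_residues coprime_prime_powers) (auto simp: A_def intro: vmod_in_res_box)
  have "d \<ge> d0 / 2"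
  proof -
    have "d = (\<Prod>p\<in>S1. card (A p) / of_int (int p ^ k) ^ CARD('n)) *
        (\<Prod>p\<in>S2. card (A p) / of_int (int p ^ k) ^ CARD('n))"
      unfolding d_def using S1(1) S2(1) by (intro prod.union_disjoint) (auto simp: S2_def)
    also have "(\<Prod>p\<in>S1. card (A p) / of_int (int p ^ k) ^ CARD('n)) = d0"
      unfolding d0_def s_def by (intro prod.cong) (auto simp: A_def power_mult[symmetric] mult.commute)
    finally have d: "d = d0 * (\<Prod>p\<in>S2. card (A p) / of_int (int p ^ k) ^ CARD('n))" .
    have le1: "(\<Sum>p\<in>S2. N / real p ^ s) \<le> 1 / 2"
    proof -
      have "(\<Sum>p\<in>S2. 1 / real p ^ s) \<le> (\<Sum>p\<in>{P0<..P1}. 1 / real p ^ s)"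
        using S2(3) by (intro sum_mono2) (auto simp: S2_def)
      also have "\<dots> \<le> 1 / (2 * (real N + 1))"
        by (rule P0') (simp add: P0_def)
      finally have "N * (\<Sum>p\<in>S2. 1 / real p ^ s) \<le> N * (1 / (2 * (real N + 1)))"
        by (intro mult_left_mono) auto
      also have "\<dots> \<le> 1 / 2"
        by (simp add: field_simps)
      finally show ?thesis
        by (simp add: sum_distrib_left)
    qed
    have "1 / 2 \<le> 1 - (\<Sum>p\<in>S2. N / real p ^ s)"
      using le1 by simp
    also have "\<dots> \<le> (\<Prod>p\<in>S2. 1 - N / real p ^ s)"
    proof (rule Weierstrass_prod_ineq)
      fix p assume "p \<in> S2"
      then have "N / real p ^ s \<le> (\<Sum>p\<in>S2. N / real p ^ s)"
        using S2(1) by (intro member_le_sum) auto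
      then show "N / real p ^ s \<in> {0..1}"
        using le1 by auto
    qed
    \<comment> \<open>At a prime of \<open>S2\<close> the forbidden classes are those of the points
      of \<open>P\<close>, at most \<open>N\<close> out of \<open>p ^ s\<close>.\<close>
    also have "\<dots> \<le> (\<Prod>p\<in>S2. card (A p) / of_int (int p ^ k) ^ CARD('n))"
    proof (rule prod_mono)
      fix p assume p: "p \<in> S2"
      have "N / real p ^ s \<le> (\<Sum>p\<in>S2. N / real p ^ s)"
        using S2(1) p by (intro member_le_sum) auto
      then have "0 \<le> 1 - N / real p ^ s"
        using le1 by simp
      moreover have "1 - N / real p ^ s \<le> card (A p) / of_int (int p ^ k) ^ CARD('n)"
      proof -
        have "p \<notin> S1"
          using p by (simp add: S2_def)
        then have "card (A p) \<ge> card (res_box (int p ^ k) :: (int^'n) set) - card (pmod k p ` P)"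
          using finP by (simp add: A_def diff_card_le_card_Diff)
        moreover have "card (pmod k p ` P) \<le> N"
          unfolding N_def by (rule card_image_le[OF finP])
        moreover have "card (res_box (int p ^ k) :: (int^'n) set) = p ^ s"
          by (simp add: card_res_box s_def nat_power_eq power_mult[symmetric] mult.commute)
        ultimately have "p ^ s \<le> card (A p) + N"
          by linarith
        then have "real p ^ s \<le> card (A p) + real N"
          by (metis of_nat_add of_nat_le_iff of_nat_power)
        moreover have "of_int (int p ^ k) ^ CARD('n) = real p ^ s"
          by (simp add: s_def power_mult[symmetric] mult.commute)
        moreover have "real p ^ s > 0"
          using S2(2)[OF p] prime_gt_0_nat by simp
        moreover have "1 - m / q \<le> a / q" if "q \<le> a + m" "q > 0" for a m q :: real
          using divide_right_mono[of "q - m" a q] that by (simp add: diff_divide_distrib)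
        ultimately show ?thesis
          by simp
      qed
      ultimately show "0 \<le> 1 - N / real p ^ s \<and> 1 - N / real p ^ s \<le> card (A p) / of_int (int p ^ k) ^ CARD('n)"
        by blast
    qed
    finally show ?thesis
      unfolding d using d0 by (simp add: field_simps)
  qed
  then have "d > d0 / 3"
    using d0 by simp
  then have ev1: "\<forall>\<^sub>F R in at_top. card (T \<inter> disc R) / vol R > d0 / 3"
    using dens unfolding has_density_def by (rule order_tendstoD(1)[rotated])
  have ev2: "\<forall>\<^sub>F R in at_top. \<forall>x\<in>P. card (divisible_beyond k P1 x \<inter> disc R) \<le> d0 / (4 * (real N + 1)) * vol R"
    using finP P1' by (intro eventually_ball_finite) (auto simp: P1_def)
  have "\<forall>\<^sub>F R :: real in at_top. \<exists>t\<in>T. \<forall>x\<in>P. t \<notin> divisible_beyond k P1 x"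
    using ev1 ev2 eventually_gt_at_top[of 0]
  proof eventually_elim
    case (elim R)
    have "real (card (\<Union>x\<in>P. divisible_beyond k P1 x \<inter> disc R)) \<le>
        (\<Sum>x\<in>P. real (card (divisible_beyond k P1 x \<inter> disc R)))"
      using card_UN_le[OF finP, of "\<lambda>x. divisible_beyond k P1 x \<inter> disc R"] by (metis of_nat_le_iff of_nat_sum)
    also have "\<dots> \<le> (\<Sum>x\<in>P. d0 / (4 * (real N + 1)) * vol R)"
      using elim by (intro sum_mono) auto
    also have "\<dots> = (N / (real N + 1)) * (d0 / 4 * vol R)"
      by (simp add: N_def)
    also have "\<dots> \<le> 1 * (d0 / 4 * vol R)"
      using d0 vol_pos[of R] elim by (intro mult_right_mono) auto
    also have "\<dots> < d0 / 3 * vol R"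
      using d0 vol_pos[of R] elim by simp
    also have "\<dots> < card (T \<inter> disc R)"
      using vol_pos[of R] elim by (simp add: field_simps)
    finally have "card (\<Union>x\<in>P. divisible_beyond k P1 x \<inter> disc R) < card (T \<inter> disc R)"
      by simp
    then have "\<not> T \<inter> disc R \<subseteq> (\<Union>x\<in>P. divisible_beyond k P1 x \<inter> disc R)"
      using finP by (metis card_mono finite_Int finite_UN finite_disc not_less)
    then show ?case
      by blast
  qed
  then obtain t where t: "t \<in> T" "\<And>x. x \<in> P \<Longrightarrow> t \<notin> divisible_beyond k P1 x"
    using eventually_happens'[of "at_top :: real filter"] by auto
  have tS1: "pmod k p t = pmod k p (e p)" if "p \<in> S1" for p
  proof -
    have "pmod k p t \<in> A p"
      using t(1) that by (simp add: T_def)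
    then show ?thesis
      using that by (simp add: A_def)
  qed
  have small: "pmod k p x \<noteq> pmod k p t" if "x \<in> P" "prime p" "p \<le> P0" for x p
    using c[OF that(2,1)] tS1[of p] e_small[of p] that by (simp add: S1_def)
  have "x - t \<in> power_free k" if x: "x \<in> P" for x
    unfolding power_free_diff_iff
  proof (intro allI impI)
    fix p :: nat assume p: "prime p"
    \<comment> \<open>Each prime is handled by one mechanism: prescribed small class, deletion of a
      point, avoidance of the classes of \<open>P\<close>, or sparsity of the bad
      translations.\<close>
    consider "p \<le> P0" | g where "g \<in> F - P" "p = \<pi> g" | "p \<in> S2" | "p > P1"
      using p by (cases "p \<le> P0"; cases "p > P1"; cases "p \<in> \<pi> ` (F - P)") (auto simp: S2_def S1_def)
    then show "pmod k p x \<noteq> pmod k p t"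
    proof cases
      case 1
      then show ?thesis
        using small x p by blast
    next
      case 2
      have "pmod k p x \<noteq> pmod k p g"
      proof
        assume eq: "pmod k p x = pmod k p g"
        have "(x - g) $ i = 0" for i
        proof (rule ccontr)
          assume nz: "(x - g) $ i \<noteq> 0"
          have "int p ^ k dvd (x - g) $ i"
            using eq by (simp add: vmod_eq_iff)
          then have "int p ^ k \<le> \<bar>(x - g) $ i\<bar>"
            using nz by (metis dvd_imp_le_int abs_of_nonneg of_nat_0_le_iff zero_le_power)
          also have "\<dots> \<le> int L"
            using L x F 2 by blast
          also have "\<dots> < int p"
            using \<pi>(3)[of g] 2 by simp
          also have "\<dots> \<le> int p ^ k"
            using k(1) prime_ge_1_nat[OF p] by (intro self_le_power) auto
          finally show False
            by simp
        qed
        then have "x = g"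
          by (simp add: vec_eq_iff)
        then show False
          using 2 x by blast
      qed
      then show ?thesis
        using tS1[of p] e_\<pi>[of g] 2 by (auto simp: S1_def)
    next
      case 3
      then have "pmod k p t \<in> A p" "p \<notin> S1"
        using t(1) by (auto simp: T_def S2_def)
      then show ?thesis
        using imageI[OF x, of "pmod k p"] by (auto simp: A_def)
    next
      case 4
      \<comment> \<open>\<open>divisible_beyond\<close> says nothing at \<open>x\<close> itself.
        That \<open>t\<close> differs from \<open>x\<close> comes from the prime 2, which is why
        \<open>P0 \<ge> 2\<close> was arranged.\<close>
      have "t \<noteq> x"
        using small[OF x two_is_prime_nat] by (auto simp: P0_def)
      then have "\<not> (\<forall>i. int p ^ k dvd (t - x) $ i)"
        using t(2)[OF x] 4 by (auto simp: divisible_beyond_def)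
      then show ?thesis
        by (metis vmod_eq_iff)
    qed
  qed
  moreover have "x - t \<notin> power_free k" if x: "x \<in> F" "x \<notin> P" for x
    unfolding power_free_diff_iff using tS1[of "\<pi> x"] e_\<pi>[of x] \<pi>(2)[of x] x
    by (auto simp: S1_def)
  ultimately show ?thesis
    by blast
qed

lemma has_density_avoid:
  assumes S: "finite S" "\<And>p. p \<in> S \<Longrightarrow> prime p" and c: "\<And>p. p \<in> S \<Longrightarrow> c p \<in> res_box (int p ^ k)"
  shows "has_density {z. \<forall>p\<in>S. pmod k p z \<in> res_box (int p ^ k) - {c p}}
    (\<Prod>p\<in>S. 1 - 1 / real p ^ (CARD('n) * k))"
proof -
  let ?s = "CARD('n) * k"
  let ?A = "\<lambda>p. res_box (int p ^ k) - {c p} :: (int^'n) set"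
  have pos: "int p ^ k > 0" if "p \<in> S" for p
    using S(2)[OF that] prime_gt_0_nat by simp
  have "has_density {z. \<forall>p\<in>S. pmod k p z \<in> ?A p} (\<Prod>p\<in>S. card (?A p) / of_int (int p ^ k) ^ CARD('n))"
    using S pos by (intro has_density_residues coprime_prime_powers) auto
  also have "(\<Prod>p\<in>S. card (?A p) / of_int (int p ^ k) ^ CARD('n)) = (\<Prod>p\<in>S. 1 - 1 / real p ^ ?s)"
  proof (rule prod.cong[OF refl])
    fix p assume p: "p \<in> S"
    have "card (?A p) = p ^ ?s - 1"
      using c[OF p] by (simp add: card_res_box nat_power_eq power_mult[symmetric] mult.commute)
    moreover have "p ^ ?s \<ge> 1"
      using prime_gt_0_nat[OF S(2)[OF p]] by (simp add: Suc_le_eq)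
    moreover have "of_int (int p ^ k) ^ CARD('n) = real p ^ ?s"
      by (simp add: power_mult[symmetric] mult.commute)
    moreover have "real p ^ ?s > 0"
      using prime_gt_0_nat[OF S(2)[OF p]] by simp
    ultimately show "card (?A p) / of_int (int p ^ k) ^ CARD('n) = 1 - 1 / real p ^ ?s"
      by (simp add: of_nat_diff diff_divide_distrib)
  qed
  finally show ?thesis .
qed

text \<open>Up to the sparse set \<open>divisible_beyond k P 0\<close>, being k-free is a condition
  at the primes up to \<open>P\<close>; its density is a finite Euler product and so at least
  \<open>1 / zeta (n * k)\<close>.\<close>

lemma power_free_density_ge:
  assumes k: "k \<ge> 1" "CARD('n) * k \<ge> 2" and \<epsilon>: "\<epsilon> > 0"
  shows "\<forall>\<^sub>F R in at_top. card (power_free k \<inter> disc R) \<ge> (1 / zeta (real (CARD('n) * k)) - \<epsilon>) * vol R"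
proof -
  define s where "s = CARD('n) * k"
  obtain P0 where P0: "\<And>P x. P \<ge> P0 \<Longrightarrow>
      \<forall>\<^sub>F R in at_top. card (divisible_beyond k P x \<inter> disc R) \<le> \<epsilon> / 2 * vol R"
    using divisible_beyond_sparse[OF k, of "\<epsilon> / 2"] \<epsilon> by auto
  define P where "P = max P0 2"
  have P: "\<And>x. \<forall>\<^sub>F R in at_top. card (divisible_beyond k P x \<inter> disc R) \<le> \<epsilon> / 2 * vol R" "P \<ge> 2"
    using P0 by (auto simp: P_def)
  let ?S = "{p. prime p \<and> p \<le> P}"
  let ?T = "{z :: int^'n. \<forall>p\<in>?S. pmod k p z \<in> res_box (int p ^ k) - {0}}"
  have dens: "has_density ?T (\<Prod>p\<in>?S. 1 - 1 / real p ^ s)"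
    unfolding s_def using prime_gt_0_nat by (intro has_density_avoid) (auto simp: res_box_def)
  have "1 / zeta (real s) - \<epsilon> / 2 < (\<Prod>p\<in>?S. 1 - 1 / real p ^ s)"
  proof -
    have "1 / zeta (real s) \<le> (\<Prod>p\<in>?S. 1 - 1 / real p ^ s)"
      by (rule euler_product_ge) (use k(2) in \<open>auto simp: s_def\<close>)
    then show ?thesis
      using \<epsilon> by linarith
  qed
  then have "\<forall>\<^sub>F R in at_top. 1 / zeta (real s) - \<epsilon> / 2 < card (?T \<inter> disc R) / vol R"
    using dens unfolding has_density_def by (rule order_tendstoD(1)[rotated])
  then show ?thesis
    using P(1)[of 0] eventually_gt_at_top[of 0]
  proof eventually_elim
    case (elim R)
    have "?T \<inter> disc R \<subseteq> (power_free k \<inter> disc R) \<union> (divisible_beyond k P 0 \<inter> disc R)"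
    proof safe
      fix z assume z: "\<forall>p\<in>?S. pmod k p z \<in> res_box (int p ^ k) - {0}" "z \<notin> divisible_beyond k P 0"
      have small: "\<not> (\<forall>i. int p ^ k dvd z $ i)" if "prime p" "p \<le> P" for p
        using z(1) that by (auto simp: vec_eq_iff dvd_eq_mod_eq_0)
      have "z \<noteq> 0"
        using small[OF two_is_prime_nat] P(2) by auto
      then have "\<not> (\<forall>i. int p ^ k dvd z $ i)" if "p > P" for p
        using z(2) that by (auto simp: divisible_beyond_def)
      then show "z \<in> power_free k"
        using small by (auto simp: power_free_def) (meson not_le)
    qed
    then have "card (?T \<inter> disc R) \<le> card ((power_free k \<inter> disc R) \<union> (divisible_beyond k P 0 \<inter> disc R))"
      by (intro card_mono) auto
    also have "\<dots> \<le> card (power_free k \<inter> disc R) + card (divisible_beyond k P 0 \<inter> disc R)"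
      by (rule card_Un_le)
    finally have "real (card (?T \<inter> disc R)) \<le> card (power_free k \<inter> disc R) + \<epsilon> / 2 * vol R"
      using elim by linarith
    moreover have "(1 / zeta (real s) - \<epsilon> / 2) * vol R < card (?T \<inter> disc R)"
      using elim vol_pos[of R] by (simp add: field_simps)
    ultimately show ?case
      by (simp add: s_def algebra_simps)
  qed
qed

end

section \<open>The topology of the power set\<close>

lemma topspace_powerset_topology [simp]: "topspace (powerset_topology L) = Pow L"
  by (auto simp: powerset_topology_def topspace_pullback_topology)

lemma openin_powerset_cylinder:
  assumes "finite F" "F \<subseteq> L"
  shows "openin (powerset_topology L) {Y. Y \<subseteq> L \<and> Y \<inter> F = X \<inter> F}"
proof -
  let ?U = "\<lambda>i. if i \<in> F then {i \<in> X} else (UNIV :: bool set)"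
  have "openin (product_topology (\<lambda>_. discrete_topology UNIV) L) (PiE L ?U)"
    by (rule product_topology_basis) (use assms in \<open>auto intro: finite_subset[of _ F]\<close>)
  moreover have "{Y. Y \<subseteq> L \<and> Y \<inter> F = X \<inter> F} = (\<lambda>X. \<lambda>x\<in>L. x \<in> X) -` PiE L ?U \<inter> Pow L"
    using assms(2) by (auto simp: PiE_iff split: if_splits)
  ultimately show ?thesis
    unfolding powerset_topology_def openin_pullback_topology by blast
qed

text \<open>Open sets in terms of finite windows, the form in which the topology is handled from
  here on.\<close>

lemma openin_powerset_topology:
  "openin (powerset_topology L) U \<longleftrightarrow> U \<subseteq> Pow L \<and>
    (\<forall>X\<in>U. \<exists>F. finite F \<and> F \<subseteq> L \<and> (\<forall>Y. Y \<subseteq> L \<longrightarrow> Y \<inter> F = X \<inter> F \<longrightarrow> Y \<in> U))"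
proof (intro iffI conjI ballI)
  assume U: "openin (powerset_topology L) U"
  then show "U \<subseteq> Pow L"
    using openin_subset by fastforce
  fix X assume X: "X \<in> U"
  obtain W where W: "openin (product_topology (\<lambda>_. discrete_topology (UNIV :: bool set)) L) W"
    "U = (\<lambda>X. \<lambda>x\<in>L. x \<in> X) -` W \<inter> Pow L"
    using U unfolding powerset_topology_def openin_pullback_topology by blast
  then have "(\<lambda>x\<in>L. x \<in> X) \<in> W"
    using X by blast
  then obtain V where V: "finite {i \<in> L. V i \<noteq> UNIV}" "(\<lambda>x\<in>L. x \<in> X) \<in> PiE L V" "PiE L V \<subseteq> W"
    using W(1) unfolding openin_product_topology_alt by auto
  have "Y \<in> U" if Y: "Y \<subseteq> L" "Y \<inter> {i \<in> L. V i \<noteq> UNIV} = X \<inter> {i \<in> L. V i \<noteq> UNIV}" for Y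
  proof -
    have "(i \<in> Y) \<in> V i" if i: "i \<in> L" for i
    proof (cases "V i = UNIV")
      case False
      then have "i \<in> Y \<longleftrightarrow> i \<in> X"
        using Y(2) i by blast
      then show ?thesis
        using V(2) i by (auto simp: PiE_iff)
    qed simp
    then have "(\<lambda>x\<in>L. x \<in> Y) \<in> PiE L V"
      by auto
    then show ?thesis
      using V(3) W(2) Y(1) by blast
  qed
  then show "\<exists>F. finite F \<and> F \<subseteq> L \<and> (\<forall>Y. Y \<subseteq> L \<longrightarrow> Y \<inter> F = X \<inter> F \<longrightarrow> Y \<in> U)"
    using V(1) by (intro exI[of _ "{i \<in> L. V i \<noteq> UNIV}"]) auto
next
  assume U: "U \<subseteq> Pow L \<and>
    (\<forall>X\<in>U. \<exists>F. finite F \<and> F \<subseteq> L \<and> (\<forall>Y. Y \<subseteq> L \<longrightarrow> Y \<inter> F = X \<inter> F \<longrightarrow> Y \<in> U))"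
  show "openin (powerset_topology L) U"
  proof (subst openin_subopen, intro ballI)
    fix X assume X: "X \<in> U"
    then obtain F where F: "finite F" "F \<subseteq> L" "\<forall>Y. Y \<subseteq> L \<longrightarrow> Y \<inter> F = X \<inter> F \<longrightarrow> Y \<in> U"
      using U by meson
    show "\<exists>T. openin (powerset_topology L) T \<and> X \<in> T \<and> T \<subseteq> U"
      using openin_powerset_cylinder[OF F(1,2), of X] F(3) U X
      by (intro exI[of _ "{Y. Y \<subseteq> L \<and> Y \<inter> F = X \<inter> F}"]) auto
  qed
qed

lemma openin_subtopology_powerset:
  assumes "S \<subseteq> Pow L"
  shows "openin (subtopology (powerset_topology L) S) U \<longleftrightarrow> U \<subseteq> S \<and>
    (\<forall>X\<in>U. \<exists>F. finite F \<and> F \<subseteq> L \<and> (\<forall>Y\<in>S. Y \<inter> F = X \<inter> F \<longrightarrow> Y \<in> U))"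
proof
  assume "openin (subtopology (powerset_topology L) S) U"
  then obtain W where "openin (powerset_topology L) W" "U = W \<inter> S"
    by (auto simp: openin_subtopology)
  then show "U \<subseteq> S \<and> (\<forall>X\<in>U. \<exists>F. finite F \<and> F \<subseteq> L \<and> (\<forall>Y\<in>S. Y \<inter> F = X \<inter> F \<longrightarrow> Y \<in> U))"
    using assms unfolding openin_powerset_topology by (metis IntD1 IntI Int_lower2 Pow_iff subsetD)
next
  assume U: "U \<subseteq> S \<and> (\<forall>X\<in>U. \<exists>F. finite F \<and> F \<subseteq> L \<and> (\<forall>Y\<in>S. Y \<inter> F = X \<inter> F \<longrightarrow> Y \<in> U))"
  show "openin (subtopology (powerset_topology L) S) U"
  proof (subst openin_subopen, intro ballI)
    fix X assume X: "X \<in> U"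
    then obtain F where F: "finite F" "F \<subseteq> L" "\<forall>Y\<in>S. Y \<inter> F = X \<inter> F \<longrightarrow> Y \<in> U"
      using U by meson
    let ?T = "{Y. Y \<subseteq> L \<and> Y \<inter> F = X \<inter> F} \<inter> S"
    have "openin (subtopology (powerset_topology L) S) ?T"
      using openin_powerset_cylinder[OF F(1,2), of X] by (auto simp: openin_subtopology)
    moreover have "X \<in> ?T" "?T \<subseteq> U"
      using U X F(3) assms by auto
    ultimately show "\<exists>T. openin (subtopology (powerset_topology L) S) T \<and> X \<in> T \<and> T \<subseteq> U"
      by blast
  qed
qed

text \<open>The product space is compact by Tychonoff's theorem, and passing from a predicate to the
  set it describes maps it continuously onto the power set.\<close>

lemma compact_space_powerset_topology: "compact_space (powerset_topology L)"
proof -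
  let ?P = "product_topology (\<lambda>_. discrete_topology (UNIV :: bool set)) L"
  let ?g = "\<lambda>h. {x \<in> L. h x}"
  have "continuous_map ?P (powerset_topology L) ?g"
    unfolding powerset_topology_def
  proof (rule continuous_map_pullback')
    show "continuous_map ?P ?P ((\<lambda>X. \<lambda>x\<in>L. x \<in> X) \<circ> ?g)"
      by (rule continuous_map_eq[OF continuous_map_id]) (auto simp: PiE_iff extensional_def fun_eq_iff)
  qed auto
  moreover have "compactin ?P (topspace ?P)"
    by (metis compact_space_def compact_space_discrete_topology compact_space_product_topology finite)
  moreover have "?g ` topspace ?P = Pow L"
  proof (intro equalityI subsetI)
    fix X assume "X \<in> Pow L"
    then show "X \<in> ?g ` topspace ?P"
      by (intro image_eqI[of _ _ "\<lambda>x\<in>L. x \<in> X"]) auto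
  qed auto
  ultimately show ?thesis
    using image_compactin unfolding compact_space_def by fastforce
qed

lemma in_closure_of_powerset_topology:
  assumes "S \<subseteq> Pow L"
  shows "X \<in> powerset_topology L closure_of S \<longleftrightarrow>
    X \<subseteq> L \<and> (\<forall>F. finite F \<longrightarrow> F \<subseteq> L \<longrightarrow> (\<exists>Y\<in>S. Y \<inter> F = X \<inter> F))"
proof
  assume X: "X \<in> powerset_topology L closure_of S"
  show "X \<subseteq> L \<and> (\<forall>F. finite F \<longrightarrow> F \<subseteq> L \<longrightarrow> (\<exists>Y\<in>S. Y \<inter> F = X \<inter> F))"
  proof (intro conjI allI impI)
    show "X \<subseteq> L"
      using X by (simp add: in_closure_of)
    fix F assume "finite F" "F \<subseteq> L"
    then have "\<exists>Y\<in>S. Y \<in> {Y. Y \<subseteq> L \<and> Y \<inter> F = X \<inter> F}"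
      using X openin_powerset_cylinder[of F L X] \<open>X \<subseteq> L\<close> unfolding in_closure_of
      by (metis (mono_tags, lifting) mem_Collect_eq)
    then show "\<exists>Y\<in>S. Y \<inter> F = X \<inter> F"
      by blast
  qed
next
  assume X: "X \<subseteq> L \<and> (\<forall>F. finite F \<longrightarrow> F \<subseteq> L \<longrightarrow> (\<exists>Y\<in>S. Y \<inter> F = X \<inter> F))"
  show "X \<in> powerset_topology L closure_of S"
    unfolding in_closure_of
  proof (intro conjI allI impI)
    fix T assume T: "X \<in> T \<and> openin (powerset_topology L) T"
    then obtain F where F: "finite F" "F \<subseteq> L" "\<forall>Y. Y \<subseteq> L \<longrightarrow> Y \<inter> F = X \<inter> F \<longrightarrow> Y \<in> T"
      unfolding openin_powerset_topology by meson
    obtain Y where "Y \<in> S" "Y \<inter> F = X \<inter> F"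
      using X F by meson
    then show "\<exists>y. y \<in> S \<and> y \<in> T"
      using F(3) assms by blast
  qed (use X in simp)
qed

lemma in_translate_iff: "x \<in> translate t X \<longleftrightarrow> x - t \<in> X"
  by (force simp: translate_def image_iff)

lemma translate_translate: "translate s (translate t X) = translate (s + t) X"
  by (auto simp: in_translate_iff algebra_simps)

lemma translate_0 [simp]: "translate 0 X = X"
  by (auto simp: in_translate_iff)

lemma translate_empty [simp]: "translate t {} = {}"
  by (auto simp: in_translate_iff)

section \<open>The hull as the set of admissible sets\<close>

context unimodular_basis
begin

abbreviation Lat :: "(real^'n) set" where
  "Lat \<equiv> range pt"

lemma Lat_closed: "x \<in> Lat \<Longrightarrow> y \<in> Lat \<Longrightarrow> x + y \<in> Lat" "x \<in> Lat \<Longrightarrow> y \<in> Lat \<Longrightarrow> x - y \<in> Lat"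
  "x \<in> Lat \<Longrightarrow> - x \<in> Lat" "0 \<in> Lat"
  by (auto simp flip: lattice_point_simps)

lemma pt_eq_iff [simp]: "pt x = pt y \<longleftrightarrow> x = y"
  using inj_lattice_point by (auto dest: injD)

lemma Lat_eq_iff: "X \<subseteq> Lat \<Longrightarrow> Y \<subseteq> Lat \<Longrightarrow> X = Y \<longleftrightarrow> (\<forall>z. pt z \<in> X \<longleftrightarrow> pt z \<in> Y)"
  by blast

lemma finite_pt_vimage: "finite F \<Longrightarrow> finite (pt -` F)"
  using inj_lattice_point by (simp add: finite_vimageI)

lemma lattice_point_smult: "lattice_point C (\<chi> i. c * w $ i) = of_int c *\<^sub>R lattice_point C w"
proof -
  have "(\<chi> i. real_of_int ((\<chi> i. c * w $ i) $ i)) = of_int c *\<^sub>R (\<chi> i. real_of_int (w $ i))"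
    by (simp add: vec_eq_iff)
  then show ?thesis
    unfolding lattice_point_def by (simp only: matrix_vector_mult_scaleR)
qed

text \<open>Two reductions. The definition refers to all bases, but that \<open>m ^ k\<close>
  divides all coordinates means that the point lies in \<open>m ^ k\<close> times the lattice, which
  involves no basis. And an integer \<open>m > 1\<close> may be replaced by a prime factor.\<close>

lemma k_free_points_eq:
  assumes "k \<ge> 1"
  shows "k_free_points Lat k = pt ` power_free k"
proof -
  have basis: "lattice_basis B Lat"
    by (simp add: lattice_basis_def inv_B)
  have dvd: "m ^ k dvd Gcd (range (\<lambda>i. z' $ i)) \<longleftrightarrow> (\<forall>i. m ^ k dvd z $ i)"
    if "lattice_basis C Lat" "pt z = lattice_point C z'" "m > 1" for C z z' and m :: int
  proof -
    have dvd_iff: "(\<forall>i. m ^ k dvd w $ i) \<longleftrightarrow> lattice_point D w \<in> (\<lambda>x. of_int (m ^ k) *\<^sub>R x) ` Lat"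
      if D: "lattice_basis D Lat" for D w
    proof
      assume "\<forall>i. m ^ k dvd w $ i"
      then have "w = (\<chi> i. m ^ k * (\<chi> i. w $ i div m ^ k) $ i)"
        by (simp add: vec_eq_iff)
      then have "lattice_point D w = of_int (m ^ k) *\<^sub>R lattice_point D (\<chi> i. w $ i div m ^ k)"
        using lattice_point_smult by metis
      then show "lattice_point D w \<in> (\<lambda>x. of_int (m ^ k) *\<^sub>R x) ` Lat"
        using D by (auto simp: lattice_basis_def)
    next
      assume "lattice_point D w \<in> (\<lambda>x. of_int (m ^ k) *\<^sub>R x) ` Lat"
      then obtain v where "lattice_point D w = of_int (m ^ k) *\<^sub>R lattice_point D v"
        using D by (auto simp: lattice_basis_def)
      then have "lattice_point D w = lattice_point D (\<chi> i. m ^ k * v $ i)"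
        by (simp only: lattice_point_smult)
      moreover obtain D' where "D' ** D = mat 1"
        using D by (auto simp: lattice_basis_def invertible_def)
      ultimately have "(\<chi> i. real_of_int (w $ i)) = (\<chi> i. real_of_int ((\<chi> i. m ^ k * v $ i) $ i))"
        unfolding lattice_point_def by (metis matrix_vector_mul_assoc matrix_vector_mul_lid)
      then have "w $ i = m ^ k * v $ i" for i
        by (simp add: vec_eq_iff del: of_int_mult of_int_power)
      then show "\<forall>i. m ^ k dvd w $ i"
        by simp
    qed
    have "m ^ k dvd Gcd (range (\<lambda>i. z' $ i)) \<longleftrightarrow> (\<forall>i. m ^ k dvd z' $ i)"
      by (auto simp: dvd_Gcd_iff)
    then show ?thesis
      using dvd_iff[OF that(1), of z'] dvd_iff[OF basis, of z] that(2) by simp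
  qed
  have pf: "z \<in> power_free k \<longleftrightarrow> \<not> (\<exists>m::int. m > 1 \<and> (\<forall>i. m ^ k dvd z $ i))" for z :: "int^'n"
  proof
    assume z: "z \<in> power_free k"
    show "\<not> (\<exists>m::int. m > 1 \<and> (\<forall>i. m ^ k dvd z $ i))"
    proof
      assume "\<exists>m::int. m > 1 \<and> (\<forall>i. m ^ k dvd z $ i)"
      then obtain m :: int where m: "m > 1" "\<forall>i. m ^ k dvd z $ i"
        by blast
      then obtain p where p: "prime p" "p dvd nat m"
        using prime_factor_nat[of "nat m"] by fastforce
      then have "int p ^ k dvd m ^ k"
        using m(1) by (intro dvd_power_same) (simp add: int_dvd_int_iff[symmetric])
      then have "\<forall>i. int p ^ k dvd z $ i"
        using m(2) dvd_trans by blast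
      then show False
        using z p(1) by (auto simp: power_free_def)
    qed
  next
    assume z: "\<not> (\<exists>m::int. m > 1 \<and> (\<forall>i. m ^ k dvd z $ i))"
    show "z \<in> power_free k"
      unfolding power_free_def
    proof (intro CollectI allI impI notI)
      fix p :: nat assume "prime p" "\<forall>i. int p ^ k dvd z $ i"
      then show False
        using z prime_gt_1_nat[of p] by (metis of_nat_1 of_nat_less_iff)
    qed
  qed
  have "pt z \<in> k_free_points Lat k \<longleftrightarrow> z \<in> power_free k" for z
  proof
    assume "pt z \<in> k_free_points Lat k"
    then show "z \<in> power_free k"
      unfolding pf k_free_points_def using basis dvd[OF basis refl, of _ z] by blast
  next
    assume "z \<in> power_free k"
    then show "pt z \<in> k_free_points Lat k"
      unfolding pf k_free_points_def using dvd by blast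
  qed
  then show ?thesis
    by (auto simp: k_free_points_def)
qed

definition Adm :: "nat \<Rightarrow> (real^'n) set set" where
  "Adm k = {X. X \<subseteq> Lat \<and> admissible k (pt -` X)}"

lemma translate_subset_Lat: "t \<in> Lat \<Longrightarrow> X \<subseteq> Lat \<Longrightarrow> translate t X \<subseteq> Lat"
  using Lat_closed(1) by (auto simp: translate_def)

lemma pt_in_translate: "pt z \<in> translate (pt t) X \<longleftrightarrow> pt (z - t) \<in> X"
  by (simp add: in_translate_iff lattice_point_simps)

lemma k_free_hull_eq:
  assumes k: "k \<ge> 1" "CARD('n) * k \<ge> 2"
  shows "k_free_hull Lat k = Adm k"
proof -
  let ?V = "k_free_points Lat k"
  have V: "?V = pt ` power_free k"
    by (rule k_free_points_eq[OF k(1)])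
  have sub: "{translate t ?V | t. t \<in> Lat} \<subseteq> Pow Lat"
    using translate_subset_Lat[of _ "pt ` power_free k"] by (auto simp: V)
  have cl: "X \<in> k_free_hull Lat k \<longleftrightarrow> X \<subseteq> Lat \<and>
      (\<forall>F. finite F \<longrightarrow> F \<subseteq> Lat \<longrightarrow> (\<exists>t. translate (pt t) ?V \<inter> F = X \<inter> F))" for X
  proof -
    have "{translate t ?V | t. t \<in> Lat} = range (\<lambda>t. translate (pt t) ?V)"
      by auto
    then show ?thesis
      unfolding k_free_hull_def in_closure_of_powerset_topology[OF sub] by (simp only: bex_simps)
  qed
  show ?thesis
  proof (intro equalityI subsetI)
    fix X assume X: "X \<in> k_free_hull Lat k"
    have "\<exists>c. \<forall>z\<in>pt -` X. pmod k p z \<noteq> pmod k p c" if p: "prime p" for p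
    proof (rule ccontr)
      assume "\<nexists>c. \<forall>z\<in>pt -` X. pmod k p z \<noteq> pmod k p c"
      \<comment> \<open>If \<open>X\<close> met every class modulo \<open>p ^ k\<close>, the
        finitely many points \<open>r c\<close> with \<open>c\<close> in the residue box would
        witness it. A translate of the k-free points that agrees with \<open>X\<close> on them would
        then meet the class of its own translation vector.\<close>
      then obtain r where r: "\<And>c. pt (r c) \<in> X" "\<And>c. pmod k p (r c) = pmod k p c"
        by (metis vimageE)
      have q: "int p ^ k > 0"
        using p prime_gt_0_nat by simp
      let ?F = "pt ` r ` res_box (int p ^ k)"
      obtain t where t: "translate (pt t) ?V \<inter> ?F = X \<inter> ?F"
        using X unfolding cl by (metis finite_imageI finite_res_box image_mono subset_UNIV)
      let ?c = "r (pmod k p t)"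
      have "pt ?c \<in> X \<inter> ?F"
        using r(1) vmod_in_res_box[OF q] by blast
      then have "pt ?c \<in> translate (pt t) ?V"
        using t by blast
      then have "?c - t \<in> power_free k"
        by (auto simp: pt_in_translate V)
      then show False
        using p r(2)[of "pmod k p t"] by (simp add: power_free_diff_iff vmod_vmod)
    qed
    then show "X \<in> Adm k"
      using X unfolding cl by (simp add: Adm_def admissible_def)
  next
    fix X assume X: "X \<in> Adm k"
    show "X \<in> k_free_hull Lat k"
      unfolding cl
    proof (intro conjI allI impI)
      show "X \<subseteq> Lat"
        using X by (simp add: Adm_def)
      fix F assume F: "finite F" "F \<subseteq> Lat"
      have "admissible k (pt -` F \<inter> pt -` X)"
        using X by (auto simp: Adm_def intro: admissible_subset)
      then obtain t where t: "\<forall>x\<in>pt -` F. x - t \<in> power_free k \<longleftrightarrow> x \<in> pt -` F \<inter> pt -` X"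
        using admissible_realized[OF k finite_pt_vimage[OF F(1)], of "pt -` F \<inter> pt -` X"] by blast
      have "translate (pt t) ?V \<inter> F = X \<inter> F"
      proof (subst Lat_eq_iff)
        show "\<forall>z. pt z \<in> translate (pt t) ?V \<inter> F \<longleftrightarrow> pt z \<in> X \<inter> F"
          using t by (auto simp: pt_in_translate V)
      qed (use F in auto)
      then show "\<exists>t. translate (pt t) ?V \<inter> F = X \<inter> F" ..
    qed
  qed
qed

lemma hull_subset_Lat: "X \<in> Adm k \<Longrightarrow> X \<subseteq> Lat"
  by (simp add: Adm_def)

text \<open>Heredity makes arbitrary subsets of the k-free points available as patterns; this is the
  source of positive entropy.\<close>

lemma hull_mono: "X \<in> Adm k \<Longrightarrow> Y \<subseteq> X \<Longrightarrow> Y \<in> Adm k"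
  unfolding Adm_def using admissible_subset[of k "pt -` X" "pt -` Y"] by auto

lemma missing_residues:
  assumes "X \<in> Adm k"
  shows "\<exists>c. \<forall>p z. prime p \<longrightarrow> pt z \<in> X \<longrightarrow> pmod k p z \<noteq> pmod k p (c p)"
proof -
  have "\<forall>p. \<exists>c. prime p \<longrightarrow> (\<forall>z\<in>pt -` X. pmod k p z \<noteq> pmod k p c)"
    using assms by (auto simp: Adm_def admissible_def)
  then show ?thesis
    unfolding choice_iff by auto
qed

lemma empty_in_hull: "{} \<in> Adm k"
  by (simp add: Adm_def admissible_def)

lemma translate_in_hull:
  assumes "X \<in> Adm k" "t \<in> Lat"
  shows "translate t X \<in> Adm k"
proof -
  obtain \<tau> where \<tau>: "t = pt \<tau>"
    using assms(2) by blast
  have "admissible k (pt -` translate t X)"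
    unfolding admissible_def
  proof (intro allI impI)
    fix p :: nat assume "prime p"
    then obtain c where c: "\<forall>z\<in>pt -` X. pmod k p z \<noteq> pmod k p c"
      using assms(1) by (auto simp: Adm_def admissible_def)
    have "pmod k p z \<noteq> pmod k p (c + \<tau>)" if "pt (z - \<tau>) \<in> X" for z
      using bspec[OF c, of "z - \<tau>"] that by (simp add: vmod_eq_iff algebra_simps)
    then show "\<exists>c. \<forall>z\<in>pt -` translate t X. pmod k p z \<noteq> pmod k p c"
      by (intro exI[of _ "c + \<tau>"]) (auto simp: \<tau> pt_in_translate)
  qed
  then show ?thesis
    using assms translate_subset_Lat by (auto simp: Adm_def)
qed

lemma translate_hull: "t \<in> Lat \<Longrightarrow> translate t ` Adm k = Adm k"
proof (intro equalityI subsetI)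
  fix X assume t: "t \<in> Lat" and X: "X \<in> Adm k"
  then have "translate (- t) X \<in> Adm k"
    using translate_in_hull Lat_closed(3) by blast
  then show "X \<in> translate t ` Adm k"
    by (intro image_eqI[of _ _ "translate (- t) X"]) (simp_all add: translate_translate)
qed (use translate_in_hull in auto)

lemma power_free_in_hull: "pt ` power_free k \<in> Adm k"
proof -
  have "pt -` pt ` power_free k = power_free k"
    by auto
  moreover have "admissible k (power_free k)"
    unfolding admissible_def vmod_eq_iff by (auto simp: power_free_def intro!: exI[of _ 0])
  ultimately show ?thesis
    by (auto simp: Adm_def)
qed

text \<open>Each of the finitely many points of the window is emptied by a prime of its own.\<close>

lemma ex_translate_avoiding:
  assumes "X \<in> Adm k" "Y \<in> Adm k" "finite F"
  shows "\<exists>t\<in>Lat. translate t X \<inter> F = {} \<and> translate t Y \<inter> F = {}"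
proof -
  obtain c where c: "\<And>p z. prime p \<Longrightarrow> pt z \<in> X \<Longrightarrow> pmod k p z \<noteq> pmod k p (c p)"
    using missing_residues[OF assms(1)] by blast
  obtain d where d: "\<And>p z. prime p \<Longrightarrow> pt z \<in> Y \<Longrightarrow> pmod k p z \<noteq> pmod k p (d p)"
    using missing_residues[OF assms(2)] by blast
  \<comment> \<open>The truth value tells \<open>X\<close> from \<open>Y\<close>: each window point
    uses one prime for each of the two sets.\<close>
  let ?G = "pt -` F \<times> (UNIV :: bool set)"
  have G: "finite ?G"
    using assms(3) finite_pt_vimage by simp
  obtain \<pi> where \<pi>: "inj_on \<pi> ?G" "\<And>g. g \<in> ?G \<Longrightarrow> prime (\<pi> g :: nat)"
    using ex_inj_primes[OF G] by meson
  \<comment> \<open>If \<open>\<tau>\<close> is congruent to \<open>f - c p\<close>, then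
    \<open>f - \<tau>\<close> falls into the class missed by \<open>X\<close>, so \<open>f\<close>
    is not in the translate; likewise for \<open>Y\<close> with \<open>d p\<close>.\<close>
  define e where "e = (\<lambda>p. case the_inv_into ?G \<pi> p of (f, b) \<Rightarrow> f - (if b then c p else d p))"
  obtain \<tau> where "\<forall>p\<in>\<pi> ` ?G. pmod k p \<tau> = pmod k p (e p)"
    using chinese_remainder[of "\<pi> ` ?G" k e] G \<pi>(2) by blast
  then have \<tau>: "vmod (int (\<pi> (f, b)) ^ k) (f - \<tau>) = vmod (int (\<pi> (f, b)) ^ k) (if b then c (\<pi> (f, b)) else d (\<pi> (f, b)))"
    if "pt f \<in> F" for f b
  proof -
    assume *: "\<forall>p\<in>\<pi> ` ?G. pmod k p \<tau> = pmod k p (e p)"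
    let ?p = "\<pi> (f, b)" and ?r = "if b then c (\<pi> (f, b)) else d (\<pi> (f, b))"
    have "(f, b) \<in> ?G"
      using that by simp
    then have "vmod (int ?p ^ k) \<tau> = vmod (int ?p ^ k) (f - ?r)"
      using * the_inv_into_f_f[OF \<pi>(1), of "(f, b)"] by (simp add: e_def image_iff)
    then have "int ?p ^ k dvd - ((\<tau> - (f - ?r)) $ i)" for i
      by (simp add: vmod_eq_iff del: minus_diff_eq)
    then show ?thesis
      unfolding vmod_eq_iff by (simp add: algebra_simps)
  qed
  have "translate (pt \<tau>) X \<subseteq> Lat" "translate (pt \<tau>) Y \<subseteq> Lat"
    using assms translate_subset_Lat by (auto simp: Adm_def)
  moreover have "pt z \<notin> translate (pt \<tau>) X \<inter> F" for z
    using \<tau>[of z True] c[of "\<pi> (z, True)" "z - \<tau>"] \<pi>(2)[of "(z, True)"] by (auto simp: pt_in_translate)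
  moreover have "pt z \<notin> translate (pt \<tau>) Y \<inter> F" for z
    using \<tau>[of z False] d[of "\<pi> (z, False)" "z - \<tau>"] \<pi>(2)[of "(z, False)"] by (auto simp: pt_in_translate)
  ultimately have "translate (pt \<tau>) X \<inter> F = {} \<and> translate (pt \<tau>) Y \<inter> F = {}"
    by blast
  then show ?thesis
    by blast
qed

end

section \<open>The hull as a compact space of admissible sets\<close>

locale k_free_system = unimodular_basis B for B :: "real^'n^'n" +
  fixes k :: nat
  assumes k1: "k \<ge> 1" and k2: "CARD('n) * k \<ge> 2"
begin

abbreviation "hull_space \<equiv> hull_topology Lat k"

lemma hull_closure: "k_free_hull Lat k = Adm k"
  by (rule k_free_hull_eq[OF k1 k2])

lemma hull_topology_eq: "hull_space = subtopology (powerset_topology Lat) (Adm k)"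
  by (simp add: hull_topology_def hull_closure)

lemma topspace_hull [simp]: "topspace hull_space = Adm k"
  using hull_subset_Lat by (auto simp: hull_topology_eq)

lemma openin_hull:
  "openin hull_space U \<longleftrightarrow> U \<subseteq> Adm k \<and>
    (\<forall>X\<in>U. \<exists>F. finite F \<and> F \<subseteq> Lat \<and> (\<forall>Y\<in>Adm k. Y \<inter> F = X \<inter> F \<longrightarrow> Y \<in> U))"
  unfolding hull_topology_eq by (rule openin_subtopology_powerset) (use hull_subset_Lat in auto)

lemma openin_hull_cylinder:
  assumes "finite F" "F \<subseteq> Lat"
  shows "openin hull_space {Y \<in> Adm k. Y \<inter> F = P}"
  unfolding openin_hull using assms by auto

lemma compact_space_hull: "compact_space hull_space"
proof -
  have "closedin (powerset_topology Lat) (Adm k)"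
    unfolding hull_closure[symmetric] k_free_hull_def by (rule closedin_closure_of)
  then have "compactin (powerset_topology Lat) (Adm k)"
    by (rule closedin_compact_space[OF compact_space_powerset_topology])
  then show ?thesis
    unfolding hull_topology_eq by (rule compact_space_subtopology)
qed

end

section \<open>Ergodicity, proximality and spectrum\<close>

lemma subset_dist_nonneg: "subset_dist X Y \<ge> 0"
  unfolding subset_dist_def by (rule cInf_greatest) auto

lemma subset_dist_le: "\<epsilon> > 0 \<Longrightarrow> X \<inter> ball 0 (1 / \<epsilon>) = Y \<inter> ball 0 (1 / \<epsilon>) \<Longrightarrow> subset_dist X Y \<le> \<epsilon>"
  unfolding subset_dist_def by (rule cInf_lower) (auto intro!: bdd_belowI[of _ 0])

context k_free_system
begin

lemma Lat_Int_ball: "Lat \<inter> ball 0 R = pt ` disc R"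
  by (auto simp: disc_def)

lemma vol_at_top: "filterlim vol at_top at_top"
proof (rule filterlim_at_top_mono)
  let ?v = "measure lborel (ball (0 :: real^'n) 1)"
  show "filterlim (\<lambda>R. ?v * R) at_top at_top"
    by (rule filterlim_tendsto_pos_mult_at_top[OF tendsto_const _ filterlim_ident]) simp
  show "\<forall>\<^sub>F R in at_top. ?v * R \<le> vol R"
    using eventually_ge_at_top[of 1]
    by eventually_elim (auto simp: vol_def ball_volume_def intro!: mult_left_mono self_le_power)
qed

text \<open>2 is the smallest prime, so \<open>2 ^ (n * k)\<close> is the least number of residue
  classes that occurs.\<close>

lemma admissible_card:
  fixes Z :: "(int^'n) set"
  assumes "finite Z" "card Z < 2 ^ (CARD('n) * k)"
  shows "admissible k Z"
  unfolding admissible_def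
proof (intro allI impI)
  fix p :: nat assume p: "prime p"
  have "card Z < 2 ^ (CARD('n) * k)"
    by (rule assms(2))
  also have "\<dots> \<le> p ^ (CARD('n) * k)"
    using prime_ge_2_nat[OF p] by (rule power_mono) simp
  also have "\<dots> = nat (int p ^ k) ^ CARD('n)"
    by (simp add: nat_power_eq power_mult[symmetric] mult.commute)
  finally show "\<exists>c. \<forall>z\<in>Z. pmod k p z \<noteq> pmod k p c"
    using prime_gt_0_nat[OF p] by (intro ex_residue_avoiding[OF assms(1)]) auto
qed

lemma admissible_image: "admissible k Z \<Longrightarrow> pt ` Z \<in> Adm k"
proof -
  have "pt -` pt ` Z = Z"
    by auto
  then show "admissible k Z \<Longrightarrow> pt ` Z \<in> Adm k"
    by (auto simp: Adm_def)
qed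

text \<open>The vectors \<open>t\<close> for which \<open>U\<close> meets the translate of
  \<open>W\<close> contain a set of positive density up to finitely many exceptions, so even the
  lower limit is positive.\<close>

lemma ergodic_hull: "topologically_ergodic Lat hull_space translate"
  unfolding topologically_ergodic_def
proof (intro allI impI)
  fix U W assume U: "openin hull_space U" "U \<noteq> {}" and W: "openin hull_space W" "W \<noteq> {}"
  obtain X F1 where X: "X \<in> U" "X \<in> Adm k" and F1: "finite F1" "F1 \<subseteq> Lat"
    "\<And>Z. Z \<in> Adm k \<Longrightarrow> Z \<inter> F1 = X \<inter> F1 \<Longrightarrow> Z \<in> U"
    using U unfolding openin_hull by (metis all_not_in_conv subsetD)
  obtain Y F2 where Y: "Y \<in> W" "Y \<in> Adm k" and F2: "finite F2" "F2 \<subseteq> Lat"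
    "\<And>Z. Z \<in> Adm k \<Longrightarrow> Z \<inter> F2 = Y \<inter> F2 \<Longrightarrow> Z \<in> W"
    using W unfolding openin_hull by (metis all_not_in_conv subsetD)
  obtain c where c: "\<And>p z. prime p \<Longrightarrow> pt z \<in> X \<Longrightarrow> pmod k p z \<noteq> pmod k p (c p)"
    using missing_residues[OF X(2)] by blast
  obtain d where d: "\<And>p z. prime p \<Longrightarrow> pt z \<in> Y \<Longrightarrow> pmod k p z \<noteq> pmod k p (d p)"
    using missing_residues[OF Y(2)] by blast
  define F where "F = pt -` (F1 \<union> F2)"
  have F: "finite F"
    unfolding F_def using F1 F2 by (intro finite_pt_vimage) auto
  define P1 where "P1 = pt -` (X \<inter> F1)"
  define P2 where "P2 = pt -` (Y \<inter> F2)"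
  have P: "P1 \<subseteq> F" "P2 \<subseteq> F"
    by (auto simp: P1_def P2_def F_def)
  \<comment> \<open>At larger primes the at most \<open>2 * card F\<close> points of the combined
    pattern cannot meet all classes, so only the primes in \<open>S\<close> constrain
    \<open>t\<close>.\<close>
  define S where "S = {p. prime p \<and> p \<le> 2 * card F}"
  \<comment> \<open>Such \<open>t\<close> move the class missed by \<open>Y\<close> onto the class
    missed by \<open>X\<close>.\<close>
  define D where "D = {t :: int^'n. \<forall>p\<in>S. pmod k p t = pmod k p (c p - d p)}"
  \<comment> \<open>Excluding differences of window points keeps the window and its translate
    disjoint, so that the two patterns do not interfere.\<close>
  define E where "E = (\<lambda>(x, y). x - y) ` (F \<times> F)"
  have E: "finite E"
    using F by (simp add: E_def)
  have good: "U \<inter> translate (pt t) ` W \<noteq> {}" if t: "t \<in> D" "t \<notin> E" for t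
  proof -
    let ?Z = "P1 \<union> (\<lambda>z. z + t) ` P2"
    have finZ: "finite ?Z"
      using P F by (auto intro: finite_subset)
    have tE: "z - t \<notin> F" if "z \<in> F" for z
    proof
      assume "z - t \<in> F"
      then have "z - (z - t) \<in> E"
        using that by (force simp: E_def)
      then show False
        using t by simp
    qed
    have "admissible k ?Z"
      unfolding admissible_def
    proof (intro allI impI)
      fix p :: nat assume p: "prime p"
      show "\<exists>c. \<forall>z\<in>?Z. pmod k p z \<noteq> pmod k p c"
      proof (cases "p \<in> S")
        case True
        have "pmod k p (z + t) \<noteq> pmod k p (c p)" if z: "z \<in> P2" for z
        proof
          assume "pmod k p (z + t) = pmod k p (c p)"
          then have "int p ^ k dvd (z + t - c p) $ i" for i
            by (simp add: vmod_eq_iff)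
          moreover have "int p ^ k dvd (t - (c p - d p)) $ i" for i
            using t(1) True by (auto simp: D_def vmod_eq_iff)
          ultimately have "int p ^ k dvd (z + t - c p) $ i - (t - (c p - d p)) $ i" for i
            by (rule dvd_diff)
          then have "pmod k p z = pmod k p (d p)"
            by (simp add: vmod_eq_iff algebra_simps)
          then show False
            using d[OF p, of z] z by (auto simp: P2_def)
        qed
        then show ?thesis
          using c[OF p] by (intro exI[of _ "c p"]) (auto simp: P1_def)
      next
        case False
        have "card ?Z \<le> card P1 + card P2"
          using card_Un_le[of P1 "(\<lambda>z. z + t) ` P2"] card_image_le[of P2 "\<lambda>z. z + t"] P F
          by (meson add_left_mono finite_subset order_trans)
        also have "\<dots> \<le> card F + card F"
          using P F by (intro add_mono card_mono) auto
        also have "\<dots> < p"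
          using False p by (simp add: S_def)
        also have "p \<le> p ^ (CARD('n) * k)"
          using k2 prime_ge_1_nat[OF p] by (intro self_le_power) linarith+
        also have "\<dots> = nat (int p ^ k) ^ CARD('n)"
          by (simp add: nat_power_eq power_mult[symmetric] mult.commute)
        finally show ?thesis
          using prime_gt_0_nat[OF p] by (intro ex_residue_avoiding[OF finZ]) auto
      qed
    qed
    then have Z: "pt ` ?Z \<in> Adm k"
      by (rule admissible_image)
    have inZ: "pt z \<in> pt ` ?Z \<longleftrightarrow> z \<in> P1 \<or> z - t \<in> P2" for z
      by (force simp: image_iff)
    have "pt ` ?Z \<inter> F1 = X \<inter> F1"
    proof (subst Lat_eq_iff)
      show "\<forall>z. pt z \<in> pt ` ?Z \<inter> F1 \<longleftrightarrow> pt z \<in> X \<inter> F1"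
        using tE P unfolding Int_iff inZ by (auto simp: P1_def F_def)
    qed (use F1 in auto)
    then have "pt ` ?Z \<in> U"
      by (rule F1(3)[OF Z])
    moreover have "translate (- pt t) (pt ` ?Z) \<inter> F2 = Y \<inter> F2"
    proof (subst Lat_eq_iff)
      have "pt z \<in> translate (- pt t) (pt ` ?Z) \<longleftrightarrow> z + t \<in> P1 \<or> z \<in> P2" for z
        using inZ[of "z + t"] by (simp add: in_translate_iff flip: lattice_point_simps)
      moreover have "z + t \<notin> P1" if "pt z \<in> F2" for z
        using tE[of "z + t"] P(1) that by (auto simp: F_def)
      ultimately show "\<forall>z. pt z \<in> translate (- pt t) (pt ` ?Z) \<inter> F2 \<longleftrightarrow> pt z \<in> Y \<inter> F2"
        by (auto simp: P2_def)
    qed (use F2 in auto)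
    then have "translate (- pt t) (pt ` ?Z) \<in> W"
      using F2(3) Z translate_in_hull Lat_closed(3) by blast
    then have "pt ` ?Z \<in> translate (pt t) ` W"
      by (intro image_eqI[of _ _ "translate (- pt t) (pt ` ?Z)"]) (simp_all add: translate_translate)
    ultimately show ?thesis
      by blast
  qed
  let ?h = "\<lambda>R. \<Sum>t\<in>Lat \<inter> ball 0 R. of_bool (U \<inter> translate t ` W \<noteq> {}) :: real"
  define \<delta> where "\<delta> = (\<Prod>p\<in>S. 1 / real p ^ (CARD('n) * k))"
  have \<delta>: "\<delta> > 0"
    unfolding \<delta>_def using prime_gt_0_nat by (intro prod_pos) (auto simp: S_def)
  have "has_density D \<delta>"
    unfolding D_def \<delta>_def by (rule has_density_crt) (auto simp: S_def)
  then have ev: "\<forall>\<^sub>F R in at_top. card (D \<inter> disc R) / vol R > \<delta> / 2"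
    unfolding has_density_def by (rule order_tendstoD) (use \<delta> in simp)
  \<comment> \<open>For such \<open>R\<close> the removal of \<open>E\<close> costs less than
    \<open>\<delta> / 4\<close> of the volume, which leaves at least \<open>\<delta> / 4\<close> of
    the \<open>\<delta> / 2\<close> available.\<close>
  have "\<forall>\<^sub>F R in at_top. vol R > card E / (\<delta> / 4)"
    using vol_at_top by (simp add: filterlim_at_top_dense)
  then have "\<forall>\<^sub>F R in at_top. ereal (\<delta> / 4) \<le>
      ereal (?h R / ball_volume TYPE('n) R)"
    using ev eventually_gt_at_top[of 0]
  proof eventually_elim
    case (elim R)
    have v: "vol R > 0"
      using vol_pos elim by simp
    have "?h R =
        (\<Sum>t\<in>disc R. of_bool (U \<inter> translate (pt t) ` W \<noteq> {}) :: real)"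
      unfolding Lat_Int_ball by (subst sum.reindex) (auto simp: inj_on_def)
    also have "\<dots> \<ge> (\<Sum>t\<in>(D - E) \<inter> disc R. of_bool (U \<inter> translate (pt t) ` W \<noteq> {}))"
      by (rule sum_mono2) auto
    also have "(\<Sum>t\<in>(D - E) \<inter> disc R. of_bool (U \<inter> translate (pt t) ` W \<noteq> {})) = real (card ((D - E) \<inter> disc R))"
      using good by simp
    finally have "real (card ((D - E) \<inter> disc R)) \<le> ?h R" .
    moreover have "card (D \<inter> disc R) \<le> card ((D - E) \<inter> disc R) + card E"
    proof -
      have "D \<inter> disc R \<subseteq> (D - E) \<inter> disc R \<union> E"
        by blast
      then have "card (D \<inter> disc R) \<le> card ((D - E) \<inter> disc R \<union> E)"
        using E by (intro card_mono) auto
      then show ?thesis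
        using card_Un_le order_trans by blast
    qed
    moreover have "real (card E) < \<delta> / 4 * vol R"
      using elim(1) \<delta> by (simp add: field_simps)
    moreover have "\<delta> / 2 * vol R < card (D \<inter> disc R)"
      using elim(2) v by (simp add: field_simps)
    ultimately have "\<delta> / 4 * vol R \<le> ?h R"
      by linarith
    then show ?case
      using v by (simp add: vol_def[symmetric] field_simps)
  qed
  then have "ereal (\<delta> / 4) \<le> Liminf at_top (\<lambda>R. ereal (?h R / ball_volume TYPE('n) R))"
    by (rule Liminf_bounded)
  then have "ereal (\<delta> / 4) \<le> Limsup at_top (\<lambda>R. ereal (?h R / ball_volume TYPE('n) R))"
    by (rule order_trans[OF _ Liminf_le_Limsup]) simp
  then show "Limsup at_top (\<lambda>R. ereal (?h R / ball_volume TYPE('n) R)) > 0"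
    by (rule less_le_trans[rotated]) (use \<delta> in simp)
qed

section \<open>Proximality, minimal sets, Kronecker factors and eigenfunctions\<close>

lemma proximal_hull: "proximal Lat (Adm k) subset_dist translate"
  unfolding proximal_def
proof (intro ballI)
  fix X Y assume XY: "X \<in> Adm k" "Y \<in> Adm k"
  let ?d = "\<lambda>t. subset_dist (translate t X) (translate t Y)"
  have bdd: "bdd_below (?d ` Lat)"
    by (rule bdd_belowI[of _ 0]) (auto simp: subset_dist_nonneg)
  have "(INF t\<in>Lat. ?d t) \<le> 0 + \<epsilon>" if \<epsilon>: "\<epsilon> > 0" for \<epsilon>
  proof -
    obtain t where t: "t \<in> Lat" "translate t X \<inter> pt ` disc (1 / \<epsilon>) = {}" "translate t Y \<inter> pt ` disc (1 / \<epsilon>) = {}"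
      using ex_translate_avoiding[OF XY, of "pt ` disc (1 / \<epsilon>)"] by auto
    have "translate t X \<subseteq> Lat" "translate t Y \<subseteq> Lat"
      using t(1) XY hull_subset_Lat translate_subset_Lat by blast+
    then have "translate t X \<inter> ball 0 (1 / \<epsilon>) = translate t Y \<inter> ball 0 (1 / \<epsilon>)"
      using t(2,3) unfolding Lat_Int_ball[symmetric] by blast
    then have "?d t \<le> \<epsilon>"
      by (rule subset_dist_le[OF \<epsilon>])
    then show ?thesis
      using cINF_lower2[OF bdd t(1)] by simp
  qed
  then have "(INF t\<in>Lat. ?d t) \<le> 0"
    by (rule field_le_epsilon)
  moreover have "(INF t\<in>Lat. ?d t) \<ge> 0"
    by (rule cINF_greatest) (auto simp: subset_dist_nonneg)
  ultimately show "(INF t\<in>Lat. ?d t) = 0"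
    by linarith
qed

lemma closed_invariant_empty: "closed_invariant Lat hull_space translate {{}}"
proof -
  have "openin hull_space (Adm k - {{}})"
    unfolding openin_hull
  proof (intro conjI ballI)
    fix X assume X: "X \<in> Adm k - {{}}"
    then obtain x where x: "x \<in> X"
      by blast
    then show "\<exists>F. finite F \<and> F \<subseteq> Lat \<and> (\<forall>Y\<in>Adm k. Y \<inter> F = X \<inter> F \<longrightarrow> Y \<in> Adm k - {{}})"
      using X hull_subset_Lat[of X k] by (intro exI[of _ "{x}"]) auto
  qed auto
  then show ?thesis
    by (simp add: closed_invariant_def closedin_def empty_in_hull)
qed

text \<open>If the complement of \<open>M\<close> contained the empty set, it would contain all
  admissible sets that are empty on some finite window; but a translation brings any point of
  \<open>M\<close> there.\<close>

lemma empty_in_closed_invariant: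
  assumes "closed_invariant Lat hull_space translate M" "M \<noteq> {}"
  shows "{} \<in> M"
proof (rule ccontr)
  assume "{} \<notin> M"
  have M: "M \<subseteq> Adm k" "openin hull_space (Adm k - M)"
    using assms(1) by (auto simp: closed_invariant_def closedin_def)
  have "{} \<in> Adm k - M"
    using empty_in_hull \<open>{} \<notin> M\<close> by blast
  then obtain F where F: "finite F" "\<And>Y. Y \<in> Adm k \<Longrightarrow> Y \<inter> F = {} \<Longrightarrow> Y \<notin> M"
    using M(2) unfolding openin_hull by (metis DiffD2 Int_empty_left)
  obtain X where X: "X \<in> M" "X \<in> Adm k"
    using assms(2) M(1) by blast
  then obtain t where "t \<in> Lat" "translate t X \<inter> F = {}"
    using ex_translate_avoiding[OF X(2) X(2) F(1)] by blast
  then show False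
    using F(2)[of "translate t X"] X assms(1) translate_in_hull unfolding closed_invariant_def by blast
qed

lemma minimal_subset_hull: "minimal_subset Lat hull_space translate M \<longleftrightarrow> M = {{}}"
proof
  assume M: "minimal_subset Lat hull_space translate M"
  then have "{} \<in> M"
    using empty_in_closed_invariant by (auto simp: minimal_subset_def)
  then show "M = {{}}"
    using M closed_invariant_empty by (auto simp: minimal_subset_def)
qed (use closed_invariant_empty in \<open>auto simp: minimal_subset_def\<close>)

text \<open>The empty set is a fixed point, hence so is its image. The singleton of that image is
  closed and invariant, and minimality leaves nothing else.\<close>

lemma kronecker_factor_trivial:
  assumes "kronecker_factor Lat hull_space translate Y actY"
  shows "\<exists>y. topspace Y = {y}"
proof -
  obtain \<phi> where \<phi>: "continuous_map hull_space Y \<phi>" "\<phi> ` Adm k = topspace Y"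
    "\<And>t X. t \<in> Lat \<Longrightarrow> X \<in> Adm k \<Longrightarrow> \<phi> (translate t X) = actY t (\<phi> X)"
    and Y: "Hausdorff_space Y" "minimal_system Lat Y actY"
    using assms unfolding kronecker_factor_def topological_factor_def dynamical_system_def topspace_hull
    by meson
  let ?y = "\<phi> {}"
  have y: "?y \<in> topspace Y"
    using \<phi>(2) empty_in_hull by blast
  have "closed_invariant Lat Y actY {?y}"
    using closedin_Hausdorff_sing_eq[OF Y(1)] y \<phi>(3)[OF _ empty_in_hull]
    by (auto simp: closed_invariant_def)
  then have "topspace Y = {?y}"
    using Y(2) y unfolding minimal_system_def minimal_subset_def by blast
  then show ?thesis ..
qed

text \<open>On every orbit \<open>f\<close> comes arbitrarily close to its value at the fixed point
  \<open>{}\<close>. If that value is nonzero, the fixed point forces all eigenvalues to be 1; then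
  \<open>f\<close> is constant on each orbit and equal to that value. The eigenvalues are not
  assumed to have modulus 1, so a zero value has to be excluded separately.\<close>

lemma trivial_point_spectrum_hull: "trivial_point_spectrum Lat hull_space translate"
  unfolding trivial_point_spectrum_def
proof (intro allI impI)
  fix f :: "(real^'n) set \<Rightarrow> complex" and ev
  assume "continuous_eigenfunction Lat hull_space translate f ev"
  then have cont: "continuous_map hull_space euclidean f" and nz: "\<exists>X\<in>Adm k. f X \<noteq> 0"
    and ev: "\<And>t X. t \<in> Lat \<Longrightarrow> X \<in> Adm k \<Longrightarrow> f (translate (- t) X) = ev t * f X"
    by (auto simp: continuous_eigenfunction_def)
  have near: "\<exists>t\<in>Lat. norm (f (translate (- t) X) - f {}) < \<epsilon>" if X: "X \<in> Adm k" and \<epsilon>: "\<epsilon> > 0" for X \<epsilon>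
  proof -
    have "openin hull_space {Y \<in> Adm k. f Y \<in> ball (f {}) \<epsilon>}"
      using openin_continuous_map_preimage[OF cont, of "ball (f {}) \<epsilon>"] by simp
    moreover have "{} \<in> {Y \<in> Adm k. f Y \<in> ball (f {}) \<epsilon>}"
      using empty_in_hull \<epsilon> by simp
    ultimately obtain F where F: "finite F"
      "\<And>Y. Y \<in> Adm k \<Longrightarrow> Y \<inter> F = {} \<Longrightarrow> f Y \<in> ball (f {}) \<epsilon>"
      unfolding openin_hull by (metis (no_types, lifting) Int_empty_left mem_Collect_eq)
    obtain t where t: "t \<in> Lat" "translate t X \<inter> F = {}"
      using ex_translate_avoiding[OF X X F(1)] by blast
    then have "f (translate t X) \<in> ball (f {}) \<epsilon>"
      using F(2) X translate_in_hull by blast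
    then show ?thesis
      using t(1) Lat_closed(3) by (intro bexI[of _ "- t"]) (auto simp: dist_norm norm_minus_commute)
  qed
  have "f {} \<noteq> 0"
  proof
    assume f0: "f {} = 0"
    obtain X where X: "X \<in> Adm k" "f X \<noteq> 0"
      using nz by blast
    have "compactin euclidean (f ` Adm k)"
      using image_compactin[OF _ cont] compact_space_hull by (simp add: compact_space_def)
    then have "bounded (f ` Adm k)"
      by (simp add: compact_imp_bounded)
    then obtain M where M: "\<And>Y. Y \<in> Adm k \<Longrightarrow> norm (f Y) \<le> M"
      unfolding bounded_iff by blast
    \<comment> \<open>Powers of an eigenvalue of modulus above 1 would make \<open>f\<close>
      unbounded on the orbit of \<open>X\<close>, contrary to compactness.\<close>
    have le1: "norm (ev t) \<le> 1" if t: "t \<in> Lat" for t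
    proof (rule ccontr)
      assume "\<not> norm (ev t) \<le> 1"
      then obtain m where m: "M / norm (f X) < norm (ev t) ^ m"
        using real_arch_pow[of "norm (ev t)"] by auto
      have "(translate (- t) ^^ m) X \<in> Adm k \<and> f ((translate (- t) ^^ m) X) = ev t ^ m * f X" for m
        by (induction m) (use X ev t translate_in_hull Lat_closed(3) in auto)
      then have "norm (ev t) ^ m * norm (f X) \<le> M"
        using M by (metis norm_mult norm_power)
      then show False
        using m X(2) by (simp add: field_simps)
    qed
    obtain t where t: "t \<in> Lat" "norm (f (translate (- t) X)) < norm (f X)"
      using near[OF X(1), of "norm (f X)"] X(2) f0 by auto
    \<comment> \<open>Returning to \<open>X\<close> by the inverse translation multiplies by
      \<open>ev (- t)\<close> and so cannot increase the modulus; hence \<open>f\<close> cannot be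
      smaller in modulus elsewhere on the orbit.\<close>
    have "f X = f (translate (- (- t)) (translate (- t) X))"
      by (simp add: translate_translate)
    also have "\<dots> = ev (- t) * f (translate (- t) X)"
      using X t Lat_closed(3) translate_in_hull by (intro ev) auto
    finally have "norm (f X) \<le> 1 * norm (f (translate (- t) X))"
      using le1[of "- t"] t(1) Lat_closed(3) by (metis mult_right_mono norm_ge_zero norm_mult)
    then show False
      using t(2) by simp
  qed
  then have one: "ev t = 1" if "t \<in> Lat" for t
    using ev[OF that empty_in_hull] by simp
  moreover have "f X = f {}" if X: "X \<in> Adm k" for X
  proof (rule ccontr)
    assume "f X \<noteq> f {}"
    then obtain t where "t \<in> Lat" "norm (f (translate (- t) X) - f {}) < norm (f X - f {})"
      using near[OF X, of "norm (f X - f {})"] by auto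
    then show False
      using ev[OF _ X] one by auto
  qed
  ultimately show "(\<forall>t\<in>Lat. ev t = 1) \<and> (\<exists>c. \<forall>X\<in>topspace hull_space. f X = c)"
    by auto
qed

section \<open>The joining with the Kronecker system\<close>

text \<open>The coset of \<open>p ^ k\<close> times the lattice through \<open>c\<close>, written as
  a congruence of coordinates.\<close>

definition residue_coset :: "nat \<Rightarrow> int^'n \<Rightarrow> (real^'n) set" where
  "residue_coset p c = pt ` {z. pmod k p z = pmod k p c}"

lemma pt_in_residue_coset: "pt z \<in> residue_coset p c \<longleftrightarrow> pmod k p z = pmod k p c"
  by (auto simp: residue_coset_def)

lemma power_sublattice_coset: "power_sublattice Lat k p #>\<^bsub>lattice_group Lat\<^esub> pt c = residue_coset p c"
proof -
  have *: "real (p ^ k) *\<^sub>R pt w + pt c = pt ((\<chi> i. int p ^ k * w $ i) + c)" for w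
    using lattice_point_smult[of B "int p ^ k" w] by (simp add: lattice_point_simps)
  have "pt z \<in> power_sublattice Lat k p #>\<^bsub>lattice_group Lat\<^esub> pt c \<longleftrightarrow>
      (\<exists>w. z = (\<chi> i. int p ^ k * w $ i) + c)" for z
  proof -
    have "pt z \<in> power_sublattice Lat k p #>\<^bsub>lattice_group Lat\<^esub> pt c \<longleftrightarrow>
        (\<exists>w. pt z = real (p ^ k) *\<^sub>R pt w + pt c)"
      by (auto simp: r_coset_def lattice_group_def power_sublattice_def)
    then show ?thesis
      unfolding * by simp
  qed
  moreover have "(\<exists>w. z = (\<chi> i. int p ^ k * w $ i) + c) \<longleftrightarrow> pmod k p z = pmod k p c" for z
  proof
    assume "pmod k p z = pmod k p c"
    then have "\<forall>i. \<exists>w. (z - c) $ i = int p ^ k * w"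
      unfolding vmod_eq_iff by (auto elim: dvdE)
    then obtain w where "\<forall>i. (z - c) $ i = int p ^ k * w i"
      unfolding choice_iff by blast
    then show "\<exists>w. z = (\<chi> i. int p ^ k * w $ i) + c"
      by (intro exI[of _ "vec_lambda w"]) (simp add: vec_eq_iff algebra_simps)
  qed (auto simp: vmod_eq_iff)
  moreover have "power_sublattice Lat k p #>\<^bsub>lattice_group Lat\<^esub> pt c \<subseteq> Lat"
  proof
    fix x assume "x \<in> power_sublattice Lat k p #>\<^bsub>lattice_group Lat\<^esub> pt c"
    then obtain w where "x = real (p ^ k) *\<^sub>R pt w + pt c"
      by (auto simp: r_coset_def lattice_group_def power_sublattice_def)
    then show "x \<in> Lat"
      unfolding * by simp
  qed
  moreover have "residue_coset p c \<subseteq> Lat"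
    by (auto simp: residue_coset_def)
  ultimately show ?thesis
    by (subst Lat_eq_iff) (auto simp: pt_in_residue_coset)
qed

lemma carrier_quotient:
  "carrier (lattice_group Lat Mod power_sublattice Lat k p) = range (residue_coset p)"
proof -
  have "carrier (lattice_group Lat) = Lat"
    by (simp add: lattice_group_def)
  then show ?thesis
    by (auto simp: FactGroup_def RCOSETS_def power_sublattice_coset)
qed

lemma topspace_kronecker:
  "topspace (kronecker_topology Lat k) = (\<Pi>\<^sub>E p\<in>{p. prime p}. range (residue_coset p))"
  by (simp add: kronecker_topology_def carrier_quotient)

lemma residue_coset_mult:
  "residue_coset p c <#>\<^bsub>lattice_group Lat\<^esub> residue_coset p d = residue_coset p (c + d)"
proof -
  let ?S = "{x + y | x y. pmod k p x = pmod k p c \<and> pmod k p y = pmod k p d}"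
  have "residue_coset p c <#>\<^bsub>lattice_group Lat\<^esub> residue_coset p d =
      pt ` ?S"
    by (force simp: set_mult_def residue_coset_def lattice_group_def lattice_point_simps image_iff)
  also have "?S =
      {z. pmod k p z = pmod k p (c + d)}"
  proof (intro equalityI subsetI)
    fix z assume "z \<in> {z. pmod k p z = pmod k p (c + d)}"
    then have "z = c + (z - c)" "pmod k p (z - c) = pmod k p d"
      by (auto simp: vmod_eq_iff algebra_simps)
    then show "z \<in> ?S"
      by blast
  next
    fix z assume "z \<in> ?S"
    then obtain x y where "z = x + y" "\<forall>i. int p ^ k dvd (x - c) $ i" "\<forall>i. int p ^ k dvd (y - d) $ i"
      by (auto simp: vmod_eq_iff)
    then have "int p ^ k dvd (x - c) $ i + (y - d) $ i" "z = x + y" for i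
      using dvd_add by blast+
    then show "z \<in> {z. pmod k p z = pmod k p (c + d)}"
      by (simp add: vmod_eq_iff algebra_simps)
  qed
  finally show ?thesis
    by (simp add: residue_coset_def)
qed

lemma kronecker_action_nth:
  assumes "prime p" "g p = residue_coset p c"
  shows "kronecker_action Lat k (pt t) g p = residue_coset p (c + t)"
  using assms by (simp add: kronecker_action_def kronecker_group_def product_group_def
      power_sublattice_coset residue_coset_mult FactGroup_def)

definition kronecker_joining :: "((real^'n) set \<times> (nat \<Rightarrow> (real^'n) set)) set" where
  "kronecker_joining = {(X, g). X \<in> Adm k \<and> g \<in> topspace (kronecker_topology Lat k) \<and>
     (\<forall>p. prime p \<longrightarrow> X \<inter> g p = {})}"

text \<open>If \<open>X\<close> and \<open>g p\<close> share a point \<open>x\<close>, they still do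
  after any change that keeps \<open>x\<close> in the set and keeps the component at
  \<open>p\<close>; these are open conditions.\<close>

lemma closedin_kronecker_joining:
  "closedin (prod_topology hull_space (kronecker_topology Lat k)) kronecker_joining"
  unfolding closedin_def
proof
  let ?K = "kronecker_topology Lat k"
  show "kronecker_joining \<subseteq> topspace (prod_topology hull_space ?K)"
    by (auto simp: kronecker_joining_def)
  show "openin (prod_topology hull_space ?K) (topspace (prod_topology hull_space ?K) - kronecker_joining)"
  proof (subst openin_subopen, safe)
    fix X g assume "(X, g) \<in> topspace (prod_topology hull_space ?K)" and "(X, g) \<notin> kronecker_joining"
    then have Xg: "X \<in> Adm k" "g \<in> topspace ?K"
      and "\<exists>p. prime p \<and> X \<inter> g p \<noteq> {}"
      by (auto simp: kronecker_joining_def)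
    then obtain p x where p: "prime p" and x: "x \<in> X" "x \<in> g p"
      by blast
    let ?A = "{Y \<in> Adm k. Y \<inter> {x} = {x}}"
    let ?C = "{h \<in> topspace ?K. h p \<in> {g p}}"
    have "openin hull_space ?A"
      using x(1) Xg(1) hull_subset_Lat by (intro openin_hull_cylinder) auto
    moreover have "openin ?K ?C"
    proof (rule openin_continuous_map_preimage)
      show "continuous_map ?K (discrete_topology (range (residue_coset p))) (\<lambda>h. h p)"
        unfolding kronecker_topology_def carrier_quotient
        using continuous_map_product_projection[of p "{p. prime p}" "\<lambda>p. discrete_topology (range (residue_coset p))"] p
        by simp
      show "openin (discrete_topology (range (residue_coset p))) {g p}"
        using Xg(2) p by (auto simp: topspace_kronecker PiE_iff)
    qed
    ultimately have "openin (prod_topology hull_space ?K) (?A \<times> ?C)"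
      by (simp add: openin_prod_Times_iff)
    moreover have "(X, g) \<in> ?A \<times> ?C"
      using Xg x by auto
    moreover have "?A \<times> ?C \<subseteq> topspace (prod_topology hull_space ?K) - kronecker_joining"
    proof
      fix Yh assume Yh: "Yh \<in> ?A \<times> ?C"
      then obtain Y h where "Yh = (Y, h)" "Y \<in> Adm k" "x \<in> Y" "h \<in> topspace ?K" "h p = g p"
        by auto
      then show "Yh \<in> topspace (prod_topology hull_space ?K) - kronecker_joining"
        using p x(2) by (auto simp: kronecker_joining_def)
    qed
    ultimately show "\<exists>T. openin (prod_topology hull_space ?K) T \<and> (X, g) \<in> T \<and>
        T \<subseteq> topspace (prod_topology hull_space ?K) - kronecker_joining"
      by blast
  qed
qed

text \<open>Set and cosets are moved by the same vector, whence invariance. Surjectivity onto the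
  hull is admissibility; onto the Kronecker system it holds because the empty set is compatible with
  every \<open>g\<close>.\<close>

lemma joining_kronecker:
  "joining Lat hull_space translate (kronecker_topology Lat k) (kronecker_action Lat k) kronecker_joining"
proof -
  let ?K = "kronecker_topology Lat k"
  have K: "\<exists>c. \<forall>p. prime p \<longrightarrow> g p = residue_coset p (c p)" if "g \<in> topspace ?K" for g
  proof -
    have "\<forall>p. \<exists>c. prime p \<longrightarrow> g p = residue_coset p c"
      using that by (auto simp: topspace_kronecker PiE_iff)
    then show ?thesis
      unfolding choice_iff .
  qed
  have "map_prod (translate t) (kronecker_action Lat k t) ` kronecker_joining \<subseteq> kronecker_joining"
    if t: "t \<in> Lat" for t
  proof (rule image_subsetI)
    fix Z assume "Z \<in> kronecker_joining"
    then obtain X g where Z: "Z = (X, g)" and Xg: "(X, g) \<in> kronecker_joining"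
      by (cases Z) auto
    obtain \<tau> where \<tau>: "t = pt \<tau>"
      using t by blast
    have X: "X \<in> Adm k" "\<And>p. prime p \<Longrightarrow> X \<inter> g p = {}"
      using Xg by (auto simp: kronecker_joining_def)
    obtain c where c: "\<And>p. prime p \<Longrightarrow> g p = residue_coset p (c p)"
      using K[of g] Xg by (auto simp: kronecker_joining_def)
    have act: "kronecker_action Lat k t g p = residue_coset p (c p + \<tau>)" if "prime p" for p
      unfolding \<tau> using kronecker_action_nth[of p g, OF that c[OF that]] .
    have "kronecker_action Lat k t g \<in> extensional {p. prime p}"
      by (simp add: kronecker_action_def kronecker_group_def product_group_def)
    then have "kronecker_action Lat k t g \<in> topspace ?K"
      using act by (auto simp: topspace_kronecker PiE_iff)
    moreover have "translate t X \<in> Adm k"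
      using X t translate_in_hull by blast
    moreover have "translate t X \<inter> kronecker_action Lat k t g p = {}" if p: "prime p" for p
    proof -
      have "pt z \<notin> residue_coset p (c p + \<tau>)" if "pt (z - \<tau>) \<in> X" for z
      proof
        assume "pt z \<in> residue_coset p (c p + \<tau>)"
        then have "pt (z - \<tau>) \<in> residue_coset p (c p)"
          by (simp add: pt_in_residue_coset vmod_eq_iff algebra_simps)
        then show False
          using that X(2)[OF p] c[OF p] by blast
      qed
      moreover have "translate t X \<subseteq> Lat"
        using \<open>translate t X \<in> Adm k\<close> hull_subset_Lat by blast
      ultimately show ?thesis
        unfolding act[OF p] using pt_in_translate[of _ \<tau> X] \<tau> by blast
    qed
    ultimately show "map_prod (translate t) (kronecker_action Lat k t) Z \<in> kronecker_joining"
      by (simp add: kronecker_joining_def Z)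
  qed
  moreover have "fst ` kronecker_joining = Adm k"
  proof (intro equalityI subsetI)
    fix X assume X: "X \<in> Adm k"
    obtain c where c: "\<And>p z. prime p \<Longrightarrow> pt z \<in> X \<Longrightarrow> pmod k p z \<noteq> pmod k p (c p)"
      using missing_residues[OF X] by blast
    have "(X, \<lambda>p\<in>{p. prime p}. residue_coset p (c p)) \<in> kronecker_joining"
      using X c by (auto simp: kronecker_joining_def topspace_kronecker residue_coset_def)
    then show "X \<in> fst ` kronecker_joining"
      by force
  qed (auto simp: kronecker_joining_def)
  moreover have "snd ` kronecker_joining = topspace ?K"
  proof (intro equalityI subsetI)
    fix g assume "g \<in> topspace ?K"
    then have "({}, g) \<in> kronecker_joining"
      by (simp add: kronecker_joining_def empty_in_hull)
    then show "g \<in> snd ` kronecker_joining"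
      by force
  qed (auto simp: kronecker_joining_def)
  ultimately show ?thesis
    using closedin_kronecker_joining by (simp add: joining_def closed_invariant_def)
qed

text \<open>The set consisting of the origin meets the zero cosets, so this pair is absent from the
  joining.\<close>

lemma kronecker_joining_nontrivial:
  "kronecker_joining \<noteq> topspace hull_space \<times> topspace (kronecker_topology Lat k)"
proof -
  have "card {0 :: int^'n} < 2 ^ (CARD('n) * k)"
    using k2 one_less_power[of "2 :: nat" "CARD('n) * k"] by (simp del: nat_0_less_mult_iff)
  then have "pt ` {0} \<in> Adm k"
    by (intro admissible_image admissible_card) auto
  moreover have "(\<lambda>p\<in>{p. prime p}. residue_coset p 0) \<in> topspace (kronecker_topology Lat k)"
    by (auto simp: topspace_kronecker)
  moreover have "(pt ` {0}, \<lambda>p\<in>{p. prime p}. residue_coset p 0) \<notin> kronecker_joining"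
    using two_is_prime_nat pt_in_residue_coset[of 0 2 0] by (fastforce simp: kronecker_joining_def)
  ultimately show ?thesis
    by auto
qed

text \<open>A set in the hull that contains a translate of all nonzero residues modulo \<open>2\<^sup>k\<close>
  determines that translation modulo \<open>2\<^sup>k\<close>, which is a nontrivial constraint on pairs.\<close>

lemma not_weakly_mixing_hull: "\<not> topologically_weakly_mixing Lat hull_space translate"
proof
  assume wm: "topologically_weakly_mixing Lat hull_space translate"
  let ?q = "int 2 ^ k"
  \<comment> \<open>One point in each nonzero class modulo \<open>2 ^ k\<close>; an admissible set
    containing it can miss no class modulo \<open>2 ^ k\<close> but zero.\<close>
  let ?P = "pt ` (res_box ?q - {0})"
  let ?a = "(\<chi> i. 1) :: int^'n"
  have q: "?q > 1"
    using k1 by (simp add: one_less_power)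
  have "card (res_box ?q - {0} :: (int^'n) set) = 2 ^ (CARD('n) * k) - 1"
    using q by (subst card_Diff_singleton)
      (auto simp: res_box_def card_res_box[unfolded res_box_def] nat_power_eq power_mult[symmetric] mult.commute)
  then have P: "?P \<in> Adm k"
    by (intro admissible_image admissible_card) auto
  have aP: "translate (pt ?a) ?P \<in> Adm k"
    using P translate_in_hull by blast
  \<comment> \<open>Containing the translate by \<open>s\<close> leaves only the class of
    \<open>s\<close> to be missed.\<close>
  have full: "vmod ?q c = vmod ?q s"
    if "translate (pt s) ?P \<subseteq> Z" "\<And>z. pt z \<in> Z \<Longrightarrow> vmod ?q z \<noteq> vmod ?q c" for Z s c
  proof (rule ccontr)
    assume ne: "vmod ?q c \<noteq> vmod ?q s"
    let ?r = "vmod ?q (c - s)"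
    have "?r \<noteq> 0"
      using ne unfolding vmod_eq_iff by (auto simp: vec_eq_iff dvd_eq_mod_eq_0)
    then have "?r \<in> res_box ?q - {0}"
      using vmod_in_res_box[of ?q "c - s"] q by simp
    then have "pt (?r + s) \<in> translate (pt s) ?P"
      by (auto simp: pt_in_translate)
    moreover have "vmod ?q (?r + s) = vmod ?q c"
      by (simp add: vec_eq_iff mod_simps)
    ultimately show False
      using that by blast
  qed
  define C where "C = (\<lambda>F. {Y \<in> Adm k. Y \<inter> F = F})"
  have C: "openin hull_space (C F)" if "finite F" "F \<subseteq> Lat" for F
    unfolding C_def by (rule openin_hull_cylinder[OF that])
  have fin: "finite (translate (pt s) ?P)" "translate (pt s) ?P \<subseteq> Lat" for s
    using translate_subset_Lat[of "pt s" ?P] by (auto simp: translate_def)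
  \<comment> \<open>With these two open sets the first component forces \<open>t\<close> into the
    zero class modulo \<open>2 ^ k\<close>, and the second forces it into the class of
    \<open>- ?a\<close>.\<close>
  have "openin (prod_topology hull_space hull_space) (C ?P \<times> C ?P)"
    "openin (prod_topology hull_space hull_space) (C ?P \<times> C (translate (pt ?a) ?P))"
    using C[OF fin, of 0] C[OF fin, of ?a] by (simp_all add: openin_prod_Times_iff lattice_point_simps)
  moreover have "C ?P \<times> C ?P \<noteq> {}" "C ?P \<times> C (translate (pt ?a) ?P) \<noteq> {}"
    using P aP by (auto simp: C_def)
  ultimately obtain t where t: "t \<in> Lat"
    "C ?P \<times> C ?P \<inter> map_prod (translate t) (translate t) ` (C ?P \<times> C (translate (pt ?a) ?P)) \<noteq> {}"
    using wm unfolding topologically_weakly_mixing_def topologically_transitive_def by meson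
  obtain \<tau> where \<tau>: "t = pt \<tau>"
    using t(1) by blast
  obtain Z1 Z2 where Z: "Z1 \<in> C ?P" "Z2 \<in> C (translate (pt ?a) ?P)"
    "translate t Z1 \<in> C ?P" "translate t Z2 \<in> C ?P"
    using t(2) by auto
  have mono: "translate t X \<subseteq> translate t Y" if "X \<subseteq> Y" for X Y
    using that by (auto simp: in_translate_iff)
  have res: "vmod ?q s = 0" if ZC: "Z \<in> C ?P" and ZP: "translate (pt s) ?P \<subseteq> Z" for Z s
  proof -
    obtain c where c: "\<And>z. pt z \<in> Z \<Longrightarrow> vmod ?q z \<noteq> vmod ?q c"
    proof -
      have "Z \<in> Adm k"
        using ZC by (simp add: C_def)
      then obtain c where "\<And>p z. prime p \<Longrightarrow> pt z \<in> Z \<Longrightarrow> pmod k p z \<noteq> pmod k p (c p)"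
        using missing_residues by blast
      from this[OF two_is_prime_nat] show ?thesis
        by (rule that)
    qed
    have "?P \<subseteq> Z"
      using ZC by (auto simp: C_def)
    then have "vmod ?q c = vmod ?q 0"
      using full[of 0 Z c] c by (simp add: lattice_point_simps)
    moreover have "vmod ?q c = vmod ?q s"
      using full[OF ZP c] .
    ultimately show ?thesis
      by (simp add: vec_eq_iff)
  qed
  have "translate (pt \<tau>) ?P \<subseteq> translate t Z1"
    unfolding \<tau>[symmetric] using Z(1) by (intro mono) (auto simp: C_def)
  then have 1: "vmod ?q \<tau> = 0"
    by (rule res[OF Z(3)])
  have "translate t (translate (pt ?a) ?P) \<subseteq> translate t Z2"
    using Z(2) by (intro mono) (auto simp: C_def)
  then have "translate (pt (\<tau> + ?a)) ?P \<subseteq> translate t Z2"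
    by (simp add: \<tau> translate_translate lattice_point_simps)
  then have "vmod ?q (\<tau> + ?a) = 0"
    by (rule res[OF Z(4)])
  then have "vmod ?q (\<tau> + ?a) = vmod ?q \<tau>"
    using 1 by simp
  then have "?q dvd (\<tau> + ?a - \<tau>) $ undefined"
    unfolding vmod_eq_iff by blast
  then have "?q dvd 1"
    by (simp del: zdvd1_eq)
  then show False
    using zdvd_imp_le[of ?q 1] q by linarith
qed

end

section \<open>Limits of subadditive set functions\<close>

context unimodular_basis
begin

lemma UN_inner_cells_subset: "(\<Union>b\<in>inner_cells q R. cell q b) \<subseteq> disc R"
  by (auto simp: inner_cells_def)

lemma disc_subset_UN_outer_cells: "disc R \<subseteq> (\<Union>b\<in>outer_cells q R. cell q b)"
  by (auto simp: outer_cells_def cell_def)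

end

lemma cell_eq_translate:
  assumes "q > 0"
  shows "cell q b = (+) (\<chi> i. q * b $ i) ` res_box q"
proof (intro equalityI subsetI)
  fix z assume "z \<in> cell q b"
  then have "z = (\<chi> i. q * b $ i) + vmod q z"
    by (auto simp: cell_def vec_eq_iff) (metis mult_div_mod_eq)
  then show "z \<in> (+) (\<chi> i. q * b $ i) ` res_box q"
    using vmod_in_res_box[OF assms] by blast
next
  fix z assume "z \<in> (+) (\<chi> i. q * b $ i) ` res_box q"
  then show "z \<in> cell q b"
    using assms by (auto simp: cell_def vec_eq_iff res_box_def)
qed

text \<open>Modelled on the logarithm of a minimal cover number as a function of the finite window.
  The inequality \<open>transl\<close>, being available for \<open>t\<close> and \<open>- t\<close>,
  amounts to translation invariance.\<close>

locale subadditive_set_function = unimodular_basis B for B :: "real^'n^'n" +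
  fixes a :: "(int^'n) set \<Rightarrow> real"
  assumes at_empty: "a {} = 0"
    and mono: "finite G \<Longrightarrow> F \<subseteq> G \<Longrightarrow> a F \<le> a G"
    and subadd: "finite F \<Longrightarrow> finite G \<Longrightarrow> a (F \<union> G) \<le> a F + a G"
    and transl: "finite F \<Longrightarrow> a ((+) t ` F) \<le> a F"
begin

lemma nonneg: "finite F \<Longrightarrow> 0 \<le> a F"
  using mono[of F "{}"] by (simp add: at_empty)

lemma cells_bound:
  assumes "q > 0" "finite C"
  shows "a (\<Union>b\<in>C. cell q b) \<le> card C * a (res_box q)"
  using assms(2)
proof (induction C)
  case empty
  then show ?case
    by (simp add: at_empty)
next
  case (insert b C)
  have "a (\<Union>b\<in>insert b C. cell q b) \<le> a (cell q b) + a (\<Union>b\<in>C. cell q b)"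
    using insert subadd[of "cell q b" "\<Union>b\<in>C. cell q b"] by (simp add: finite_cell[OF assms(1)])
  also have "a (cell q b) \<le> a (res_box q)"
    unfolding cell_eq_translate[OF assms(1)] by (rule transl) simp
  finally show ?case
    using insert by (simp add: algebra_simps)
qed

text \<open>As in Fekete's lemma, the limit will be the infimum over cubes.\<close>

definition rate :: real where
  "rate = (INF q\<in>{q. q > 0}. a (res_box q) / of_int q ^ CARD('n))"

lemma bdd_rate: "bdd_below ((\<lambda>q. a (res_box q) / of_int q ^ CARD('n)) ` {q. q > 0})"
  by (rule bdd_belowI[of _ 0]) (auto intro!: divide_nonneg_nonneg nonneg)

lemma rate_le: "q > 0 \<Longrightarrow> rate * of_int q ^ CARD('n) \<le> a (res_box q)"
proof -
  assume q: "q > 0"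
  then have "rate \<le> a (res_box q) / of_int q ^ CARD('n)"
    unfolding rate_def by (intro cINF_lower[OF bdd_rate]) simp
  then show ?thesis
    using q by (simp add: field_simps)
qed

lemma rate_approx: "\<epsilon> > 0 \<Longrightarrow> \<exists>q>0. a (res_box q) < (rate + \<epsilon>) * of_int q ^ CARD('n)"
proof -
  assume "\<epsilon> > 0"
  moreover have "{q :: int. q > 0} \<noteq> {}"
    using zero_less_one by blast
  ultimately obtain q :: int where "q > 0" "a (res_box q) / of_int q ^ CARD('n) < rate + \<epsilon>"
    using cInf_lessD[of "(\<lambda>q. a (res_box q) / of_int q ^ CARD('n)) ` {q. q > 0}" "rate + \<epsilon>"]
    unfolding rate_def by auto
  then show ?thesis
    by (intro exI[of _ q]) (simp add: field_simps)
qed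

text \<open>For the lower bound a large cube around the disc is cut into the disc and those cells which
  do not lie inside it.\<close>

lemma disc_lower_bound:
  assumes q: "q > 0" and \<epsilon>: "a (res_box q) \<le> (rate + \<epsilon>) * of_int q ^ CARD('n)" "\<epsilon> > 0"
    and R: "R \<ge> 4 * of_int q"
  shows "rate * of_int q ^ CARD('n) * card (inner_cells q R) - \<epsilon> * ((2 * \<kappa> + 1) * R) ^ CARD('n) \<le> a (disc R)"
proof -
  let ?n = "CARD('n)"
  \<comment> \<open>With this \<open>m\<close> the cube of half side \<open>q * m\<close> contains
    the disc, while its full side is at most \<open>2 * \<kappa> * R + 4 * q\<close>; this is where
    \<open>R \<ge> 4 * q\<close> enters.\<close>
  define m where "m = \<lceil>\<kappa> * R / of_int q\<rceil> + 1"
  have R0: "R > 0"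
    using R q by (meson less_le_trans mult_pos_pos of_int_0_less_iff zero_less_numeral)
  have "\<kappa> * R / of_int q \<ge> 0"
    using \<kappa>_pos R0 q by simp
  then have m: "m \<ge> 1" "\<kappa> * R / of_int q < of_int m" "of_int m \<le> \<kappa> * R / of_int q + 2"
    unfolding m_def by linarith+
  then have mq: "\<kappa> * R < of_int (q * m)" "of_int (q * m) \<le> \<kappa> * R + 2 * of_int q"
    using q by (simp_all add: field_simps)
  define C where "C = {b :: int^'n. \<forall>i. b $ i \<in> {-m..<m}}"
  have C: "finite C" "card C = nat (2 * m) ^ ?n"
  proof -
    show "finite C"
      unfolding C_def by (rule finite_vec_box) simp
    show "card C = nat (2 * m) ^ ?n"
      unfolding C_def card_vec_box using m(1) by simp
  qed
  define Q where "Q = (\<Union>b\<in>C. cell q b)"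
  have finQ: "finite Q"
    using C(1) by (simp add: Q_def finite_cell[OF q])
  have QI: "z \<in> Q" if "\<And>i. - (q * m) \<le> z $ i \<and> z $ i < q * m" for z
  proof -
    have "- m \<le> z $ i div q \<and> z $ i div q < m" for i
    proof
      have "(- m * q) div q \<le> z $ i div q"
        using that[of i] q by (intro zdiv_mono1) (auto simp: mult.commute)
      then show "- m \<le> z $ i div q"
        using q nonzero_mult_div_cancel_right[of q "- m"] by simp
      show "z $ i div q < m"
      proof (rule ccontr)
        assume "\<not> z $ i div q < m"
        then have "m * q \<le> z $ i div q * q"
          using q by (intro mult_right_mono) auto
        then show False
          using that[of i] div_mult_mod_eq[of "z $ i" q] pos_mod_sign[OF q, of "z $ i"]
          unfolding mult.commute[of q m] by linarith
      qed
    qed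
    then have "vdiv q z \<in> C"
      by (simp add: C_def)
    then show ?thesis
      unfolding Q_def cell_def by blast
  qed
  have discQ: "disc R \<subseteq> Q"
  proof
    fix z assume z: "z \<in> disc R"
    show "z \<in> Q"
    proof (rule QI)
      fix i
      have "of_int \<bar>z $ i\<bar> \<le> \<kappa> * R"
        using coord_lattice_point[of z i] z \<kappa>_pos
        by (smt (verit) disc_def mem_Collect_eq mult_left_mono)
      then have "of_int \<bar>z $ i\<bar> < (of_int (q * m) :: real)"
        using mq(1) by linarith
      then have "\<bar>z $ i\<bar> < q * m"
        by (simp only: of_int_less_iff)
      then show "- (q * m) \<le> z $ i \<and> z $ i < q * m"
        by linarith
    qed
  qed
  have inner: "inner_cells q R \<subseteq> C"
  proof
    fix b assume b: "b \<in> inner_cells q R"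
    obtain z where "z \<in> cell q b"
      using cell_eq_translate[OF q, of b] vmod_in_res_box[OF q] by blast
    then have "z \<in> Q" "vdiv q z = b"
      using b discQ by (auto simp: inner_cells_def cell_def)
    then show "b \<in> C"
      by (auto simp: Q_def cell_def)
  qed
  have "Q - disc R \<subseteq> (\<Union>b\<in>C - inner_cells q R. cell q b)"
    unfolding Q_def using UN_inner_cells_subset[of q R] by blast
  moreover have finD: "finite (\<Union>b\<in>C - inner_cells q R. cell q b)"
    using C(1) by (simp add: finite_cell[OF q])
  ultimately have "a (Q - disc R) \<le> a (\<Union>b\<in>C - inner_cells q R. cell q b)"
    by (intro mono)
  also have "\<dots> \<le> card (C - inner_cells q R) * a (res_box q)"
    using C(1) by (intro cells_bound[OF q]) simp
  finally have rest: "a (Q - disc R) \<le> (real (card C) - card (inner_cells q R)) * a (res_box q)"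
    using C(1) inner by (simp add: card_Diff_subset finite_inner_cells[OF q] of_nat_diff card_mono)
  let ?M = "2 * m * q"
  have M: "?M > 0"
    using m(1) q by simp
  have "rate * of_int ?M ^ ?n \<le> a (res_box ?M)"
    by (rule rate_le[OF M])
  \<comment> \<open>The standard cube of side \<open>?M\<close> is a translate of the cube centred
    at the origin, which is contained in \<open>Q\<close>.\<close>
  also have "\<dots> = a ((+) (\<chi> i. m * q) ` (+) (\<chi> i. - (m * q)) ` res_box ?M)"
    by (simp add: image_image add.assoc[symmetric]) (simp add: plus_vec_def zero_vec_def[symmetric])
  also have "\<dots> \<le> a ((+) (\<chi> i. - (m * q)) ` res_box ?M)"
    by (rule transl) simp
  also have "\<dots> \<le> a Q"
    by (rule mono[OF finQ]) (auto intro!: QI simp: res_box_def algebra_simps)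
  also have "\<dots> = a (disc R \<union> (Q - disc R))"
    using discQ by (simp add: Un_absorb1)
  also have "\<dots> \<le> a (disc R) + a (Q - disc R)"
    using finQ by (intro subadd) auto
  also have "\<dots> \<le> a (disc R) + (real (card C) - card (inner_cells q R)) * a (res_box q)"
    using rest by simp
  also have "\<dots> \<le> a (disc R) + (real (card C) - card (inner_cells q R)) * ((rate + \<epsilon>) * of_int q ^ ?n)"
    using \<epsilon>(1) card_mono[OF C(1) inner] by (intro add_left_mono mult_left_mono) auto
  also have "\<dots> = a (disc R) + real (card C) * of_int q ^ ?n * (rate + \<epsilon>)
      - rate * of_int q ^ ?n * card (inner_cells q R) - \<epsilon> * of_int q ^ ?n * card (inner_cells q R)"
    by (simp add: algebra_simps)
  also have "real (card C) * of_int q ^ ?n = of_int ?M ^ ?n"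
    using m(1) by (simp add: C(2) power_mult_distrib)
  \<comment> \<open>The terms \<open>rate * ?M ^ n\<close> on both sides cancel, and
    \<open>\<epsilon>\<close> times the volume of the cube remains as the error.\<close>
  finally have "rate * of_int ?M ^ ?n \<le> a (disc R) + of_int ?M ^ ?n * (rate + \<epsilon>)
      - rate * of_int q ^ ?n * card (inner_cells q R) - \<epsilon> * of_int q ^ ?n * card (inner_cells q R)" .
  moreover have "\<epsilon> * of_int q ^ ?n * card (inner_cells q R) \<ge> 0"
    using \<epsilon>(2) q by simp
  moreover have "\<epsilon> * of_int ?M ^ ?n \<le> \<epsilon> * ((2 * \<kappa> + 1) * R) ^ ?n"
  proof (rule mult_left_mono[OF power_mono])
    show "of_int ?M \<le> (2 * \<kappa> + 1) * R"
      using mq(2) R by (simp add: algebra_simps)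
    show "(0 :: real) \<le> of_int ?M"
      using M by (simp only: of_int_0_le_iff)
  qed (use \<epsilon>(2) in simp)
  ultimately show ?thesis
    by (simp add: algebra_simps)
qed

text \<open>Fekete's lemma for discs: from above a disc is covered by its outer cells, and from
  below \<open>disc_lower_bound\<close> compares it with a surrounding cube.\<close>

lemma tendsto_rate: "((\<lambda>R. a (disc R) / vol R) \<longlongrightarrow> rate) at_top"
proof (rule order_tendstoI)
  fix u assume "u > rate"
  then obtain q where q: "q > 0" "a (res_box q) < (rate + (u - rate)) * of_int q ^ CARD('n)"
    using rate_approx[of "u - rate"] by auto
  then have lim: "1 / of_int q ^ CARD('n) * a (res_box q) < u"
    by (simp add: field_simps)
  have "((\<lambda>R. card (outer_cells q R) / vol R * a (res_box q)) \<longlongrightarrow> 1 / of_int q ^ CARD('n) * a (res_box q)) at_top"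
    by (intro tendsto_mult_right card_cells_ratio q)
  then have "\<forall>\<^sub>F R in at_top. card (outer_cells q R) / vol R * a (res_box q) < u"
    using lim by (rule order_tendstoD(2))
  then show "\<forall>\<^sub>F R in at_top. a (disc R) / vol R < u"
    using eventually_gt_at_top[of 0]
  proof eventually_elim
    case (elim R)
    have "a (disc R) \<le> a (\<Union>b\<in>outer_cells q R. cell q b)"
      using disc_subset_UN_outer_cells by (intro mono) (simp_all add: finite_cell[OF q(1)])
    also have "\<dots> \<le> card (outer_cells q R) * a (res_box q)"
      by (rule cells_bound[OF q(1)]) simp
    finally have "a (disc R) / vol R \<le> card (outer_cells q R) * a (res_box q) / vol R"
      using vol_pos[OF elim(2)] by (simp add: divide_right_mono)
    then show ?case
      using elim(1) by simp
  qed
next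
  fix l assume "l < rate"
  define v where "v = vol 1"
  have v: "v > 0"
    by (simp add: v_def vol_pos)
  \<comment> \<open>The error in \<open>disc_lower_bound\<close>, divided by \<open>vol R\<close>,
    is \<open>\<epsilon> * K\<close> for every \<open>R > 0\<close>; \<open>\<epsilon>\<close> is
    chosen to make it half of the gap between \<open>rate\<close> and \<open>l\<close>.\<close>
  define K where "K = (2 * \<kappa> + 1) ^ CARD('n) / v"
  have K: "K > 0"
    using \<kappa>_pos v by (simp add: K_def)
  define \<epsilon> where "\<epsilon> = (rate - l) / (2 * K)"
  have \<epsilon>: "\<epsilon> > 0" "\<epsilon> * K = (rate - l) / 2"
    using \<open>l < rate\<close> K by (simp_all add: \<epsilon>_def)
  obtain q where q: "q > 0" "a (res_box q) < (rate + \<epsilon>) * of_int q ^ CARD('n)"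
    using rate_approx[OF \<epsilon>(1)] by auto
  have "((\<lambda>R. rate * of_int q ^ CARD('n) * (card (inner_cells q R) / vol R)) \<longlongrightarrow>
      rate * of_int q ^ CARD('n) * (1 / of_int q ^ CARD('n))) at_top"
    by (intro tendsto_mult_left card_cells_ratio q)
  moreover have "rate * of_int q ^ CARD('n) * (1 / of_int q ^ CARD('n)) = rate"
    using q by simp
  ultimately have "\<forall>\<^sub>F R in at_top. rate * of_int q ^ CARD('n) * (card (inner_cells q R) / vol R) > (rate + l) / 2"
    using \<open>l < rate\<close> by (intro order_tendstoD(1)) (simp_all only: field_sum_of_halves, simp)
  then show "\<forall>\<^sub>F R in at_top. l < a (disc R) / vol R"
    using eventually_ge_at_top[of "4 * of_int q"]
  proof eventually_elim
    case (elim R)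
    have R: "R > 0"
      using elim(2) q(1) by (meson less_le_trans mult_pos_pos of_int_0_less_iff zero_less_numeral)
    have gen: "l < y" if "x - z \<le> y" "z = e" "x > (rate + l) / 2" "e = (rate - l) / 2" for x y z e :: real
      using that by (simp add: field_simps)
    have volR: "vol R = R ^ CARD('n) * v"
      using vol_mult[of R 1] by (simp add: v_def)
    have "(rate * of_int q ^ CARD('n) * card (inner_cells q R) - \<epsilon> * ((2 * \<kappa> + 1) * R) ^ CARD('n)) / vol R
        \<le> a (disc R) / vol R"
      using disc_lower_bound[OF q(1) less_imp_le[OF q(2)] \<epsilon>(1) elim(2)] vol_pos[OF R] by (simp add: divide_right_mono)
    moreover have "\<epsilon> * ((2 * \<kappa> + 1) * R) ^ CARD('n) / vol R = \<epsilon> * K"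
      using R v by (simp add: volR K_def power_mult_distrib)
    moreover have "rate * of_int q ^ CARD('n) * card (inner_cells q R) / vol R > (rate + l) / 2"
      using elim(1) by simp
    ultimately show ?case
      using \<epsilon>(2) gen unfolding diff_divide_distrib[of _ _ "vol R"] by blast
  qed
qed

end

section \<open>Topological entropy\<close>

context k_free_system
begin

text \<open>The members need be neither open nor intersections of pulled-back sets. This makes it
  easy to shrink the window, to combine covers and to translate them, while the minimal cardinality
  is the same as for subcovers of the join.\<close>

definition refines_along :: "(real^'n) set set set \<Rightarrow> (int^'n) set \<Rightarrow> (real^'n) set set set \<Rightarrow> bool" where
  "refines_along \<U> F \<V> \<longleftrightarrow> finite \<V> \<and> \<Union>\<V> = Adm k \<and>
     (\<forall>v\<in>\<V>. \<forall>z\<in>F. \<exists>A\<in>\<U>. v \<subseteq> translate (- pt z) ` A)"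

definition cover_number :: "(real^'n) set set set \<Rightarrow> (int^'n) set \<Rightarrow> nat" where
  "cover_number \<U> F = (LEAST m. \<exists>\<V>. refines_along \<U> F \<V> \<and> card \<V> = m)"

lemma cover_number_le: "refines_along \<U> F \<V> \<Longrightarrow> cover_number \<U> F \<le> card \<V>"
  unfolding cover_number_def by (rule Least_le) blast

lemma translate_image_iff: "X \<in> translate (- t) ` A \<longleftrightarrow> translate t X \<in> A"
  by (auto simp: translate_translate image_iff intro!: bexI[of _ "translate t X"])

definition patterns :: "(int^'n) set \<Rightarrow> (int^'n) set set" where
  "patterns G = (\<lambda>X. pt -` X \<inter> G) ` Adm k"

lemma finite_patterns: "finite G \<Longrightarrow> finite (patterns G)"
  by (rule finite_subset[of _ "Pow G"]) (auto simp: patterns_def)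

context
  fixes \<U> :: "(real^'n) set set set"
  assumes \<U>: "finite_open_cover hull_space \<U>"
begin

lemma refines_empty: "refines_along \<U> {} {Adm k}"
  by (simp add: refines_along_def)

lemma refines_single: "refines_along \<U> {z} ((\<lambda>A. translate (- pt z) ` A) ` \<U>)"
proof -
  have "\<Union>((\<lambda>A. translate (- pt z) ` A) ` \<U>) = translate (- pt z) ` \<Union>\<U>"
    by blast
  also have "\<dots> = Adm k"
    using \<U> translate_hull Lat_closed(3) by (auto simp: finite_open_cover_def)
  finally show ?thesis
    using \<U> by (auto simp: refines_along_def finite_open_cover_def)
qed

lemma refines_Un:
  assumes "refines_along \<U> F \<V>" "refines_along \<U> G \<W>"
  shows "refines_along \<U> (F \<union> G) ((\<lambda>(v, w). v \<inter> w) ` (\<V> \<times> \<W>))"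
proof -
  have "\<Union>((\<lambda>(v, w). v \<inter> w) ` (\<V> \<times> \<W>)) = \<Union>\<V> \<inter> \<Union>\<W>"
    by auto
  moreover have "\<exists>A\<in>\<U>. v \<inter> w \<subseteq> translate (- pt z) ` A" if "v \<in> \<V>" "w \<in> \<W>" "z \<in> F \<union> G" for v w z
  proof (cases "z \<in> F")
    case True
    then show ?thesis
      using assms(1) that(1) unfolding refines_along_def by (meson inf.coboundedI1)
  next
    case False
    then show ?thesis
      using assms(2) that(2,3) unfolding refines_along_def by (meson UnE inf.coboundedI2)
  qed
  ultimately show ?thesis
    using assms by (auto simp: refines_along_def)
qed

lemma ex_refines: "finite F \<Longrightarrow> \<exists>\<V>. refines_along \<U> F \<V>"
proof (induction F rule: finite_induct)
  case empty
  then show ?case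
    using refines_empty by blast
next
  case (insert z F)
  then show ?case
    using refines_Un[OF refines_single[of z]] by (metis insert_is_Un)
qed

lemma cover_number_attained:
  assumes "finite F"
  shows "\<exists>\<V>. refines_along \<U> F \<V> \<and> card \<V> = cover_number \<U> F"
proof -
  have "\<exists>m. \<exists>\<V>. refines_along \<U> F \<V> \<and> card \<V> = m"
    using ex_refines[OF assms] by blast
  then show ?thesis
    unfolding cover_number_def by (rule LeastI_ex)
qed

lemma cover_number_pos:
  assumes "finite F"
  shows "cover_number \<U> F \<ge> 1"
proof -
  obtain \<V> where "refines_along \<U> F \<V>" "card \<V> = cover_number \<U> F"
    using cover_number_attained[OF assms] by blast
  moreover from this have "\<V> \<noteq> {}" "finite \<V>"
    using empty_in_hull[of k] by (auto simp: refines_along_def)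
  ultimately show ?thesis
    by (metis One_nat_def Suc_leI card_gt_0_iff)
qed

text \<open>Intersecting the members of two covers at most multiplies the cardinalities, and
  translating all members translates the window.\<close>

lemma subadditive_cover_number: "subadditive_set_function B (\<lambda>F. log 2 (cover_number \<U> F))"
proof
  have "cover_number \<U> {} = 1"
    using cover_number_le[OF refines_empty] cover_number_pos[of "{}"] by simp
  then show "log 2 (cover_number \<U> {}) = 0"
    by simp
next
  fix F G :: "(int^'n) set" assume "finite G" "F \<subseteq> G"
  then obtain \<V> where "refines_along \<U> G \<V>" "card \<V> = cover_number \<U> G"
    using cover_number_attained by blast
  moreover then have "refines_along \<U> F \<V>"
    using \<open>F \<subseteq> G\<close> by (auto simp: refines_along_def)
  ultimately have "cover_number \<U> F \<le> cover_number \<U> G"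
    using cover_number_le by metis
  then show "log 2 (cover_number \<U> F) \<le> log 2 (cover_number \<U> G)"
    using cover_number_pos[of F] \<open>finite G\<close> \<open>F \<subseteq> G\<close> finite_subset by fastforce
next
  fix F G :: "(int^'n) set" assume F: "finite F" and G: "finite G"
  obtain \<V> where \<V>: "refines_along \<U> F \<V>" "card \<V> = cover_number \<U> F"
    using cover_number_attained[OF F] by blast
  obtain \<W> where \<W>: "refines_along \<U> G \<W>" "card \<W> = cover_number \<U> G"
    using cover_number_attained[OF G] by blast
  have "cover_number \<U> (F \<union> G) \<le> card ((\<lambda>(v, w). v \<inter> w) ` (\<V> \<times> \<W>))"
    by (rule cover_number_le[OF refines_Un[OF \<V>(1) \<W>(1)]])
  also have "\<dots> \<le> card (\<V> \<times> \<W>)"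
    using \<V>(1) \<W>(1) by (intro card_image_le) (auto simp: refines_along_def)
  also have "\<dots> = cover_number \<U> F * cover_number \<U> G"
    by (simp add: card_cartesian_product \<V>(2) \<W>(2))
  finally have "real (cover_number \<U> (F \<union> G)) \<le> real (cover_number \<U> F) * real (cover_number \<U> G)"
    by (metis of_nat_le_iff of_nat_mult)
  then have "log 2 (cover_number \<U> (F \<union> G)) \<le> log 2 (real (cover_number \<U> F) * real (cover_number \<U> G))"
    using cover_number_pos[of "F \<union> G"] F G by simp
  also have "\<dots> = log 2 (cover_number \<U> F) + log 2 (cover_number \<U> G)"
    using cover_number_pos[OF F] cover_number_pos[OF G] by (intro log_mult_pos) auto
  finally show "log 2 (cover_number \<U> (F \<union> G)) \<le> log 2 (cover_number \<U> F) + log 2 (cover_number \<U> G)" .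
next
  fix F :: "(int^'n) set" and t assume F: "finite F"
  obtain \<V> where \<V>: "refines_along \<U> F \<V>" "card \<V> = cover_number \<U> F"
    using cover_number_attained[OF F] by blast
  let ?\<W> = "(\<lambda>v. translate (- pt t) ` v) ` \<V>"
  have "\<Union>?\<W> = translate (- pt t) ` \<Union>\<V>"
    by blast
  also have "\<dots> = Adm k"
    using \<V>(1) translate_hull Lat_closed(3) by (auto simp: refines_along_def)
  finally have "\<Union>?\<W> = Adm k" .
  moreover have "\<exists>A\<in>\<U>. translate (- pt t) ` v \<subseteq> translate (- pt (t + z)) ` A" if v: "v \<in> \<V>" "z \<in> F" for v z
  proof -
    obtain A where "A \<in> \<U>" "v \<subseteq> translate (- pt z) ` A"
      using \<V>(1) v unfolding refines_along_def by blast
    then have "translate (- pt t) ` v \<subseteq> translate (- pt t) ` translate (- pt z) ` A"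
      by blast
    also have "\<dots> = translate (- pt (t + z)) ` A"
      by (simp add: image_image translate_translate lattice_point_simps)
    finally show ?thesis
      using \<open>A \<in> \<U>\<close> by blast
  qed
  ultimately have "refines_along \<U> ((+) t ` F) ?\<W>"
    using \<V>(1) by (auto simp: refines_along_def)
  then have "cover_number \<U> ((+) t ` F) \<le> card ?\<W>"
    by (rule cover_number_le)
  also have "\<dots> \<le> card \<V>"
    using \<V>(1) by (intro card_image_le) (auto simp: refines_along_def)
  finally show "log 2 (cover_number \<U> ((+) t ` F)) \<le> log 2 (cover_number \<U> F)"
    using \<V>(2) cover_number_pos[of "(+) t ` F"] F by simp
qed

text \<open>A member of a refining cover lies in an intersection of pulled-back sets, one for each
  window point; replacing it by that intersection yields a subfamily of the join of no larger
  size.\<close>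

lemma min_subcover_card_eq:
  assumes F: "finite F"
  shows "min_subcover_card hull_space (cover_join hull_space (pt ` F) (\<lambda>t. (\<lambda>A. translate (- t) ` A) ` \<U>))
    = cover_number \<U> F"
proof -
  let ?J = "cover_join hull_space (pt ` F) (\<lambda>t. (\<lambda>A. translate (- t) ` A) ` \<U>)"
  let ?P = "\<lambda>m. \<exists>\<V>\<subseteq>?J. finite \<V> \<and> \<Union>\<V> = topspace hull_space \<and> card \<V> = m"
  have ref: "refines_along \<U> F \<V>" if "\<V> \<subseteq> ?J" "finite \<V>" "\<Union>\<V> = Adm k" for \<V>
    unfolding refines_along_def
  proof (intro conjI ballI)
    fix v z assume v: "v \<in> \<V>" and z: "z \<in> F"
    have "v \<in> ?J"
      using v that(1) by blast
    then obtain A where A: "v = topspace hull_space \<inter> (\<Inter>t\<in>pt ` F. A t)" "\<forall>t\<in>pt ` F. A t \<in> (\<lambda>A. translate (- t) ` A) ` \<U>"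
      unfolding cover_join_def mem_Collect_eq by (elim exE conjE) (rule that)
    then obtain A' where "A' \<in> \<U>" "A (pt z) = translate (- pt z) ` A'"
      using z by blast
    then show "\<exists>A\<in>\<U>. v \<subseteq> translate (- pt z) ` A"
      using A(1) z by blast
  qed (use that in auto)
  have join: "\<exists>m\<le>card \<V>. ?P m" if \<V>: "refines_along \<U> F \<V>" for \<V>
  proof -
    have "\<forall>v\<in>\<V>. \<forall>t\<in>pt ` F. \<exists>A\<in>\<U>. v \<subseteq> translate (- t) ` A"
      using \<V> by (auto simp: refines_along_def)
    then obtain f where f: "\<And>v t. v \<in> \<V> \<Longrightarrow> t \<in> pt ` F \<Longrightarrow> f v t \<in> \<U> \<and> v \<subseteq> translate (- t) ` f v t"
      by metis
    define J where "J = (\<lambda>v. topspace hull_space \<inter> (\<Inter>t\<in>pt ` F. translate (- t) ` f v t))"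
    have J: "J v \<in> ?J" if "v \<in> \<V>" for v
      unfolding J_def cover_join_def using f[OF that] by blast
    have sub: "v \<subseteq> J v" if "v \<in> \<V>" for v
      using f[OF that] \<V> that by (fastforce simp: J_def refines_along_def)
    have "\<Union>(J ` \<V>) = topspace hull_space"
    proof
      show "\<Union>(J ` \<V>) \<subseteq> topspace hull_space"
        by (auto simp: J_def)
      show "topspace hull_space \<subseteq> \<Union>(J ` \<V>)"
      proof
        fix X assume "X \<in> topspace hull_space"
        then have "X \<in> \<Union>\<V>"
          using \<V> by (simp add: refines_along_def)
        then obtain v where "v \<in> \<V>" "X \<in> v"
          by blast
        then show "X \<in> \<Union>(J ` \<V>)"
          using sub by blast
      qed
    qed
    then have "?P (card (J ` \<V>))"
      using J \<V> by (intro exI[of _ "J ` \<V>"]) (auto simp: refines_along_def)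
    moreover have "card (J ` \<V>) \<le> card \<V>"
      using \<V> by (intro card_image_le) (auto simp: refines_along_def)
    ultimately show ?thesis
      by blast
  qed
  obtain \<V> where \<V>: "refines_along \<U> F \<V>" "card \<V> = cover_number \<U> F"
    using cover_number_attained[OF F] by blast
  obtain m where m: "m \<le> card \<V>" "?P m"
    using join[OF \<V>(1)] by blast
  have "min_subcover_card hull_space ?J \<le> m"
    unfolding min_subcover_card_def by (rule Least_le[of ?P, OF m(2)])
  then have "min_subcover_card hull_space ?J \<le> cover_number \<U> F"
    using m(1) \<V>(2) by simp
  moreover have "?P (min_subcover_card hull_space ?J)"
    unfolding min_subcover_card_def by (rule LeastI[of ?P, OF m(2)])
  then have "cover_number \<U> F \<le> min_subcover_card hull_space ?J"
    using ref cover_number_le unfolding topspace_hull by metis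
  ultimately show ?thesis
    by simp
qed

definition entropy_rate :: real where
  "entropy_rate = subadditive_set_function.rate (\<lambda>F. log 2 (cover_number \<U> F))"

lemma cover_entropy_at_eq:
  "cover_entropy_at Lat hull_space translate \<U> R = log 2 (cover_number \<U> (disc R)) / vol R"
  unfolding cover_entropy_at_def Lat_Int_ball min_subcover_card_eq[OF finite_disc] by (simp add: vol_def)

lemma tendsto_cover_entropy:
  "((\<lambda>R. log 2 (cover_number \<U> (disc R)) / vol R) \<longlongrightarrow> entropy_rate) at_top"
  unfolding entropy_rate_def by (rule subadditive_set_function.tendsto_rate[OF subadditive_cover_number])

text \<open>A Lebesgue number in terms of windows: by compactness finitely many cylinders, each
  inside a member of the cover, suffice, and the union of their windows serves for all of
  them.\<close>

lemma ex_window: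
  "\<exists>F. finite F \<and> F \<subseteq> Lat \<and> (\<forall>X\<in>Adm k. \<exists>A\<in>\<U>. \<forall>Y\<in>Adm k. Y \<inter> F = X \<inter> F \<longrightarrow> Y \<in> A)"
proof -
  have "\<exists>A F. A \<in> \<U> \<and> finite F \<and> F \<subseteq> Lat \<and> (\<forall>Y\<in>Adm k. Y \<inter> F = X \<inter> F \<longrightarrow> Y \<in> A)"
    if X: "X \<in> Adm k" for X
  proof -
    obtain A where "A \<in> \<U>" "X \<in> A" "openin hull_space A"
      using \<U> X unfolding finite_open_cover_def topspace_hull by blast
    then show ?thesis
      unfolding openin_hull by blast
  qed
  then obtain A F where AF: "\<And>X. X \<in> Adm k \<Longrightarrow> A X \<in> \<U> \<and> finite (F X) \<and> F X \<subseteq> Lat \<and>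
      (\<forall>Y\<in>Adm k. Y \<inter> F X = X \<inter> F X \<longrightarrow> Y \<in> A X)"
    by metis
  let ?C = "\<lambda>X. {Y \<in> Adm k. Y \<inter> F X = X \<inter> F X}"
  have "\<exists>\<F>. finite \<F> \<and> \<F> \<subseteq> ?C ` Adm k \<and> topspace hull_space \<subseteq> \<Union>\<F>"
    using compact_space_hull unfolding compact_space_alt
  proof (elim allE impE)
    show "(\<forall>U\<in>?C ` Adm k. openin hull_space U) \<and> topspace hull_space \<subseteq> \<Union>(?C ` Adm k)"
      using AF by (auto intro!: openin_hull_cylinder)
  qed
  then obtain \<F> where \<F>: "finite \<F>" "\<F> \<subseteq> ?C ` Adm k" "Adm k \<subseteq> \<Union>\<F>"
    unfolding topspace_hull by blast
  obtain T where T: "finite T" "T \<subseteq> Adm k" "\<F> = ?C ` T"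
    using finite_subset_image[OF \<F>(1,2)] by blast
  note T = T(1,2) \<F>(3)[unfolded T(3)]
  show ?thesis
  proof (intro exI[of _ "\<Union>(F ` T)"] conjI ballI)
    show "finite (\<Union>(F ` T))" "\<Union>(F ` T) \<subseteq> Lat"
      using T AF by blast+
    fix X assume "X \<in> Adm k"
    then obtain X' where X': "X' \<in> T" "X \<inter> F X' = X' \<inter> F X'"
      using T(3) by blast
    then have X'a: "X' \<in> Adm k"
      using T(2) by blast
    have "Y \<in> A X'" if Y: "Y \<in> Adm k" "Y \<inter> \<Union>(F ` T) = X \<inter> \<Union>(F ` T)" for Y
    proof -
      have "Y \<inter> F X' = X' \<inter> F X'"
        using Y(2) X' by blast
      then show ?thesis
        using AF[OF X'a] Y(1) by blast
    qed
    then show "\<exists>A\<in>\<U>. \<forall>Y\<in>Adm k. Y \<inter> \<Union>(F ` T) = X \<inter> \<Union>(F ` T) \<longrightarrow> Y \<in> A"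
      using AF[OF X'a] by (intro bexI[of _ "A X'"] ballI impI) simp_all
  qed
qed

lemma cover_number_le_patterns:
  "\<exists>r. \<forall>R. cover_number \<U> (disc R) \<le> card (patterns (disc (R + r)))"
proof -
  obtain F where F: "finite F" "F \<subseteq> Lat"
    "\<forall>X\<in>Adm k. \<exists>A\<in>\<U>. \<forall>Y\<in>Adm k. Y \<inter> F = X \<inter> F \<longrightarrow> Y \<in> A"
    using ex_window by (elim exE conjE) (rule that)
  \<comment> \<open>A radius bounding the window; taking the sum also covers an empty
    \<open>F\<close>.\<close>
  define r where "r = (\<Sum>x\<in>F. norm x)"
  have r: "norm x \<le> r" if "x \<in> F" for x
    unfolding r_def using F(1) that by (intro member_le_sum) auto
  have "cover_number \<U> (disc R) \<le> card (patterns (disc (R + r)))" for R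
  proof -
    let ?G = "disc (R + r)"
    let ?v = "\<lambda>P. {X \<in> Adm k. pt -` X \<inter> ?G = P}"
    have "refines_along \<U> (disc R) (?v ` patterns ?G)"
      unfolding refines_along_def
    proof (intro conjI ballI)
      show "finite (?v ` patterns ?G)"
        by (simp add: finite_patterns)
      show "\<Union>(?v ` patterns ?G) = Adm k"
        by (auto simp: patterns_def)
      fix v z assume "v \<in> ?v ` patterns ?G" and z: "z \<in> disc R"
      then obtain X where X: "X \<in> Adm k" "v = ?v (pt -` X \<inter> ?G)"
        by (auto simp: patterns_def)
      obtain A where A: "A \<in> \<U>" "\<And>Y. Y \<in> Adm k \<Longrightarrow> Y \<inter> F = translate (pt z) X \<inter> F \<Longrightarrow> Y \<in> A"
        using bspec[OF F(3) translate_in_hull[OF X(1), of "pt z"]] by blast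
      have "translate (pt z) Y \<in> A" if Y: "Y \<in> v" for Y
      proof (rule A(2))
        show "translate (pt z) Y \<in> Adm k"
          using Y X(2) translate_in_hull by blast
        have "pt f \<in> translate (pt z) Y \<longleftrightarrow> pt f \<in> translate (pt z) X" if f: "pt f \<in> F" for f
        proof -
          \<comment> \<open>Looking at \<open>f\<close> in the translate by \<open>z\<close> is
            looking at \<open>f - z\<close> in the original set, so the pattern in the enlarged disc
            decides.\<close>
          have "- z \<in> disc R"
            using z by (simp add: disc_def lattice_point_simps)
          then have "- z + f \<in> ?G"
            using disc_translate r[OF f] by blast
          then have "f - z \<in> ?G"
            by simp
          moreover have "pt -` Y \<inter> ?G = pt -` X \<inter> ?G"
            using Y X(2) by blast
          ultimately show ?thesis
            unfolding pt_in_translate by blast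
        qed
        then show "translate (pt z) Y \<inter> F = translate (pt z) X \<inter> F"
          using F(2) by blast
      qed
      then have "v \<subseteq> translate (- pt z) ` A"
        unfolding subset_iff translate_image_iff by blast
      then show "\<exists>A\<in>\<U>. v \<subseteq> translate (- pt z) ` A"
        using A(1) by blast
    qed
    then have "cover_number \<U> (disc R) \<le> card (?v ` patterns ?G)"
      by (rule cover_number_le)
    also have "\<dots> \<le> card (patterns ?G)"
      by (intro card_image_le finite_patterns) simp
    finally show ?thesis .
  qed
  then show ?thesis
    by blast
qed

end

section \<open>The upper bound for the entropy: counting patterns\<close>

lemma has_density_shift:
  assumes "has_density S d"
  shows "((\<lambda>R. card (S \<inter> disc (R + r)) / vol R) \<longlongrightarrow> d) at_top"
proof -
  have "((\<lambda>R. card (S \<inter> disc (R + r)) / vol (R + r)) \<longlongrightarrow> d) at_top"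
    using assms unfolding has_density_def
    by (rule filterlim_compose)
      (subst add.commute, rule filterlim_tendsto_add_at_top[OF tendsto_const filterlim_ident])
  then have "((\<lambda>R. card (S \<inter> disc (R + r)) / vol (R + r) * (vol (R + r) / vol R)) \<longlongrightarrow> d * 1) at_top"
    by (intro tendsto_mult vol_shift_ratio)
  moreover have "\<forall>\<^sub>F R in at_top. card (S \<inter> disc (R + r)) / vol (R + r) * (vol (R + r) / vol R)
      = card (S \<inter> disc (R + r)) / vol R"
    using eventually_gt_at_top[of "max 0 (- r)"]
  proof eventually_elim
    case (elim R)
    then have "vol (R + r) > 0"
      by (intro vol_pos) auto
    then show ?case
      by simp
  qed
  ultimately show ?thesis
    by (auto intro: Lim_transform_eventually)
qed

text \<open>For fixed \<open>P\<close> the number of choices of missed classes is a constant,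
  absorbed by \<open>K\<close>, and vanishes after division by the volume. The shift
  \<open>r\<close> is there because the cylinders that refine a general cover look a fixed distance
  beyond the disc.\<close>

lemma card_patterns_le:
  assumes \<epsilon>: "\<epsilon> > 0"
  shows "\<exists>K>0. \<forall>\<^sub>F R in at_top. log 2 (card (patterns (disc (R + r))))
    \<le> K + (1 / zeta (real (CARD('n) * k)) + \<epsilon>) * vol R"
proof -
  let ?s = "CARD('n) * k"
  obtain P where P: "(\<Prod>p\<in>{p. prime p \<and> p \<le> P}. 1 - 1 / real p ^ ?s) \<le> 1 / zeta (real ?s) + \<epsilon> / 2"
    using euler_product_le[OF k2, of "\<epsilon> / 2"] \<epsilon> by auto
  define S where "S = {p. prime p \<and> p \<le> P}"
  define D where "D = (\<Prod>p\<in>S. 1 - 1 / real p ^ ?s)"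
  \<comment> \<open>One class for each small prime, as candidates for the missed classes.\<close>
  define Ch where "Ch = (\<Pi>\<^sub>E p\<in>S. res_box (int p ^ k) :: (int^'n) set)"
  define Av where "Av = (\<lambda>c. {z :: int^'n. \<forall>p\<in>S. pmod k p z \<in> res_box (int p ^ k) - {c p}})"
  define d where "d = 1 / zeta (real ?s) + \<epsilon>"
  have finS: "finite S"
    by (simp add: S_def)
  have Ch: "finite Ch" "Ch \<noteq> {}"
  proof -
    show "finite Ch"
      unfolding Ch_def using finS by (intro finite_PiE) auto
    have "(\<lambda>p\<in>S. pmod k p 0) \<in> Ch"
      unfolding Ch_def using prime_gt_0_nat by (intro restrict_PiE_iff[THEN iffD2] ballI vmod_in_res_box) (simp add: S_def)
    then show "Ch \<noteq> {}"
      by blast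
  qed
  have "D < d"
    using P \<epsilon> by (simp add: D_def S_def d_def)
  have "\<forall>\<^sub>F R in at_top. card (Av c \<inter> disc (R + r)) / vol R < d" if c: "c \<in> Ch" for c
  proof -
    have "has_density (Av c) D"
      unfolding Av_def D_def using finS c by (intro has_density_avoid) (auto simp: S_def Ch_def PiE_iff)
    then show ?thesis
      by (intro order_tendstoD(2)[OF has_density_shift \<open>D < d\<close>])
  qed
  then have ev: "\<forall>\<^sub>F R in at_top. \<forall>c\<in>Ch. card (Av c \<inter> disc (R + r)) / vol R < d"
    using Ch(1) by (intro eventually_ball_finite) auto
  have "\<forall>\<^sub>F R in at_top. log 2 (card (patterns (disc (R + r)))) \<le> log 2 (card Ch) + d * vol R"
    using ev eventually_gt_at_top[of 0]
  proof eventually_elim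
    case (elim R)
    let ?G = "disc (R + r)"
    have "patterns ?G \<subseteq> (\<Union>c\<in>Ch. Pow (Av c \<inter> ?G))"
    proof
      fix Q assume "Q \<in> patterns ?G"
      then obtain X where X: "X \<in> Adm k" "Q = pt -` X \<inter> ?G"
        by (auto simp: patterns_def)
      obtain c where c: "\<And>p z. prime p \<Longrightarrow> pt z \<in> X \<Longrightarrow> pmod k p z \<noteq> pmod k p (c p)"
        using missing_residues[OF X(1)] by blast
      let ?c = "\<lambda>p\<in>S. pmod k p (c p)"
      have pos: "int p ^ k > 0" if "p \<in> S" for p
        using that prime_gt_0_nat by (simp add: S_def)
      have "?c \<in> Ch"
        using pos by (auto simp: Ch_def vmod_in_res_box)
      moreover have "Q \<subseteq> Av ?c \<inter> ?G"
        using X(2) c pos by (auto simp: Av_def S_def vmod_in_res_box)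
      ultimately show "Q \<in> (\<Union>c\<in>Ch. Pow (Av c \<inter> ?G))"
        by blast
    qed
    then have "card (patterns ?G) \<le> card (\<Union>c\<in>Ch. Pow (Av c \<inter> ?G))"
      using Ch(1) by (intro card_mono) auto
    also have "\<dots> \<le> (\<Sum>c\<in>Ch. card (Pow (Av c \<inter> ?G)))"
      by (rule card_UN_le[OF Ch(1)])
    also have "\<dots> = (\<Sum>c\<in>Ch. 2 ^ card (Av c \<inter> ?G))"
      by (intro sum.cong refl card_Pow) simp
    finally have "card (patterns ?G) \<le> (\<Sum>c\<in>Ch. 2 ^ card (Av c \<inter> ?G))" .
    then have "real (card (patterns ?G)) \<le> real (\<Sum>c\<in>Ch. 2 ^ card (Av c \<inter> ?G))"
      by (rule of_nat_mono)
    also have "\<dots> = (\<Sum>c\<in>Ch. 2 ^ card (Av c \<inter> ?G))"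
      by simp
    also have "\<dots> \<le> (\<Sum>c\<in>Ch. 2 powr (d * vol R))"
    proof (rule sum_mono)
      fix c assume c: "c \<in> Ch"
      have "card (Av c \<inter> ?G) \<le> d * vol R"
        using bspec[OF elim(1) c] vol_pos[OF elim(2)] by (simp add: field_simps)
      then show "2 ^ card (Av c \<inter> ?G) \<le> 2 powr (d * vol R)"
        by (simp flip: powr_realpow)
    qed
    also have "\<dots> = card Ch * 2 powr (d * vol R)"
      by simp
    finally have le: "real (card (patterns ?G)) \<le> card Ch * 2 powr (d * vol R)" .
    have pos: "card (patterns ?G) > 0" "card Ch > 0"
      using Ch empty_in_hull finite_patterns[of ?G] by (auto simp: card_gt_0_iff patterns_def)
    then have "log 2 (card (patterns ?G)) \<le> log 2 (card Ch * 2 powr (d * vol R))"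
      using le by simp
    also have "\<dots> = log 2 (card Ch) + d * vol R"
      using pos by (subst log_mult_pos) auto
    finally show ?case .
  qed
  then have "\<forall>\<^sub>F R in at_top. log 2 (card (patterns (disc (R + r)))) \<le> \<bar>log 2 (card Ch)\<bar> + 1 + d * vol R"
    by eventually_elim linarith
  then show ?thesis
    unfolding d_def by (intro exI[of _ "\<bar>log 2 (card Ch)\<bar> + 1"]) auto
qed

lemma entropy_rate_le:
  assumes \<U>: "finite_open_cover hull_space \<U>"
  shows "entropy_rate \<U> \<le> 1 / zeta (real (CARD('n) * k))"
proof (rule field_le_epsilon)
  fix \<epsilon> :: real assume \<epsilon>: "\<epsilon> > 0"
  let ?d = "1 / zeta (real (CARD('n) * k)) + \<epsilon>"
  obtain r where r: "\<And>R. cover_number \<U> (disc R) \<le> card (patterns (disc (R + r)))"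
    using cover_number_le_patterns[OF \<U>] by blast
  obtain K where K: "\<forall>\<^sub>F R in at_top. log 2 (card (patterns (disc (R + r)))) \<le> K + ?d * vol R"
    using card_patterns_le[OF \<epsilon>, of r] by blast
  have "((\<lambda>R. K / vol R + ?d) \<longlongrightarrow> 0 + ?d) at_top"
    by (intro tendsto_add tendsto_const tendsto_divide_0[OF tendsto_const]
        filterlim_at_top_imp_at_infinity vol_at_top)
  moreover have "\<forall>\<^sub>F R in at_top. log 2 (cover_number \<U> (disc R)) / vol R \<le> K / vol R + ?d"
    using K eventually_gt_at_top[of 0]
  proof eventually_elim
    case (elim R)
    have "log 2 (cover_number \<U> (disc R)) \<le> log 2 (card (patterns (disc (R + r))))"
      using r[of R] cover_number_pos[OF \<U>, of "disc R"] by simp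
    also have "\<dots> \<le> K + ?d * vol R"
      by (rule elim(1))
    finally show ?case
      using vol_pos[OF elim(2)] by (simp add: field_simps)
  qed
  ultimately show "entropy_rate \<U> \<le> ?d"
    using tendsto_le[OF trivial_limit_at_top_linorder _ tendsto_cover_entropy[OF \<U>]] by simp
qed

section \<open>The lower bound for the entropy: a cover that separates patterns\<close>

text \<open>The partition by membership of the origin; its translates read off a set point by point,
  so this one cover already attains the supremum.\<close>

definition origin_cover :: "(real^'n) set set set" where
  "origin_cover = {{X \<in> Adm k. 0 \<in> X}, {X \<in> Adm k. 0 \<notin> X}}"

lemma finite_open_origin_cover: "finite_open_cover hull_space origin_cover"
proof -
  have "{X \<in> Adm k. 0 \<in> X} = {X \<in> Adm k. X \<inter> {0} = {0}}"
    "{X \<in> Adm k. 0 \<notin> X} = {X \<in> Adm k. X \<inter> {0} = {}}"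
    by auto
  moreover have "openin hull_space {X \<in> Adm k. X \<inter> {0} = P}" for P
    by (rule openin_hull_cylinder) (use Lat_closed(4) in auto)
  ultimately have "openin hull_space {X \<in> Adm k. 0 \<in> X}" "openin hull_space {X \<in> Adm k. 0 \<notin> X}"
    by (simp_all only:)
  then show ?thesis
    by (auto simp: finite_open_cover_def origin_cover_def)
qed

text \<open>All subsets of the k-free points in the disc lie in the hull, and two of them in the
  same member of a refining cover agree at each point of the disc.\<close>

lemma cover_number_origin_ge: "2 ^ card (power_free k \<inter> disc R) \<le> cover_number origin_cover (disc R)"
proof -
  obtain \<V> where \<V>: "refines_along origin_cover (disc R) \<V>" "card \<V> = cover_number origin_cover (disc R)"
    using cover_number_attained[OF finite_open_origin_cover finite_disc] by blast
  let ?D = "Pow (power_free k \<inter> disc R)"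
  have "\<exists>v\<in>\<V>. pt ` T \<in> v" if "T \<in> ?D" for T
  proof -
    have "pt ` T \<in> Adm k"
      using that by (intro hull_mono[OF power_free_in_hull]) auto
    then show ?thesis
      using \<V>(1) by (auto simp: refines_along_def)
  qed
  then obtain v where v: "\<And>T. T \<in> ?D \<Longrightarrow> v T \<in> \<V> \<and> pt ` T \<in> v T"
    by metis
  have "inj_on v ?D"
  proof (rule inj_onI)
    fix T T' assume T: "T \<in> ?D" "T' \<in> ?D" and eq: "v T = v T'"
    have "z \<in> T \<longleftrightarrow> z \<in> T'" if z: "z \<in> disc R" for z
    proof -
      \<comment> \<open>The set pulled back at \<open>- z\<close> tests membership of
        \<open>z\<close>, and the disc is symmetric.\<close>
      have "- z \<in> disc R"
        using z by (simp add: disc_def lattice_point_simps)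
      then obtain A where A: "A \<in> origin_cover" "v T \<subseteq> translate (- pt (- z)) ` A"
        using \<V>(1) v[OF T(1)] unfolding refines_along_def by blast
      then have "translate (pt (- z)) (pt ` T) \<in> A" "translate (pt (- z)) (pt ` T') \<in> A"
        using v[OF T(1)] v[OF T(2)] eq by (auto simp flip: translate_image_iff)
      moreover have "0 \<in> translate (pt (- z)) (pt ` W) \<longleftrightarrow> z \<in> W" for W
        using pt_in_translate[of 0 "- z" "pt ` W"] by (auto simp: lattice_point_simps)
      ultimately show ?thesis
        using A(1) by (auto simp: origin_cover_def)
    qed
    then show "T = T'"
      using T by auto
  qed
  then have "card ?D \<le> card \<V>"
    using v \<V>(1) by (intro card_inj_on_le[of v]) (auto simp: refines_along_def)
  then show ?thesis
    using \<V>(2) by (simp add: card_Pow del: Pow_Int_eq)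
qed

lemma entropy_rate_origin_ge: "entropy_rate origin_cover \<ge> 1 / zeta (real (CARD('n) * k))"
proof (rule field_le_epsilon)
  fix \<epsilon> :: real assume \<epsilon>: "\<epsilon> > 0"
  let ?d = "1 / zeta (real (CARD('n) * k)) - \<epsilon>"
  have "\<forall>\<^sub>F R in at_top. ?d \<le> log 2 (cover_number origin_cover (disc R)) / vol R"
    using power_free_density_ge[OF k1 k2 \<epsilon>] eventually_gt_at_top[of 0]
  proof eventually_elim
    case (elim R)
    have "?d * vol R \<le> card (power_free k \<inter> disc R)"
      by (rule elim(1))
    also have "\<dots> = log 2 (2 ^ card (power_free k \<inter> disc R))"
      by (simp add: log_nat_power)
    also have "\<dots> \<le> log 2 (cover_number origin_cover (disc R))"
    proof -
      have "(2 :: real) ^ card (power_free k \<inter> disc R) \<le> cover_number origin_cover (disc R)"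
        using of_nat_mono[OF cover_number_origin_ge[of R], where 'a = real] by simp
      then show ?thesis
        by (intro log_mono) auto
    qed
    finally show ?case
      using vol_pos[OF elim(2)] by (simp add: field_simps)
  qed
  then have "?d \<le> entropy_rate origin_cover"
    by (intro tendsto_lowerbound[OF tendsto_cover_entropy[OF finite_open_origin_cover]]) auto
  then show "1 / zeta (real (CARD('n) * k)) \<le> entropy_rate origin_cover + \<epsilon>"
    by linarith
qed

lemma entropy_hull:
  "has_topological_entropy Lat hull_space translate (ereal (1 / zeta (real (CARD('n) * k))))"
  unfolding has_topological_entropy_def
proof (intro exI[of _ "\<lambda>\<U>. ereal (entropy_rate \<U>)"] conjI allI impI)
  fix \<U> assume \<U>: "finite_open_cover hull_space \<U>"
  show "((\<lambda>R. ereal (cover_entropy_at Lat hull_space translate \<U> R)) \<longlongrightarrow> ereal (entropy_rate \<U>)) at_top"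
    unfolding cover_entropy_at_eq[OF \<U>] using tendsto_cover_entropy[OF \<U>] by simp
next
  show "ereal (1 / zeta (real (CARD('n) * k))) =
      (SUP \<U>\<in>{\<U>. finite_open_cover hull_space \<U>}. ereal (entropy_rate \<U>))"
  proof (rule antisym)
    have "ereal (1 / zeta (real (CARD('n) * k))) \<le> ereal (entropy_rate origin_cover)"
      using entropy_rate_origin_ge by simp
    also have "\<dots> \<le> (SUP \<U>\<in>{\<U>. finite_open_cover hull_space \<U>}. ereal (entropy_rate \<U>))"
      by (rule SUP_upper) (simp add: finite_open_origin_cover)
    finally show "ereal (1 / zeta (real (CARD('n) * k))) \<le>
        (SUP \<U>\<in>{\<U>. finite_open_cover hull_space \<U>}. ereal (entropy_rate \<U>))" .
    show "(SUP \<U>\<in>{\<U>. finite_open_cover hull_space \<U>}. ereal (entropy_rate \<U>)) \<le>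
        ereal (1 / zeta (real (CARD('n) * k)))"
      by (rule SUP_least) (use entropy_rate_le in auto)
  qed
qed

end

theorem theorem6:
  fixes \<Lambda> :: "(real^'n) set" and k :: nat
  assumes "k \<ge> 1"
    and "\<not> (CARD('n) = 1 \<and> k = 1)"
    and "is_lattice \<Lambda>"
    and "\<bar>lattice_det \<Lambda>\<bar> = 1"
  shows
    "(topologically_ergodic \<Lambda> (hull_topology \<Lambda> k) translate \<and>
      has_topological_entropy \<Lambda> (hull_topology \<Lambda> k) translate
        (ereal (1 / zeta (real (CARD('n) * k)))) \<and>
      1 / zeta (real (CARD('n) * k)) > 0)
   \<and> (proximal \<Lambda> (k_free_hull \<Lambda> k) subset_dist translate \<and>
      (\<forall>M. minimal_subset \<Lambda> (hull_topology \<Lambda> k) translate M \<longleftrightarrow> M = {{}}))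
   \<and> ((\<forall>(Y :: 'y topology) actY.
         kronecker_factor \<Lambda> (hull_topology \<Lambda> k) translate Y actY \<longrightarrow> (\<exists>y. topspace Y = {y})) \<and>
      trivial_point_spectrum \<Lambda> (hull_topology \<Lambda> k) translate)
   \<and> ((\<exists>J. joining \<Lambda> (hull_topology \<Lambda> k) translate
             (kronecker_topology \<Lambda> k) (kronecker_action \<Lambda> k) J \<and>
           J \<noteq> topspace (hull_topology \<Lambda> k) \<times> topspace (kronecker_topology \<Lambda> k)) \<and>
      \<not> topologically_weakly_mixing \<Lambda> (hull_topology \<Lambda> k) translate)"
proof -
  \<comment> \<open>The same choice as in \<open>lattice_det\<close>, so that the hypothesis on the
    determinant speaks about this basis.\<close>
  define B where "B = (SOME B. lattice_basis B \<Lambda>)"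
  have B: "lattice_basis B \<Lambda>"
    using assms(3) unfolding B_def is_lattice_def by (rule someI_ex)
  have "CARD('n) * k \<ge> 2"
  proof (cases "k = 1")
    case True
    then have "CARD('n) \<noteq> 1" "CARD('n) \<noteq> 0"
      using assms(2) by auto
    then have "CARD('n) \<ge> 2"
      by linarith
    then show ?thesis
      using True by simp
  next
    case False
    then have "1 * 2 \<le> CARD('n) * k"
      using assms(1) by (intro mult_le_mono) (simp_all add: Suc_le_eq)
    then show ?thesis
      by simp
  qed
  moreover have "\<bar>det B\<bar> = 1"
    using assms(4) by (simp only: lattice_det_def B_def[symmetric])
  ultimately interpret k_free_system B k
    using assms(1) B by unfold_locales (simp_all add: lattice_basis_def)
  have \<Lambda>: "\<Lambda> = range (lattice_point B)"
    using B by (simp add: lattice_basis_def)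
  have "1 / zeta (real (CARD('n) * k)) > 0"
    using zeta_ge_1[OF k2] by simp
  then show ?thesis
    unfolding \<Lambda> hull_closure
    using ergodic_hull entropy_hull proximal_hull minimal_subset_hull kronecker_factor_trivial
      trivial_point_spectrum_hull joining_kronecker kronecker_joining_nontrivial not_weakly_mixing_hull
    by blast
qed

end
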